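(* Let $n,m\ge 1$ be natural numbers and let $f\in L^2(\mathbb{R}_+^n)$ and $g\in L^2(\mathbb{R}_+^m)$ be symmetric functions. Then: (i) $I_n^S(f)$ and $I_m^S(g)$ are free if and only if $f\stackrel{1}{\frown}g=0$ almost everywhere. (ii) $I_n^{\hat N}(f)$ and $I_m^{\hat N}(g)$ are free if and only if $f\star_1^0 g=0$ almost everywhere.
   Context: $\mathbb{R}_+=[0,\infty)$ with Lebesgue measure; $L^2(\mathbb{R}_+^n)$ is the space of complex-valued square-integrable functions. A function $f\in L^2(\mathbb{R}_+^n)$ is called symmetric if it is real-valued and $f(t_1,\dots,t_n)=f(t_{\sigma(1)},\dots,t_{\sigma(n)})$ for a.e. $(t_1,\dots,t_n)$ and every permutation $\sigma$. Its adjoint is $f^*(t_1,\dots,t_n)=\overline{f(t_n,\dots,t_1)}$. $(\mathscr{A},\varphi)$ is a tracial $W^*$-probability space: $\mathscr{A}$ is a von Neumann algebra and $\varphi:\mathscr{A}\to\mathbb{C}$ is a unital, weakly continuous, positive, faithful, tracial linear functional. $L^2(\mathscr{A},\varphi)$ is the completion of $\mathscr{A}$ for $\|X\|_2=\sqrt{\varphi(XX^* )}$. Freeness: $X_1,\dots,X_d$ are free if $\varphi\big([P_1(X_{i_1})-\varphi(P_1(X_{i_1}))]\cdots[P_r(X_{i_r})-\varphi(P_r(X_{i_r}))]\big)=0$ whenever $r\ge1$, $P_1,\dots,P_r$ are polynomials and $i_1,\dots,i_r\in\{1,\dots,d\}$ have no two adjacent indices equal. Free Brownian motion $S=\{S_t\}_{t\ge0}$: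 self-adjoint elements of $\mathscr{A}$, adapted to an increasing filtration $(\mathscr{A}_t)_{t\ge 0}$ of von Neumann subalgebras, with $S_0=0$ and such that for $0\le u<t$ the increment $S_t-S_u$ is free from $\mathscr{A}_u$ and has the centered semicircular law of variance $t-u$, with density $(2\pi(t-u))^{-1}\sqrt{4(t-u)-x^2}$ on $[-2\sqrt{t-u},2\sqrt{t-u}]$. Free Poisson process $N=\{N_t\}_{t\ge0}$: positive elements of $\mathscr{A}$ adapted to such a filtration, with $N_0=0$ and $N_t-N_u$ free from $\mathscr{A}_u$ with the free Poisson law of rate $\lambda=t-u$, i.e. $(1-\lambda)\delta_0+\tilde\nu$ if $\lambda\le1$ (with the understanding that $\tilde\nu$ carries mass $\lambda$) and $\tilde\nu$ if $\lambda>1$, where $\tilde\nu(dx)=(2\pi x)^{-1}\sqrt{4\lambda-(x-1-\lambda)^2}\,dx$ on $[(1-\sqrt\lambda)^2,(1+\sqrt\lambda)^2]$. $\hat N_t=N_t-t\mathbf{1}$ is the compensated process. Multiple integrals: for $\mathfrak{M}\in\{S,\hat N\}$, $I_n^{\mathfrak{M}}$ is the linear map $L^2(\mathbb{R}_+^n)\to L^2(\mathscr{A},\varphi)$ determined by $I_n^{\mathfrak{M}}(\mathbf{1}_{[a_1,b_1]\times\cdots\times[a_n,b_n]})=(\mathfrak{M}_{b_1}-\mathfrak{M}_{a_1})\cdots(\mathfrak{M}_{b_n}-\mathfrak{M}_{a_n})$ for pairwise disjoint intervals and extended by linearity and the isometry $\varphi(I_n^{\mathfrak{M}}(f)I_n^{\mathfrak{M}}(g)^*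 )=\langle f,g\rangle_{L^2(\mathbb{R}_+^n)}$; $I_0^{\mathfrak M}(c)=c\mathbf 1$. $I^S$ are Wigner integrals, $I^{\hat N}$ free Poisson integrals. Integrals of different orders are orthogonal, and $I_n^{\mathfrak{M}}(f)^*=I_n^{\mathfrak{M}}(f^* )$. Contractions, for $f\in L^2(\mathbb{R}_+^n)$, $g\in L^2(\mathbb{R}_+^m)$: for $0\le p\le n\wedge m$, $(f\stackrel{p}{\frown}g)(t_1,\dots,t_{n+m-2p})=\int_{\mathbb{R}_+^p}f(t_1,\dots,t_{n-p},s_1,\dots,s_p)\,g(s_p,\dots,s_1,t_{n-p+1},\dots,t_{n+m-2p})\,ds_1\cdots ds_p$; and for $1\le p\le n\wedge m$, $(f\star_p^{p-1}g)(t_1,\dots,t_{n+m-2p+1})=\int_{\mathbb{R}_+^{p-1}}f(t_1,\dots,t_{n-p+1},s_{p-1},\dots,s_1)\,g(s_1,\dots,s_{p-1},t_{n-p+1},\dots,t_{n+m-2p+1})\,ds_1\cdots ds_{p-1}$. In particular $(f\star_1^0 g)(t_1,\dots,t_{n+m-1})=f(t_1,\dots,t_n)g(t_n,\dots,t_{n+m-1})$. Standing convention: the multiple integrals span a unital $*$-algebra, with products (hence moments) computed by $I_n^S(f)I_m^S(g)=\sum_{p=0}^{n\wedge m}I_{n+m-2p}^S(f\stackrel{p}{\frown}g)$ in the Wigner case and $I_n^{\hat N}(f)I_m^{\hat N}(g)=\sum_{p=0}^{n\wedge m}I_{n+m-2p}^{\hat N}(f\stackrel{p}{\frown}g)+\sum_{p=1}^{n\wedge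 m}I_{n+m-2p+1}^{\hat N}(f\star_p^{p-1}g)$ in the free Poisson case.
   Formalization: In (ii), f and g are taken from a class of square-integrable kernels stable under sums, scalars, adjoints and all contractions, on which the product formula holds; for general f in L² the kernel f⋆₁⁰f need not be in L², so the free Poisson product formula and moments are undefined. *)

theory Defs
  imports "HOL-Analysis.Analysis" "HOL-Computational_Algebra.Polynomial"
begin

section \<open>Complex Hilbert spaces and von Neumann algebras\<close>

text \<open>The complex inner product is linear in its first argument. The real inner product of the
  underlying real Hilbert space, and hence its norm, is the real part of the complex one.\<close>

class complex_hilbert_space = real_inner + complete_space +
  fixes scaleC :: "complex \<Rightarrow> 'a \<Rightarrow> 'a" (infixr "*\<^sub>C" 75)
    and cinner :: "'a \<Rightarrow> 'a \<Rightarrow> complex"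
  assumes scaleC_add_right: "c *\<^sub>C (x + y) = c *\<^sub>C x + c *\<^sub>C y"
    and scaleC_add_left: "(c + d) *\<^sub>C x = c *\<^sub>C x + d *\<^sub>C x"
    and scaleC_scaleC: "c *\<^sub>C (d *\<^sub>C x) = (c * d) *\<^sub>C x"
    and scaleC_of_real: "complex_of_real r *\<^sub>C x = r *\<^sub>R x"
    and cinner_commute: "cinner x y = cnj (cinner y x)"
    and cinner_add_left: "cinner (x + y) z = cinner x z + cinner y z"
    and cinner_scaleC_left: "cinner (c *\<^sub>C x) y = c * cinner x y"
    and Re_cinner: "Re (cinner x y) = x \<bullet> y"

lemma cinner_self: "cinner x x = complex_of_real ((norm x)\<^sup>2)"
  for x :: "'a::complex_hilbert_space"
proof (rule complex_eqI)
  have "Im (cinner x x) = Im (cnj (cinner x x))"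
    using cinner_commute[of x x] by simp
  then show "Im (cinner x x) = Im (complex_of_real ((norm x)\<^sup>2))"
    by simp
qed (simp add: Re_cinner dot_square_norm)

lemma norm_scaleC: "norm (c *\<^sub>C x) = cmod c * norm x"
  for x :: "'a::complex_hilbert_space"
proof -
  have "cinner (c *\<^sub>C x) (c *\<^sub>C x) = c * cnj c * cinner x x"
    using cinner_commute[of x "c *\<^sub>C x"] cinner_commute[of x x]
    by (simp add: cinner_scaleC_left)
  then have "complex_of_real ((norm (c *\<^sub>C x))\<^sup>2) = complex_of_real ((cmod c * norm x)\<^sup>2)"
    by (simp add: cinner_self power_mult_distrib complex_norm_square[of c, symmetric])
  then have "(norm (c *\<^sub>C x))\<^sup>2 = (cmod c * norm x)\<^sup>2"
    by (simp only: of_real_eq_iff)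
  then show ?thesis
    by (rule power2_eq_imp_eq) simp_all
qed

lemma bounded_linear_scaleC: "bounded_linear (\<lambda>x :: 'a::complex_hilbert_space. c *\<^sub>C x)"
  for c :: complex
proof (rule bounded_linear_intro[where K = "cmod c"])
  show "c *\<^sub>C (x + y) = c *\<^sub>C x + c *\<^sub>C y" for x y :: 'a
    by (rule scaleC_add_right)
  show "c *\<^sub>C (r *\<^sub>R x) = r *\<^sub>R (c *\<^sub>C x)" for r :: real and x :: 'a
    by (simp add: scaleC_of_real[symmetric] scaleC_scaleC mult.commute)
  show "norm (c *\<^sub>C x) \<le> norm x * cmod c" for x :: 'a
    by (simp add: norm_scaleC mult.commute)
qed

text \<open>Bounded operators are represented by the real bounded linear maps of the library; the
  complex-linear ones are singled out by \<open>clinear_op\<close>. The product of operators is \<open>(o\<^sub>L)\<close>.\<close>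

type_synonym 'h op = "'h \<Rightarrow>\<^sub>L 'h"

definition clinear_op :: "'h::complex_hilbert_space op \<Rightarrow> bool" where
  "clinear_op T \<longleftrightarrow> (\<forall>c x. blinfun_apply T (c *\<^sub>C x) = c *\<^sub>C blinfun_apply T x)"

lift_definition scale_op :: "complex \<Rightarrow> 'h::complex_hilbert_space op \<Rightarrow> 'h op"
  is "\<lambda>c T x. c *\<^sub>C T x"
  by (rule bounded_linear_compose[OF bounded_linear_scaleC])

definition is_adj :: "'h::complex_hilbert_space op \<Rightarrow> 'h op \<Rightarrow> bool" where
  "is_adj S T \<longleftrightarrow> (\<forall>x y. cinner (blinfun_apply S x) y = cinner x (blinfun_apply T y))"

definition adj :: "'h::complex_hilbert_space op \<Rightarrow> 'h op" where
  "adj T = (THE S. is_adj S T)"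

definition positive_op :: "'h::complex_hilbert_space op \<Rightarrow> bool" where
  "positive_op T \<longleftrightarrow>
     clinear_op T \<and> (\<forall>x. \<exists>r\<ge>0. cinner (blinfun_apply T x) x = complex_of_real r)"

definition weak_operator_topology :: "'h::complex_hilbert_space op topology" where
  "weak_operator_topology =
     topology_generated_by
       {{T. cinner (blinfun_apply T x) y \<in> U} | x y U. open U}"

definition ultraweak_topology :: "'h::complex_hilbert_space op topology" where
  "ultraweak_topology =
     topology_generated_by
       {{T. (\<Sum>k. cinner (blinfun_apply T (x k)) (y k)) \<in> U} | (x :: nat \<Rightarrow> 'h) y U.
          open U \<and> summable (\<lambda>k. (norm (x k))\<^sup>2) \<and> summable (\<lambda>k. (norm (y k))\<^sup>2)}"

definition von_neumann_algebra :: "'h::complex_hilbert_space op set \<Rightarrow> bool" where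
  "von_neumann_algebra A \<longleftrightarrow>
     (\<forall>T\<in>A. clinear_op T) \<and> id_blinfun \<in> A \<and>
     (\<forall>T\<in>A. \<forall>S\<in>A. T + S \<in> A) \<and> (\<forall>c. \<forall>T\<in>A. scale_op c T \<in> A) \<and>
     (\<forall>T\<in>A. \<forall>S\<in>A. T o\<^sub>L S \<in> A) \<and> (\<forall>T\<in>A. \<exists>S\<in>A. is_adj S T) \<and>
     closedin weak_operator_topology A"

text \<open>Weak continuity of the state is understood in the weak-* sense, i.e. \<open>\<phi>\<close> is ultraweakly
  continuous (normal); continuity for the weak operator topology implies it.\<close>

definition tracial_Wstar_space ::
  "'h::complex_hilbert_space op set \<Rightarrow> ('h op \<Rightarrow> complex) \<Rightarrow> bool" where
  "tracial_Wstar_space A \<phi> \<longleftrightarrow>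
     von_neumann_algebra A \<and>
     (\<forall>T\<in>A. \<forall>S\<in>A. \<phi> (T + S) = \<phi> T + \<phi> S) \<and>
     (\<forall>c. \<forall>T\<in>A. \<phi> (scale_op c T) = c * \<phi> T) \<and>
     \<phi> id_blinfun = 1 \<and>
     continuous_map (subtopology ultraweak_topology A) euclidean \<phi> \<and>
     (\<forall>T\<in>A. \<exists>r\<ge>0. \<phi> (adj T o\<^sub>L T) = complex_of_real r) \<and>
     (\<forall>T\<in>A. \<phi> (adj T o\<^sub>L T) = 0 \<longrightarrow> T = 0) \<and>
     (\<forall>T\<in>A. \<forall>S\<in>A. \<phi> (T o\<^sub>L S) = \<phi> (S o\<^sub>L T))"


section \<open>The space \<open>L\<^sup>2(A,\<phi>)\<close>\<close>

text \<open>The Hilbert space \<open>'l\<close>, with the embedding \<open>\<iota>\<close> of \<open>A\<close>, is a completion of \<open>A\<close> for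
  \<open>\<parallel>X\<parallel>\<^sub>2 = \<phi>(X X*)\<^sup>1\<^sup>/\<^sup>2\<close>.\<close>

definition L2_completion :: "'h::complex_hilbert_space op set \<Rightarrow> ('h op \<Rightarrow> complex) \<Rightarrow>
    ('h op \<Rightarrow> 'l::complex_hilbert_space) \<Rightarrow> bool" where
  "L2_completion A \<phi> \<iota> \<longleftrightarrow>
     (\<forall>X\<in>A. \<forall>Y\<in>A. \<iota> (X + Y) = \<iota> X + \<iota> Y) \<and>
     (\<forall>c. \<forall>X\<in>A. \<iota> (scale_op c X) = c *\<^sub>C \<iota> X) \<and>
     (\<forall>X\<in>A. norm (\<iota> X) = sqrt (Re (\<phi> (X o\<^sub>L adj X)))) \<and>
     closure (\<iota> ` A) = UNIV"

definition L2_approx :: "'h::complex_hilbert_space op set \<Rightarrow>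
    ('h op \<Rightarrow> 'l::complex_hilbert_space) \<Rightarrow> (nat \<Rightarrow> 'h op) \<Rightarrow> 'l \<Rightarrow> bool" where
  "L2_approx A \<iota> a X \<longleftrightarrow> range a \<subseteq> A \<and> (\<lambda>k. \<iota> (a k)) \<longlonglongrightarrow> X"

definition L2_one :: "('h::complex_hilbert_space op \<Rightarrow> 'l) \<Rightarrow> 'l" where
  "L2_one \<iota> = \<iota> id_blinfun"

text \<open>The extension of \<open>\<phi>\<close> to \<open>L\<^sup>2(A,\<phi>)\<close>: for \<open>X\<close> in \<open>A\<close> this is \<open>\<phi>(X 1*) = \<phi>(X)\<close>.\<close>

definition L2_state :: "('h::complex_hilbert_space op \<Rightarrow> 'l::complex_hilbert_space) \<Rightarrow> 'l \<Rightarrow> complex"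
  where "L2_state \<iota> X = cinner X (L2_one \<iota>)"

definition L2_star :: "'h::complex_hilbert_space op set \<Rightarrow>
    ('h op \<Rightarrow> 'l::complex_hilbert_space) \<Rightarrow> 'l \<Rightarrow> 'l" where
  "L2_star A \<iota> X = (THE Y. \<forall>a. L2_approx A \<iota> a X \<longrightarrow> L2_approx A \<iota> (\<lambda>k. adj (a k)) Y)"

text \<open>The product \<open>X Y\<close> of two elements of \<open>L\<^sup>2(A,\<phi>)\<close> is in general only an element of
  \<open>L\<^sup>1(A,\<phi>)\<close>, the predual of \<open>A\<close>, where it is the functional \<open>c \<mapsto> \<phi>(c X Y)\<close>, i.e. the limit of
  \<open>\<phi>(c a\<^sub>k b\<^sub>k)\<close> whenever \<open>a\<^sub>k \<rightarrow> X\<close> and \<open>b\<^sub>k \<rightarrow> Y\<close> in \<open>L\<^sup>2\<close>. The relation \<open>is_L2_prod A \<phi> \<iota> X Y Z\<close>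
  says that this product is the element \<open>Z\<close> of \<open>L\<^sup>2(A,\<phi>)\<close>, whose functional is
  \<open>c \<mapsto> \<phi>(c Z) = \<langle>Z, c*\<rangle>\<close>. There is at most one such \<open>Z\<close>, it depends bilinearly on \<open>X\<close> and \<open>Y\<close>,
  and for \<open>X\<close>, \<open>Y\<close> in \<open>A\<close> it is the product of \<open>A\<close>.\<close>

definition is_L2_prod :: "'h::complex_hilbert_space op set \<Rightarrow> ('h op \<Rightarrow> complex) \<Rightarrow>
    ('h op \<Rightarrow> 'l::complex_hilbert_space) \<Rightarrow> 'l \<Rightarrow> 'l \<Rightarrow> 'l \<Rightarrow> bool" where
  "is_L2_prod A \<phi> \<iota> X Y Z \<longleftrightarrow>
     (\<forall>c\<in>A. \<forall>a b. L2_approx A \<iota> a X \<and> L2_approx A \<iota> b Y \<longrightarrow>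
        (\<lambda>k. \<phi> (c o\<^sub>L a k o\<^sub>L b k)) \<longlonglongrightarrow> cinner Z (\<iota> (adj c)))"

definition L2_mult :: "'h::complex_hilbert_space op set \<Rightarrow> ('h op \<Rightarrow> complex) \<Rightarrow>
    ('h op \<Rightarrow> 'l::complex_hilbert_space) \<Rightarrow> 'l \<Rightarrow> 'l \<Rightarrow> 'l" where
  "L2_mult A \<phi> \<iota> X Y = (THE Z. is_L2_prod A \<phi> \<iota> X Y Z)"

definition L2_prod_list :: "'h::complex_hilbert_space op set \<Rightarrow> ('h op \<Rightarrow> complex) \<Rightarrow>
    ('h op \<Rightarrow> 'l::complex_hilbert_space) \<Rightarrow> 'l list \<Rightarrow> 'l" where
  "L2_prod_list A \<phi> \<iota> Xs = foldr (L2_mult A \<phi> \<iota>) Xs (L2_one \<iota>)"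

definition L2_poly :: "'h::complex_hilbert_space op set \<Rightarrow> ('h op \<Rightarrow> complex) \<Rightarrow>
    ('h op \<Rightarrow> 'l::complex_hilbert_space) \<Rightarrow> complex poly \<Rightarrow> 'l \<Rightarrow> 'l" where
  "L2_poly A \<phi> \<iota> P X =
     (\<Sum>k\<le>degree P. coeff P k *\<^sub>C L2_prod_list A \<phi> \<iota> (replicate k X))"


section \<open>Freeness\<close>

definition L2_free :: "'h::complex_hilbert_space op set \<Rightarrow> ('h op \<Rightarrow> complex) \<Rightarrow>
    ('h op \<Rightarrow> 'l::complex_hilbert_space) \<Rightarrow> 'l list \<Rightarrow> bool" where
  "L2_free A \<phi> \<iota> Xs \<longleftrightarrow>
     (\<forall>w :: (nat \<times> complex poly) list.
        w \<noteq> [] \<and> (\<forall>(i, P)\<in>set w. i < length Xs) \<and> distinct_adj (map fst w) \<longrightarrow>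
        L2_state \<iota> (L2_prod_list A \<phi> \<iota>
          (map (\<lambda>(i, P). L2_poly A \<phi> \<iota> P (Xs ! i)
                  - L2_state \<iota> (L2_poly A \<phi> \<iota> P (Xs ! i)) *\<^sub>C L2_one \<iota>) w)) = 0)"

definition op_prod_list :: "'h::complex_hilbert_space op list \<Rightarrow> 'h op" where
  "op_prod_list Ts = foldr (o\<^sub>L) Ts id_blinfun"

definition op_poly :: "complex poly \<Rightarrow> 'h::complex_hilbert_space op \<Rightarrow> 'h op" where
  "op_poly P T = (\<Sum>k\<le>degree P. scale_op (coeff P k) (op_prod_list (replicate k T)))"

definition free_algebras :: "('h::complex_hilbert_space op \<Rightarrow> complex) \<Rightarrow> 'h op set list \<Rightarrow> bool"
  where
  "free_algebras \<phi> Bs \<longleftrightarrow>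
     (\<forall>w :: (nat \<times> 'h op) list.
        w \<noteq> [] \<and> (\<forall>(i, T)\<in>set w. i < length Bs \<and> T \<in> Bs ! i \<and> \<phi> T = 0) \<and>
        distinct_adj (map fst w) \<longrightarrow>
        \<phi> (op_prod_list (map snd w)) = 0)"

definition free_from :: "('h::complex_hilbert_space op \<Rightarrow> complex) \<Rightarrow> 'h op \<Rightarrow> 'h op set \<Rightarrow> bool"
  where "free_from \<phi> X B \<longleftrightarrow> free_algebras \<phi> [range (\<lambda>P. op_poly P X), B]"


section \<open>Free Brownian motion and the free Poisson process\<close>

text \<open>All laws below have compact support, so that they are determined by their moments.\<close>

definition has_law ::
  "('h::complex_hilbert_space op \<Rightarrow> complex) \<Rightarrow> 'h op \<Rightarrow> real measure \<Rightarrow> bool" where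
  "has_law \<phi> X \<mu> \<longleftrightarrow>
     (\<forall>k. integrable \<mu> (\<lambda>x. x ^ k) \<and>
          \<phi> (op_prod_list (replicate k X)) = complex_of_real (\<integral>x. x ^ k \<partial>\<mu>))"

definition semicircular_law :: "real \<Rightarrow> real measure" where
  "semicircular_law v =
     density lborel (\<lambda>x. ennreal
       (indicator {- 2 * sqrt v..2 * sqrt v} x * (sqrt (4 * v - x\<^sup>2) / (2 * pi * v))))"

definition free_poisson_ac :: "real \<Rightarrow> real measure" where
  "free_poisson_ac l =
     density lborel (\<lambda>x. ennreal
       (indicator {(1 - sqrt l)\<^sup>2..(1 + sqrt l)\<^sup>2} x *
        (sqrt (4 * l - (x - 1 - l)\<^sup>2) / (2 * pi * x))))"

definition free_poisson_law :: "real \<Rightarrow> real measure" where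
  "free_poisson_law l =
     (if l \<le> 1
      then measure_of UNIV (sets borel)
             (\<lambda>B. ennreal (1 - l) * indicator B 0 + emeasure (free_poisson_ac l) B)
      else free_poisson_ac l)"

definition vn_filtration ::
  "'h::complex_hilbert_space op set \<Rightarrow> (real \<Rightarrow> 'h op set) \<Rightarrow> bool" where
  "vn_filtration A \<F> \<longleftrightarrow>
     (\<forall>t\<ge>0. von_neumann_algebra (\<F> t) \<and> \<F> t \<subseteq> A) \<and>
     (\<forall>s t. 0 \<le> s \<and> s \<le> t \<longrightarrow> \<F> s \<subseteq> \<F> t)"

definition free_brownian_motion :: "'h::complex_hilbert_space op set \<Rightarrow> ('h op \<Rightarrow> complex) \<Rightarrow>
    (real \<Rightarrow> 'h op) \<Rightarrow> bool" where
  "free_brownian_motion A \<phi> S \<longleftrightarrow>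
     (\<exists>\<F>. vn_filtration A \<F> \<and>
        (\<forall>t\<ge>0. S t \<in> \<F> t \<and> is_adj (S t) (S t)) \<and> S 0 = 0 \<and>
        (\<forall>u t. 0 \<le> u \<and> u < t \<longrightarrow>
           free_from \<phi> (S t - S u) (\<F> u) \<and> has_law \<phi> (S t - S u) (semicircular_law (t - u))))"

definition free_poisson_process :: "'h::complex_hilbert_space op set \<Rightarrow> ('h op \<Rightarrow> complex) \<Rightarrow>
    (real \<Rightarrow> 'h op) \<Rightarrow> bool" where
  "free_poisson_process A \<phi> N \<longleftrightarrow>
     (\<exists>\<F>. vn_filtration A \<F> \<and>
        (\<forall>t\<ge>0. N t \<in> \<F> t \<and> positive_op (N t)) \<and> N 0 = 0 \<and>
        (\<forall>u t. 0 \<le> u \<and> u < t \<longrightarrow>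
           free_from \<phi> (N t - N u) (\<F> u) \<and> has_law \<phi> (N t - N u) (free_poisson_law (t - u))))"

definition compensated :: "(real \<Rightarrow> 'h::complex_hilbert_space op) \<Rightarrow> real \<Rightarrow> 'h op" where
  "compensated N t = N t - t *\<^sub>R id_blinfun"


section \<open>Kernels and contractions\<close>

text \<open>A point \<open>(t\<^sub>1,\<dots>,t\<^sub>n)\<close> of \<open>\<real>\<^sub>+\<^sup>n\<close> is an extensional function on \<open>{..<n}\<close>, the coordinate
  \<open>t\<^sub>i\<close> being its value at \<open>i - 1\<close>; in particular \<open>\<real>\<^sub>+\<^sup>0\<close> is a single point of mass one.\<close>

definition half_line_power :: "nat \<Rightarrow> (nat \<Rightarrow> real) measure" where
  "half_line_power n = (\<Pi>\<^sub>M i\<in>{..<n}. restrict_space lborel {0..})"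

type_synonym kernel = "(nat \<Rightarrow> real) \<Rightarrow> complex"

definition sq_integrable :: "nat \<Rightarrow> kernel set" where
  "sq_integrable n =
     {f. f \<in> borel_measurable (half_line_power n) \<and>
         integrable (half_line_power n) (\<lambda>t. (cmod (f t))\<^sup>2)}"

definition symmetric_kernel :: "nat \<Rightarrow> kernel \<Rightarrow> bool" where
  "symmetric_kernel n f \<longleftrightarrow>
     (AE t in half_line_power n. f t \<in> \<real>) \<and>
     (\<forall>\<sigma>. \<sigma> permutes {..<n} \<longrightarrow>
        (AE t in half_line_power n. f t = f (\<lambda>i\<in>{..<n}. t (\<sigma> i))))"

definition adj_kernel :: "nat \<Rightarrow> kernel \<Rightarrow> kernel" where
  "adj_kernel n f = (\<lambda>t. cnj (f (\<lambda>i\<in>{..<n}. t (n - 1 - i))))"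

text \<open>\<open>contraction n m p f g\<close> is \<open>f \<frown>\<^sup>p g\<close> for \<open>f\<close> of order \<open>n\<close>, \<open>g\<close> of order \<open>m\<close> and
  \<open>p \<le> min n m\<close>.\<close>

definition contraction :: "nat \<Rightarrow> nat \<Rightarrow> nat \<Rightarrow> kernel \<Rightarrow> kernel \<Rightarrow> kernel" where
  "contraction n m p f g = (\<lambda>t. \<integral>s.
     f (\<lambda>i\<in>{..<n}. if i < n - p then t i else s (i - (n - p))) *
     g (\<lambda>i\<in>{..<m}. if i < p then s (p - 1 - i) else t (n - p + (i - p)))
     \<partial>half_line_power p)"

text \<open>\<open>star_contraction n m p f g\<close> is \<open>f \<star>\<^sub>p\<^sup>p\<^sup>-\<^sup>1 g\<close> for \<open>1 \<le> p \<le> min n m\<close>; the coordinate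
  \<open>n - p\<close> of \<open>t\<close> is shared by \<open>f\<close> and \<open>g\<close>.\<close>

definition star_contraction :: "nat \<Rightarrow> nat \<Rightarrow> nat \<Rightarrow> kernel \<Rightarrow> kernel \<Rightarrow> kernel" where
  "star_contraction n m p f g = (\<lambda>t. \<integral>s.
     f (\<lambda>i\<in>{..<n}. if i < n - p + 1 then t i else s (p - 2 - (i - (n - p + 1)))) *
     g (\<lambda>i\<in>{..<m}. if i < p - 1 then s i else t (n - p + (i - (p - 1))))
     \<partial>half_line_power (p - 1))"


section \<open>Multiple integrals\<close>

text \<open>\<open>I n f\<close> stands for the multiple integral of order \<open>n\<close> of the square-integrable kernel \<open>f\<close>
  with respect to \<open>M\<close>; the first four clauses determine it. Since \<open>\<langle>X,Y\<rangle> = \<phi>(X Y*)\<close> on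
  \<open>L\<^sup>2(A,\<phi>)\<close>, the fourth is the isometry. The last two (orthogonality of different orders and
  \<open>I\<^sub>n(f)* = I\<^sub>n(f*)\<close>) are the standard properties of multiple integrals.\<close>

definition multiple_integral :: "'h::complex_hilbert_space op set \<Rightarrow> ('h op \<Rightarrow> complex) \<Rightarrow>
    ('h op \<Rightarrow> 'l::complex_hilbert_space) \<Rightarrow> (real \<Rightarrow> 'h op) \<Rightarrow> (nat \<Rightarrow> kernel \<Rightarrow> 'l) \<Rightarrow> bool" where
  "multiple_integral A \<phi> \<iota> M I \<longleftrightarrow>
     (\<forall>c. I 0 (\<lambda>_. c) = c *\<^sub>C L2_one \<iota>) \<and>
     (\<forall>n. \<forall>f\<in>sq_integrable n. \<forall>g\<in>sq_integrable n. \<forall>c.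
        I n (\<lambda>t. f t + g t) = I n f + I n g \<and> I n (\<lambda>t. c * f t) = c *\<^sub>C I n f) \<and>
     (\<forall>n (a :: nat \<Rightarrow> real) b.
        (\<forall>i<n. 0 \<le> a i \<and> a i \<le> b i) \<and> disjoint_family_on (\<lambda>i. {a i..b i}) {..<n} \<longrightarrow>
        I n (indicator (\<Pi>\<^sub>E i\<in>{..<n}. {a i..b i})) =
          \<iota> (op_prod_list (map (\<lambda>i. M (b i) - M (a i)) [0..<n]))) \<and>
     (\<forall>n. \<forall>f\<in>sq_integrable n. \<forall>g\<in>sq_integrable n.
        cinner (I n f) (I n g) = (\<integral>t. f t * cnj (g t) \<partial>half_line_power n)) \<and>
     (\<forall>n m. \<forall>f\<in>sq_integrable n. \<forall>g\<in>sq_integrable m.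
        n \<noteq> m \<longrightarrow> cinner (I n f) (I m g) = 0) \<and>
     (\<forall>n. \<forall>f\<in>sq_integrable n. L2_star A \<iota> (I n f) = I n (adj_kernel n f))"

definition integral_span :: "(nat \<Rightarrow> kernel \<Rightarrow> 'l::complex_hilbert_space) \<Rightarrow>
    (nat \<Rightarrow> kernel set) \<Rightarrow> 'l set" where
  "integral_span I K = {\<Sum>j\<le>r. I j (k j) | r k. \<forall>j\<le>r. k j \<in> K j}"

text \<open>A unital *-subalgebra of \<open>L\<^sup>2(A,\<phi>)\<close>; bilinearity of the product is built into
  \<open>is_L2_prod\<close>.\<close>

definition unital_star_algebra :: "'h::complex_hilbert_space op set \<Rightarrow> ('h op \<Rightarrow> complex) \<Rightarrow>
    ('h op \<Rightarrow> 'l::complex_hilbert_space) \<Rightarrow> 'l set \<Rightarrow> bool" where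
  "unital_star_algebra A \<phi> \<iota> V \<longleftrightarrow>
     L2_one \<iota> \<in> V \<and>
     (\<forall>X\<in>V. \<forall>Y\<in>V. X + Y \<in> V) \<and> (\<forall>c. \<forall>X\<in>V. c *\<^sub>C X \<in> V) \<and>
     (\<forall>X\<in>V. L2_star A \<iota> X \<in> V) \<and>
     (\<forall>X\<in>V. \<forall>Y\<in>V. \<exists>Z\<in>V. is_L2_prod A \<phi> \<iota> X Y Z) \<and>
     (\<forall>X\<in>V. \<forall>Y\<in>V. \<forall>Z\<in>V.
        L2_mult A \<phi> \<iota> (L2_mult A \<phi> \<iota> X Y) Z = L2_mult A \<phi> \<iota> X (L2_mult A \<phi> \<iota> Y Z)) \<and>
     (\<forall>X\<in>V. \<forall>Y\<in>V.
        L2_star A \<iota> (L2_mult A \<phi> \<iota> X Y) = L2_mult A \<phi> \<iota> (L2_star A \<iota> Y) (L2_star A \<iota> X))"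

definition wigner_algebra :: "'h::complex_hilbert_space op set \<Rightarrow> ('h op \<Rightarrow> complex) \<Rightarrow>
    ('h op \<Rightarrow> 'l::complex_hilbert_space) \<Rightarrow> (nat \<Rightarrow> kernel \<Rightarrow> 'l) \<Rightarrow> bool" where
  "wigner_algebra A \<phi> \<iota> I \<longleftrightarrow>
     unital_star_algebra A \<phi> \<iota> (integral_span I sq_integrable) \<and>
     (\<forall>n m. \<forall>f\<in>sq_integrable n. \<forall>g\<in>sq_integrable m.
        is_L2_prod A \<phi> \<iota> (I n f) (I m g)
          (\<Sum>p\<le>min n m. I (n + m - 2 * p) (contraction n m p f g)))"

text \<open>In the free Poisson case the contractions \<open>f \<star>\<^sub>p\<^sup>p\<^sup>-\<^sup>1 g\<close> of square-integrable kernels need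
  not be square-integrable (e.g. \<open>f \<star>\<^sub>1\<^sup>0 f = f\<^sup>2\<close> for \<open>n = 1\<close>), and multiple integrals need not have
  finite moments. The multiple integrals can thus only span an algebra when their kernels range over
  a class which is stable under contractions, such as the bounded kernels with bounded support.\<close>

definition stable_kernels :: "(nat \<Rightarrow> kernel set) \<Rightarrow> bool" where
  "stable_kernels K \<longleftrightarrow>
     (\<forall>n. K n \<subseteq> sq_integrable n) \<and>
     (\<forall>c. (\<lambda>_. c) \<in> K 0) \<and>
     (\<forall>n. \<forall>f\<in>K n. \<forall>g\<in>K n. (\<lambda>t. f t + g t) \<in> K n) \<and>
     (\<forall>n c. \<forall>f\<in>K n. (\<lambda>t. c * f t) \<in> K n) \<and>
     (\<forall>n. \<forall>f\<in>K n. adj_kernel n f \<in> K n) \<and>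
     (\<forall>n m. \<forall>f\<in>K n. \<forall>g\<in>K m.
        (\<forall>p\<le>min n m. contraction n m p f g \<in> K (n + m - 2 * p)) \<and>
        (\<forall>p\<in>{1..min n m}. star_contraction n m p f g \<in> K (n + m - 2 * p + 1)))"

definition free_poisson_algebra :: "'h::complex_hilbert_space op set \<Rightarrow> ('h op \<Rightarrow> complex) \<Rightarrow>
    ('h op \<Rightarrow> 'l::complex_hilbert_space) \<Rightarrow> (nat \<Rightarrow> kernel \<Rightarrow> 'l) \<Rightarrow> (nat \<Rightarrow> kernel set) \<Rightarrow> bool"
  where
  "free_poisson_algebra A \<phi> \<iota> I K \<longleftrightarrow>
     stable_kernels K \<and>
     unital_star_algebra A \<phi> \<iota> (integral_span I K) \<and>
     (\<forall>n m. \<forall>f\<in>K n. \<forall>g\<in>K m.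
        is_L2_prod A \<phi> \<iota> (I n f) (I m g)
          ((\<Sum>p\<le>min n m. I (n + m - 2 * p) (contraction n m p f g)) +
           (\<Sum>p=1..min n m. I (n + m - 2 * p + 1) (star_contraction n m p f g))))"

end

theory Submission
  imports Defs
begin

text \<open>Write \<open>X = I\<^sub>n(f)\<close> and \<open>Y = I\<^sub>m(g)\<close>; both are self-adjoint and centred.

  Suppose that \<open>X\<close> and \<open>Y\<close> are free. Freeness applied to the word \<open>X (Y\<^sup>2 - \<phi>(Y\<^sup>2)) X\<close> gives
  \<open>\<phi>(X Y\<^sup>2 X) = \<phi>(X\<^sup>2) \<phi>(Y\<^sup>2)\<close>, that is \<open>\<parallel>XY\<parallel> = \<parallel>X\<parallel> \<parallel>Y\<parallel>\<close> (\<open>L2_free_norm_mult\<close>). The product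
  formula expands \<open>XY\<close> into integrals of pairwise different orders, hence orthogonal ones. The
  integral of \<open>f \<otimes> g\<close> is one of them and has norm \<open>\<parallel>f\<parallel> \<parallel>g\<parallel> = \<parallel>X\<parallel> \<parallel>Y\<parallel>\<close> already, so that all other
  terms vanish (\<open>free_imp_terms_0\<close>), in particular \<open>f \<frown>\<^sup>1 g\<close> or \<open>f \<star>\<^sub>1\<^sup>0 g\<close>.

  For the converse, put \<open>f\<close> and \<open>g\<close> into two classes of kernels, each closed under contractions, such
  that a kernel of one class annihilates, under every contraction but the tensor product, all kernels
  whose first variable is of the type prescribed by the other class. Polynomials in \<open>X\<close> are then sums
  of integrals of kernels of the first class, the centred ones contain only positive orders, and
  likewise for \<open>Y\<close>. If an alternating word of centred factors is multiplied out from the right to the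
  left, every single product reduces to a tensor product, so that only positive orders occur and the
  expectation is zero (\<open>L2_free_kernel_classes\<close>). It remains to find the classes.

  In the free Poisson case \<open>f \<star>\<^sub>1\<^sup>0 g = 0\<close> says that the variables of \<open>f\<close> and of \<open>g\<close> live on disjoint
  sets: there is \<open>B\<close> such that \<open>f\<close> is supported by \<open>B\<^sup>n\<close> and \<open>g\<close> by the corresponding power of the
  complement (\<open>separating_set\<close>). Being supported by a power of a fixed set is preserved by all
  contractions.

  In the Wigner case \<open>f \<frown>\<^sup>1 g = 0\<close> says that almost every slice of \<open>f\<close> in one variable is orthogonal to
  almost every slice of \<open>g\<close>. The classes consist of the kernels whose slices are orthogonal to a fixed
  set of functions (\<open>separating_function_sets\<close>), and Fubini's theorem shows that they are closed under
  contractions. The delicate point is that \<open>f \<frown>\<^sup>p g\<close> vanishes for \<open>p \<ge> 2\<close>: there the two slices share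
  the other contracted variables, so that the pairs of parameters run through a null set. But
  \<open>L\<^sup>2(\<real>\<^sub>+)\<close> is separable, and therefore the slices are orthogonal for all pairs of parameters taken
  from two sets of full measure (\<open>orthogonal_slices_uniform\<close>), which makes shared variables
  harmless.\<close>

section \<open>Complex Hilbert spaces and adjoints\<close>

lemma cinner_add_right: "cinner x (y + z) = cinner x y + cinner x z"
  for x :: "'a::complex_hilbert_space"
  by (metis cinner_add_left cinner_commute complex_cnj_add)

lemma cinner_scaleC_right: "cinner x (c *\<^sub>C y) = cnj c * cinner x y"
  for x :: "'a::complex_hilbert_space"
  by (metis cinner_scaleC_left cinner_commute complex_cnj_mult)

lemma scaleC_one: "1 *\<^sub>C x = x" for x :: "'a::complex_hilbert_space"
  using scaleC_of_real[of 1 x] by simp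

lemma scaleC_zero_left: "0 *\<^sub>C x = 0" for x :: "'a::complex_hilbert_space"
  using scaleC_of_real[of 0 x] by simp

lemma scaleC_zero_right: "c *\<^sub>C 0 = (0 :: 'a::complex_hilbert_space)"
  using scaleC_add_right[of c 0 "0::'a"] by simp

lemma scaleC_neg_one: "(-1) *\<^sub>C x = - x" for x :: "'a::complex_hilbert_space"
  using scaleC_of_real[of "-1" x] by simp

lemma scaleC_minus_left: "(- c) *\<^sub>C x = - (c *\<^sub>C x)" for x :: "'a::complex_hilbert_space"
  using scaleC_scaleC[of "-1" c x] by (simp add: scaleC_neg_one)

lemma scaleC_sum_right: "c *\<^sub>C (\<Sum>i\<in>J. x i) = (\<Sum>i\<in>J. c *\<^sub>C x i)"
  for x :: "'b \<Rightarrow> 'a::complex_hilbert_space"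
  by (induction J rule: infinite_finite_induct) (simp_all add: scaleC_zero_right scaleC_add_right)

lemma cinner_minus_left: "cinner (- x) y = - cinner x y" for x :: "'a::complex_hilbert_space"
  using cinner_scaleC_left[of "-1" x y] by (simp add: scaleC_neg_one)

lemma cinner_minus_right: "cinner x (- y) = - cinner x y" for x :: "'a::complex_hilbert_space"
  using cinner_scaleC_right[of x "-1" y] by (simp add: scaleC_neg_one)

lemma cinner_diff_left: "cinner (x - y) z = cinner x z - cinner y z"
  for x :: "'a::complex_hilbert_space"
  using cinner_add_left[of x "-y" z] by (simp add: cinner_minus_left)

lemma cinner_diff_right: "cinner x (y - z) = cinner x y - cinner x z"
  for x :: "'a::complex_hilbert_space"
  using cinner_add_right[of x y "-z"] by (simp add: cinner_minus_right)

lemma cinner_zero_left [simp]: "cinner 0 x = 0" for x :: "'a::complex_hilbert_space"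
  using cinner_scaleC_left[of 0 0 x] by (simp add: scaleC_zero_left)

lemma cinner_zero_right [simp]: "cinner x 0 = 0" for x :: "'a::complex_hilbert_space"
  using cinner_scaleC_right[of x 0 0] by (simp add: scaleC_zero_left)

lemma cinner_sum_left: "cinner (\<Sum>i\<in>J. x i) y = (\<Sum>i\<in>J. cinner (x i) y)"
  for y :: "'a::complex_hilbert_space"
  by (induction J rule: infinite_finite_induct) (simp_all add: cinner_add_left)

lemma cinner_sum_right: "cinner y (\<Sum>i\<in>J. x i) = (\<Sum>i\<in>J. cinner y (x i))"
  for y :: "'a::complex_hilbert_space"
  by (induction J rule: infinite_finite_induct) (simp_all add: cinner_add_right)

lemma cinner_eq_Complex: "cinner x y = Complex (x \<bullet> y) (((- \<i>) *\<^sub>C x) \<bullet> y)"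
  for x :: "'a::complex_hilbert_space"
  by (rule complex_eqI) (simp_all add: Re_cinner[symmetric] cinner_scaleC_left)

lemma tendsto_cinner:
  fixes x y :: "'a::complex_hilbert_space"
  assumes "(f \<longlongrightarrow> x) F" "(g \<longlongrightarrow> y) F"
  shows "((\<lambda>k. cinner (f k) (g k)) \<longlongrightarrow> cinner x y) F"
  unfolding cinner_eq_Complex
  by (intro tendsto_Complex tendsto_inner assms
      bounded_linear.tendsto[OF bounded_linear_scaleC])

lemma cinner_ext:
  fixes x y :: "'a::complex_hilbert_space"
  assumes "\<And>z. cinner z x = cinner z y"
  shows "x = y"
proof -
  have "cinner (x - y) (x - y) = 0"
    using assms[of "x - y"] by (simp add: cinner_diff_right)
  then show ?thesis by (simp add: cinner_self)
qed

lemma scale_op_apply: "blinfun_apply (scale_op c T) x = c *\<^sub>C blinfun_apply T x"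
  by transfer simp

lemma is_adj_sym: "is_adj S T \<Longrightarrow> is_adj T S"
  unfolding is_adj_def by (metis cinner_commute)

lemma is_adj_unique:
  assumes "is_adj S T" "is_adj S' T"
  shows "S = S'"
proof (rule blinfun_eqI)
  fix x
  show "blinfun_apply S x = blinfun_apply S' x"
  proof (rule cinner_ext)
    fix z
    show "cinner z (blinfun_apply S x) = cinner z (blinfun_apply S' x)"
      using assms unfolding is_adj_def by (metis cinner_commute)
  qed
qed

lemma adj_eqI: "is_adj S T \<Longrightarrow> adj T = S"
  unfolding adj_def by (blast intro: is_adj_unique the_equality)

lemma is_adj_id: "is_adj id_blinfun (id_blinfun :: 'h::complex_hilbert_space op)"
  by (simp add: is_adj_def)

lemma adj_id: "adj id_blinfun = (id_blinfun :: 'h::complex_hilbert_space op)"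
  by (rule adj_eqI[OF is_adj_id])

lemma minus_eq_scale_op: "T - S = T + scale_op (- 1) S"
  by (rule blinfun_eqI) (simp add: blinfun.add_left blinfun.diff_left scale_op_apply scaleC_neg_one)

lemma id_comp: "id_blinfun o\<^sub>L T = T"
  by (rule blinfun_eqI) simp

lemma comp_add_left: "(T + S) o\<^sub>L R = (T o\<^sub>L R) + (S o\<^sub>L R)"
  by (rule blinfun_eqI) (simp add: blinfun.add_left)

lemma comp_add_right: "R o\<^sub>L (T + S) = (R o\<^sub>L T) + (R o\<^sub>L S)"
  by (rule blinfun_eqI) (simp add: blinfun.add_left blinfun.add_right)

lemma comp_scale_left: "scale_op c T o\<^sub>L R = scale_op c (T o\<^sub>L R)"
  by (rule blinfun_eqI) (simp add: scale_op_apply)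

lemma comp_scale_right: "clinear_op R \<Longrightarrow> R o\<^sub>L scale_op c T = scale_op c (R o\<^sub>L T)"
  by (rule blinfun_eqI) (simp add: scale_op_apply clinear_op_def)

section \<open>The space \<open>L\<^sup>2\<close> of a tracial state\<close>

locale tracial_L2 =
  fixes A :: "'h::complex_hilbert_space op set" and \<phi> :: "'h op \<Rightarrow> complex"
    and \<iota> :: "'h op \<Rightarrow> 'l::complex_hilbert_space"
  assumes tracial: "tracial_Wstar_space A \<phi>" and completion: "L2_completion A \<phi> \<iota>"
begin

abbreviation "has_product \<equiv> is_L2_prod A \<phi> \<iota>"
abbreviation "mul \<equiv> L2_mult A \<phi> \<iota>"
abbreviation "star \<equiv> L2_star A \<iota>"
abbreviation "approximates \<equiv> L2_approx A \<iota>"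

lemma vN: "von_neumann_algebra A"
  using tracial by (simp add: tracial_Wstar_space_def)

lemma A_clinear: "T \<in> A \<Longrightarrow> clinear_op T"
  and A_id: "id_blinfun \<in> A"
  and A_add: "T \<in> A \<Longrightarrow> S \<in> A \<Longrightarrow> T + S \<in> A"
  and A_scale: "T \<in> A \<Longrightarrow> scale_op c T \<in> A"
  and A_mult: "T \<in> A \<Longrightarrow> S \<in> A \<Longrightarrow> T o\<^sub>L S \<in> A"
  using vN by (simp_all add: von_neumann_algebra_def)

lemma A_diff: "T \<in> A \<Longrightarrow> S \<in> A \<Longrightarrow> T - S \<in> A"
  by (simp add: minus_eq_scale_op A_add A_scale)

lemma A_adj:
  assumes "T \<in> A"
  shows "is_adj (adj T) T" "adj T \<in> A"
proof -
  obtain S where S: "S \<in> A" "is_adj S T"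
    using vN assms by (auto simp: von_neumann_algebra_def)
  then show "is_adj (adj T) T" "adj T \<in> A"
    using adj_eqI[OF S(2)] by simp_all
qed

lemma adj_adj: "T \<in> A \<Longrightarrow> adj (adj T) = T"
  by (rule adj_eqI[OF is_adj_sym[OF A_adj(1)]])

lemma adj_add: "T \<in> A \<Longrightarrow> S \<in> A \<Longrightarrow> adj (T + S) = adj T + adj S"
  using A_adj(1)[of T] A_adj(1)[of S]
  by (intro adj_eqI) (simp add: is_adj_def blinfun.add_left cinner_add_left cinner_add_right)

lemma adj_scale: "T \<in> A \<Longrightarrow> adj (scale_op c T) = scale_op (cnj c) (adj T)"
  using A_adj(1)[of T]
  by (intro adj_eqI) (simp add: is_adj_def scale_op_apply cinner_scaleC_left cinner_scaleC_right)

lemma adj_diff: "T \<in> A \<Longrightarrow> S \<in> A \<Longrightarrow> adj (T - S) = adj T - adj S"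
  by (simp add: minus_eq_scale_op adj_add adj_scale A_scale)

lemma phi_add: "T \<in> A \<Longrightarrow> S \<in> A \<Longrightarrow> \<phi> (T + S) = \<phi> T + \<phi> S"
  and phi_scale: "T \<in> A \<Longrightarrow> \<phi> (scale_op c T) = c * \<phi> T"
  and phi_id: "\<phi> id_blinfun = 1"
  and phi_trace: "T \<in> A \<Longrightarrow> S \<in> A \<Longrightarrow> \<phi> (T o\<^sub>L S) = \<phi> (S o\<^sub>L T)"
  and phi_positive: "T \<in> A \<Longrightarrow> \<exists>r\<ge>0. \<phi> (adj T o\<^sub>L T) = complex_of_real r"
  using tracial by (simp_all add: tracial_Wstar_space_def)

lemma iota_add: "X \<in> A \<Longrightarrow> Y \<in> A \<Longrightarrow> \<iota> (X + Y) = \<iota> X + \<iota> Y"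
  and iota_scale: "X \<in> A \<Longrightarrow> \<iota> (scale_op c X) = c *\<^sub>C \<iota> X"
  and norm_iota: "X \<in> A \<Longrightarrow> norm (\<iota> X) = sqrt (Re (\<phi> (X o\<^sub>L adj X)))"
  and iota_dense: "closure (\<iota> ` A) = UNIV"
  using completion by (simp_all add: L2_completion_def)

lemma iota_diff: "X \<in> A \<Longrightarrow> Y \<in> A \<Longrightarrow> \<iota> (X - Y) = \<iota> X - \<iota> Y"
  by (simp add: minus_eq_scale_op iota_add iota_scale A_scale scaleC_neg_one)

lemma cinner_iota_self:
  assumes "X \<in> A"
  shows "cinner (\<iota> X) (\<iota> X) = \<phi> (X o\<^sub>L adj X)"
proof -
  obtain r where r: "r \<ge> 0" "\<phi> (adj X o\<^sub>L X) = complex_of_real r"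
    using phi_positive[OF assms] by blast
  then have "\<phi> (X o\<^sub>L adj X) = complex_of_real r"
    using phi_trace[OF assms A_adj(2)[OF assms]] by simp
  then show ?thesis
    using r by (simp add: cinner_self norm_iota[OF assms])
qed

text \<open>Polarization: both sides are sesquilinear forms on \<open>A\<close> with the same diagonal.\<close>

lemma cinner_iota:
  assumes "X \<in> A" "Y \<in> A"
  shows "cinner (\<iota> X) (\<iota> Y) = \<phi> (X o\<^sub>L adj Y)"
proof -
  define B where "B X Y = cinner (\<iota> X) (\<iota> Y) - \<phi> (X o\<^sub>L adj Y)" for X Y
  have B_add_left: "B (X + X') Y = B X Y + B X' Y"
    and B_add_right: "B Y (X + X') = B Y X + B Y X'" if "X \<in> A" "X' \<in> A" "Y \<in> A" for X X' Y
    using that by (simp_all add: B_def iota_add cinner_add_left cinner_add_right comp_add_left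
        comp_add_right adj_add phi_add A_mult A_adj)
  have B_scale_left: "B (scale_op c X) Y = c * B X Y"
    and B_scale_right: "B X (scale_op c Y) = cnj c * B X Y" if "X \<in> A" "Y \<in> A" for c X Y
    using that by (simp_all add: B_def iota_scale cinner_scaleC_left cinner_scaleC_right
        comp_scale_left comp_scale_right A_clinear adj_scale phi_scale A_mult A_adj
        right_diff_distrib)
  have diag: "B X X = 0" if "X \<in> A" for X
    using cinner_iota_self[OF that] by (simp add: B_def)
  \<comment> \<open>The factors \<open>c = 1\<close> and \<open>c = \<i>\<close> separate the two mixed terms.\<close>
  have "B (X + scale_op c Y) (X + scale_op c Y) = cnj c * B X Y + c * B Y X" for c
    using assms diag[OF assms(1)] diag[OF assms(2)]
    by (simp add: B_add_left B_add_right B_scale_left B_scale_right A_scale A_add)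
  then have eq: "cnj c * B X Y + c * B Y X = 0" for c
    using diag assms by (simp add: A_add A_scale)
  have "B X Y = 0"
    using eq[of 1] eq[of \<i>] by (simp add: algebra_simps eq_neg_iff_add_eq_0)
  then show ?thesis by (simp add: B_def)
qed

lemma norm_L2_one: "cinner (L2_one \<iota>) (L2_one \<iota>) = 1"
  by (simp add: L2_one_def cinner_iota A_id adj_id phi_id id_comp)

lemma L2_approx_exists: "\<exists>a. approximates a X"
proof -
  have "X \<in> closure (\<iota> ` A)" by (simp add: iota_dense)
  then obtain x where x: "\<forall>k. x k \<in> \<iota> ` A" "x \<longlonglongrightarrow> X"
    by (auto simp: closure_sequential)
  then have "\<forall>k. \<exists>a\<in>A. x k = \<iota> a" by blast
  then obtain a where a: "\<And>k. a k \<in> A" "\<And>k. x k = \<iota> (a k)" by metis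
  then have "x = (\<lambda>k. \<iota> (a k))" by auto
  then show ?thesis
    using x(2) a(1) by (auto simp: L2_approx_def)
qed

lemma L2_approx_add:
  "approximates a X \<Longrightarrow> approximates b Y \<Longrightarrow> approximates (\<lambda>k. a k + b k) (X + Y)"
  unfolding L2_approx_def
  by (auto simp: A_add iota_add image_subset_iff intro!: tendsto_add)

lemma L2_approx_scale:
  "approximates a X \<Longrightarrow> approximates (\<lambda>k. scale_op c (a k)) (c *\<^sub>C X)"
  unfolding L2_approx_def
  by (auto simp: A_scale iota_scale image_subset_iff
      intro!: bounded_linear.tendsto[OF bounded_linear_scaleC])

lemma norm_iota_adj:
  assumes "X \<in> A"
  shows "norm (\<iota> (adj X)) = norm (\<iota> X)"
  using assms phi_trace[OF assms A_adj(2)[OF assms]] by (simp add: norm_iota A_adj adj_adj)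

text \<open>The trace makes the adjoint isometric for the \<open>L\<^sup>2\<close> norm, so that it extends to
  \<open>L\<^sup>2(A,\<phi>)\<close>.\<close>

lemma L2_approx_adj:
  assumes "approximates a X"
  shows "approximates (\<lambda>k. adj (a k)) (star X)"
proof -
  have aA: "a k \<in> A" for k using assms by (auto simp: L2_approx_def)
  have dist: "dist (\<iota> (adj x)) (\<iota> (adj y)) = dist (\<iota> x) (\<iota> y)" if "x \<in> A" "y \<in> A" for x y
    using that norm_iota_adj[OF A_diff[OF that]]
    by (simp add: dist_norm adj_diff iota_diff A_adj)
  have "Cauchy (\<lambda>k. \<iota> (a k))"
    using assms by (auto simp: L2_approx_def intro: LIMSEQ_imp_Cauchy)
  then have "Cauchy (\<lambda>k. \<iota> (adj (a k)))"
    by (simp add: Cauchy_def dist aA)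
  then obtain Y where Y: "(\<lambda>k. \<iota> (adj (a k))) \<longlonglongrightarrow> Y"
    by (meson Cauchy_convergent convergentD)
  have all: "approximates (\<lambda>k. adj (b k)) Y" if b: "approximates b X" for b
  proof -
    have bA: "b k \<in> A" for k using b by (auto simp: L2_approx_def)
    have "(\<lambda>k. \<iota> (a k) - \<iota> (b k)) \<longlonglongrightarrow> X - X"
      using assms b unfolding L2_approx_def by (intro tendsto_diff) auto
    then have "(\<lambda>k. dist (\<iota> (adj (a k))) (\<iota> (adj (b k)))) \<longlonglongrightarrow> 0"
      unfolding dist[OF aA bA] unfolding dist_norm by (simp add: tendsto_norm_zero)
    then have "(\<lambda>k. \<iota> (adj (a k)) - \<iota> (adj (b k))) \<longlonglongrightarrow> 0"
      unfolding dist_norm by (simp only: tendsto_norm_zero_iff)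
    then have "(\<lambda>k. \<iota> (adj (b k))) \<longlonglongrightarrow> Y"
      by (rule Lim_transform2[OF Y])
    then show ?thesis
      using bA A_adj(2) by (auto simp: L2_approx_def)
  qed
  have "star X = Y"
    unfolding L2_star_def
  proof (rule the_equality)
    fix Y' assume "\<forall>b. approximates b X \<longrightarrow> approximates (\<lambda>k. adj (b k)) Y'"
    then have "approximates (\<lambda>k. adj (a k)) Y'" using assms by blast
    then show "Y' = Y"
      using Y by (auto simp: L2_approx_def intro: LIMSEQ_unique)
  qed (use all in blast)
  then show ?thesis using all[OF assms] by simp
qed

lemma is_L2_prod_unique:
  assumes "has_product X Y Z" "has_product X Y Z'"
  shows "Z = Z'"
proof -
  obtain a b where ab: "approximates a X" "approximates b Y"
    using L2_approx_exists by metis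
  have eq: "cinner Z (\<iota> c) = cinner Z' (\<iota> c)" if "c \<in> A" for c
    using assms[unfolded is_L2_prod_def, rule_format, OF A_adj(2)[OF that] conjI[OF ab]]
    by (simp add: adj_adj that LIMSEQ_unique)
  obtain d where d: "approximates d (Z - Z')"
    using L2_approx_exists by blast
  have "(\<lambda>k. cinner (Z - Z') (\<iota> (d k))) \<longlonglongrightarrow> cinner (Z - Z') (Z - Z')"
    using d by (intro tendsto_cinner) (auto simp: L2_approx_def)
  moreover have "cinner (Z - Z') (\<iota> (d k)) = 0" for k
    using d eq[of "d k"] by (auto simp: cinner_diff_left L2_approx_def)
  ultimately have "cinner (Z - Z') (Z - Z') = 0"
    by (simp add: LIMSEQ_const_iff)
  then show ?thesis by (simp add: cinner_self)
qed

lemma L2_mult_eq: "has_product X Y Z \<Longrightarrow> mul X Y = Z"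
  unfolding L2_mult_def by (blast intro: is_L2_prod_unique the_equality)

text \<open>Additivity of the product is derived from its compatibility with differences, because the latter
  also yields that \<open>0\<close> is a product as soon as one product with the same factor exists:
  an approximating sequence of \<open>X - X'\<close> and one of \<open>X'\<close> add up to one of \<open>X\<close>.\<close>

lemma is_L2_prod_diff_left:
  assumes "has_product X Y Z" "has_product X' Y Z'"
  shows "has_product (X - X') Y (Z - Z')"
  unfolding is_L2_prod_def
proof (intro ballI allI impI, elim conjE)
  fix c a b assume c: "c \<in> A" and a: "approximates a (X - X')" and b: "approximates b Y"
  obtain a' where a': "approximates a' X'" using L2_approx_exists by blast
  have sum: "approximates (\<lambda>k. a k + a' k) X"
    using L2_approx_add[OF a a'] by simp
  have inA: "a k \<in> A" "a' k \<in> A" "b k \<in> A" for k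
    using a a' b by (auto simp: L2_approx_def)
  have "(\<lambda>k. \<phi> (c o\<^sub>L (a k + a' k) o\<^sub>L b k) - \<phi> (c o\<^sub>L a' k o\<^sub>L b k))
      \<longlonglongrightarrow> cinner Z (\<iota> (adj c)) - cinner Z' (\<iota> (adj c))"
    using assms c b sum a' by (intro tendsto_diff) (auto simp: is_L2_prod_def)
  then show "(\<lambda>k. \<phi> (c o\<^sub>L a k o\<^sub>L b k)) \<longlonglongrightarrow> cinner (Z - Z') (\<iota> (adj c))"
    using inA c by (simp add: comp_add_left comp_add_right phi_add A_mult cinner_diff_left)
qed

lemma is_L2_prod_diff_right:
  assumes "has_product Y X Z" "has_product Y X' Z'"
  shows "has_product Y (X - X') (Z - Z')"
  unfolding is_L2_prod_def
proof (intro ballI allI impI, elim conjE)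
  fix c b a assume c: "c \<in> A" and a: "approximates a (X - X')" and b: "approximates b Y"
  obtain a' where a': "approximates a' X'" using L2_approx_exists by blast
  have sum: "approximates (\<lambda>k. a k + a' k) X"
    using L2_approx_add[OF a a'] by simp
  have inA: "a k \<in> A" "a' k \<in> A" "b k \<in> A" for k
    using a a' b by (auto simp: L2_approx_def)
  have "(\<lambda>k. \<phi> (c o\<^sub>L b k o\<^sub>L (a k + a' k)) - \<phi> (c o\<^sub>L b k o\<^sub>L a' k))
      \<longlonglongrightarrow> cinner Z (\<iota> (adj c)) - cinner Z' (\<iota> (adj c))"
    using assms c b sum a' by (intro tendsto_diff) (auto simp: is_L2_prod_def)
  then show "(\<lambda>k. \<phi> (c o\<^sub>L b k o\<^sub>L a k)) \<longlonglongrightarrow> cinner (Z - Z') (\<iota> (adj c))"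
    using inA c by (simp add: comp_add_left comp_add_right phi_add A_mult cinner_diff_left)
qed

lemma is_L2_prod_add_left:
  assumes "has_product X Y Z" "has_product X' Y Z'"
  shows "has_product (X + X') Y (Z + Z')"
  using is_L2_prod_diff_left[OF assms(1)
      is_L2_prod_diff_left[OF is_L2_prod_diff_left[OF assms(2) assms(2)] assms(2)]]
  by simp

lemma is_L2_prod_add_right:
  assumes "has_product Y X Z" "has_product Y X' Z'"
  shows "has_product Y (X + X') (Z + Z')"
  using is_L2_prod_diff_right[OF assms(1)
      is_L2_prod_diff_right[OF is_L2_prod_diff_right[OF assms(2) assms(2)] assms(2)]]
  by simp

lemma is_L2_prod_scale_left:
  assumes "has_product X Y Z"
  shows "has_product (c *\<^sub>C X) Y (c *\<^sub>C Z)"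
proof (cases "c = 0")
  case True
  then show ?thesis
    using is_L2_prod_diff_left[OF assms assms] by (simp add: scaleC_zero_left)
next
  case False
  show ?thesis
    unfolding is_L2_prod_def
  proof (intro ballI allI impI, elim conjE)
    fix d a b assume d: "d \<in> A" and a: "approximates a (c *\<^sub>C X)" and b: "approximates b Y"
    have a': "approximates (\<lambda>k. scale_op (1 / c) (a k)) X"
      using L2_approx_scale[OF a, of "1 / c"] False by (simp add: scaleC_scaleC scaleC_one)
    have inA: "a k \<in> A" "b k \<in> A" for k
      using a b by (auto simp: L2_approx_def)
    have "(\<lambda>k. c * \<phi> (d o\<^sub>L scale_op (1 / c) (a k) o\<^sub>L b k)) \<longlonglongrightarrow> c * cinner Z (\<iota> (adj d))"
      using assms d a' b by (intro tendsto_mult tendsto_const) (auto simp: is_L2_prod_def)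
    then show "(\<lambda>k. \<phi> (d o\<^sub>L a k o\<^sub>L b k)) \<longlonglongrightarrow> cinner (c *\<^sub>C Z) (\<iota> (adj d))"
      using inA d False
      by (simp add: comp_scale_left comp_scale_right A_clinear A_mult phi_scale cinner_scaleC_left)
  qed
qed

lemma is_L2_prod_scale_right:
  assumes "has_product Y X Z"
  shows "has_product Y (c *\<^sub>C X) (c *\<^sub>C Z)"
proof (cases "c = 0")
  case True
  then show ?thesis
    using is_L2_prod_diff_right[OF assms assms] by (simp add: scaleC_zero_left)
next
  case False
  show ?thesis
    unfolding is_L2_prod_def
  proof (intro ballI allI impI, elim conjE)
    fix d b a assume d: "d \<in> A" and a: "approximates a (c *\<^sub>C X)" and b: "approximates b Y"
    have a': "approximates (\<lambda>k. scale_op (1 / c) (a k)) X"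
      using L2_approx_scale[OF a, of "1 / c"] False by (simp add: scaleC_scaleC scaleC_one)
    have inA: "a k \<in> A" "b k \<in> A" for k
      using a b by (auto simp: L2_approx_def)
    have "(\<lambda>k. c * \<phi> (d o\<^sub>L b k o\<^sub>L scale_op (1 / c) (a k))) \<longlonglongrightarrow> c * cinner Z (\<iota> (adj d))"
      using assms d a' b by (intro tendsto_mult tendsto_const) (auto simp: is_L2_prod_def)
    then show "(\<lambda>k. \<phi> (d o\<^sub>L b k o\<^sub>L a k)) \<longlonglongrightarrow> cinner (c *\<^sub>C Z) (\<iota> (adj d))"
      using inA d False
      by (simp add: comp_scale_left comp_scale_right A_clinear A_mult phi_scale cinner_scaleC_left)
  qed
qed

text \<open>On \<open>A\<close> this is \<open>\<phi>(X Y*) = \<langle>X,Y\<rangle>\<close>; both sides are continuous.\<close>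

lemma L2_state_prod_star:
  assumes "has_product X (star Y) Z"
  shows "L2_state \<iota> Z = cinner X Y"
proof -
  obtain a b where ab: "approximates a X" "approximates b Y"
    using L2_approx_exists by metis
  have inA: "a k \<in> A" "b k \<in> A" for k
    using ab by (auto simp: L2_approx_def)
  have "(\<lambda>k. \<phi> (id_blinfun o\<^sub>L a k o\<^sub>L adj (b k))) \<longlonglongrightarrow> cinner Z (\<iota> (adj id_blinfun))"
    using assms A_id ab(1) L2_approx_adj[OF ab(2)] by (auto simp: is_L2_prod_def)
  then have "(\<lambda>k. cinner (\<iota> (a k)) (\<iota> (b k))) \<longlonglongrightarrow> L2_state \<iota> Z"
    by (simp add: cinner_iota inA adj_id L2_state_def L2_one_def id_comp)
  moreover have "(\<lambda>k. cinner (\<iota> (a k)) (\<iota> (b k))) \<longlonglongrightarrow> cinner X Y"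
    using ab by (intro tendsto_cinner) (auto simp: L2_approx_def)
  ultimately show ?thesis by (rule LIMSEQ_unique)
qed

lemma L2_state_add: "L2_state \<iota> (X + Y) = L2_state \<iota> X + L2_state \<iota> Y"
  and L2_state_diff: "L2_state \<iota> (X - Y) = L2_state \<iota> X - L2_state \<iota> Y"
  and L2_state_scale: "L2_state \<iota> (c *\<^sub>C X) = c * L2_state \<iota> X"
  and L2_state_one: "L2_state \<iota> (L2_one \<iota>) = 1"
  by (simp_all add: L2_state_def cinner_add_left cinner_diff_left cinner_scaleC_left norm_L2_one)

end

section \<open>A criterion for freeness\<close>

definition kernel_space :: "(nat \<Rightarrow> kernel set) \<Rightarrow> bool" where
  "kernel_space C \<longleftrightarrow>
     (\<forall>n. C n \<subseteq> sq_integrable n \<and> (\<lambda>_. 0) \<in> C n \<and>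
        (\<forall>f\<in>C n. \<forall>g\<in>C n. (\<lambda>t. f t + g t) \<in> C n) \<and>
        (\<forall>c. \<forall>f\<in>C n. (\<lambda>t. c * f t) \<in> C n))"

text \<open>Order \<open>0\<close> keeps the zero kernel, so that the result is again a
  \<open>kernel_space\<close>.\<close>

definition positive_order :: "(nat \<Rightarrow> kernel set) \<Rightarrow> nat \<Rightarrow> kernel set" where
  "positive_order C n = (if n = 0 then {\<lambda>_. 0} else C n)"

lemma kernel_spaceD:
  assumes "kernel_space C"
  shows "f \<in> C n \<Longrightarrow> f \<in> sq_integrable n"
    and "(\<lambda>_. 0) \<in> C n"
    and "f \<in> C n \<Longrightarrow> g \<in> C n \<Longrightarrow> (\<lambda>t. f t + g t) \<in> C n"
    and "f \<in> C n \<Longrightarrow> (\<lambda>t. c * f t) \<in> C n"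
  using assms unfolding kernel_space_def by blast+

lemma kernel_space_positive_order: "kernel_space C \<Longrightarrow> kernel_space (positive_order C)"
  unfolding kernel_space_def positive_order_def by auto

lemma sq_integrable_zero: "(\<lambda>_. 0) \<in> sq_integrable n"
  by (simp add: sq_integrable_def)

lemma sq_integrable_scale: "f \<in> sq_integrable n \<Longrightarrow> (\<lambda>t. c * f t) \<in> sq_integrable n"
  by (auto simp: sq_integrable_def norm_mult power_mult_distrib)

lemma norm_add_sq_le: "(norm (a + b))\<^sup>2 \<le> 2 * (norm a)\<^sup>2 + 2 * (norm b)\<^sup>2"
  for a b :: "'a::real_normed_vector"
proof -
  have "(norm (a + b))\<^sup>2 \<le> (norm a + norm b)\<^sup>2"
    by (simp add: norm_triangle_ineq power_mono)
  also have "\<dots> \<le> 2 * (norm a)\<^sup>2 + 2 * (norm b)\<^sup>2"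
    using sum_squares_bound[of "norm a" "norm b"] by (simp add: power2_sum)
  finally show ?thesis .
qed

lemma sq_integrable_add:
  assumes "f \<in> sq_integrable n" "g \<in> sq_integrable n"
  shows "(\<lambda>t. f t + g t) \<in> sq_integrable n"
proof -
  have "integrable (half_line_power n) (\<lambda>t. (cmod (f t + g t))\<^sup>2)"
  proof (rule Bochner_Integration.integrable_bound)
    show "integrable (half_line_power n) (\<lambda>t. 2 * (cmod (f t))\<^sup>2 + 2 * (cmod (g t))\<^sup>2)"
      using assms by (simp add: sq_integrable_def)
    show "(\<lambda>t. (cmod (f t + g t))\<^sup>2) \<in> borel_measurable (half_line_power n)"
      using assms by (auto simp: sq_integrable_def)
    show "AE t in half_line_power n. norm ((cmod (f t + g t))\<^sup>2)
        \<le> norm (2 * (cmod (f t))\<^sup>2 + 2 * (cmod (g t))\<^sup>2)"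
      using norm_add_sq_le by (intro AE_I2) (auto intro: order_trans)
  qed
  then show ?thesis
    using assms by (auto simp: sq_integrable_def)
qed

lemma kernel_space_sq_integrable: "kernel_space sq_integrable"
  unfolding kernel_space_def
  using sq_integrable_zero sq_integrable_scale sq_integrable_add by blast

lemma space_half_line_power_0: "space (half_line_power 0) = {\<lambda>_. undefined}"
  by (simp add: half_line_power_def space_PiM)

context tracial_L2
begin

lemma L2_poly_in_subalgebra:
  assumes one: "L2_one \<iota> \<in> S"
    and add: "\<And>U W. U \<in> S \<Longrightarrow> W \<in> S \<Longrightarrow> U + W \<in> S"
    and scale: "\<And>c U. U \<in> S \<Longrightarrow> c *\<^sub>C U \<in> S"
    and prod: "\<And>U W. U \<in> S \<Longrightarrow> W \<in> S \<Longrightarrow> \<exists>Z\<in>S. has_product U W Z"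
    and X: "X \<in> S"
  shows "L2_poly A \<phi> \<iota> P X \<in> S"
proof -
  have power: "L2_prod_list A \<phi> \<iota> (replicate k X) \<in> S" for k
  proof (induction k)
    case 0
    then show ?case using one by (simp add: L2_prod_list_def)
  next
    case (Suc k)
    obtain Z where "Z \<in> S" "has_product X (L2_prod_list A \<phi> \<iota> (replicate k X)) Z"
      using prod[OF X Suc.IH] by blast
    then show ?case
      by (simp add: L2_prod_list_def L2_mult_eq)
  qed
  have "(\<Sum>k\<le>d. coeff P k *\<^sub>C L2_prod_list A \<phi> \<iota> (replicate k X)) \<in> S" for d
    by (induction d) (auto intro!: add scale power simp del: replicate.simps)
  then show ?thesis by (simp add: L2_poly_def)
qed

text \<open>Multiplying from the right to the left, an alternating product of centred elements never
  leaves the spaces \<open>T i\<close>, where \<open>i\<close> is the letter that was multiplied last.\<close>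

lemma L2_freeI:
  fixes S T :: "nat \<Rightarrow> 'l set"
  assumes one: "\<And>i. i < length Xs \<Longrightarrow> L2_one \<iota> \<in> S i"
    and add: "\<And>i U W. i < length Xs \<Longrightarrow> U \<in> S i \<Longrightarrow> W \<in> S i \<Longrightarrow> U + W \<in> S i"
    and scale: "\<And>i c U. i < length Xs \<Longrightarrow> U \<in> S i \<Longrightarrow> c *\<^sub>C U \<in> S i"
    and prod: "\<And>i U W. i < length Xs \<Longrightarrow> U \<in> S i \<Longrightarrow> W \<in> S i \<Longrightarrow>
                 \<exists>Z\<in>S i. has_product U W Z"
    and X: "\<And>i. i < length Xs \<Longrightarrow> Xs ! i \<in> S i"
    and base: "\<And>i U. i < length Xs \<Longrightarrow> U \<in> S i \<Longrightarrow> L2_state \<iota> U = 0 \<Longrightarrow>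
                 \<exists>Z\<in>T i. has_product U (L2_one \<iota>) Z"
    and step: "\<And>i j U W. i < length Xs \<Longrightarrow> j < length Xs \<Longrightarrow> i \<noteq> j \<Longrightarrow> U \<in> S i \<Longrightarrow>
                 L2_state \<iota> U = 0 \<Longrightarrow> W \<in> T j \<Longrightarrow> \<exists>Z\<in>T i. has_product U W Z"
    and state: "\<And>i Z. i < length Xs \<Longrightarrow> Z \<in> T i \<Longrightarrow> L2_state \<iota> Z = 0"
  shows "L2_free A \<phi> \<iota> Xs"
proof -
  define c where "c = (\<lambda>(i, P). L2_poly A \<phi> \<iota> P (Xs ! i)
      - L2_state \<iota> (L2_poly A \<phi> \<iota> P (Xs ! i)) *\<^sub>C L2_one \<iota>)"
  have c: "c (i, P) \<in> S i" "L2_state \<iota> (c (i, P)) = 0" if "i < length Xs" for i P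
  proof -
    let ?U = "L2_poly A \<phi> \<iota> P (Xs ! i)"
    have U: "?U \<in> S i"
      by (rule L2_poly_in_subalgebra[OF one add scale prod X]) (use that in auto)
    have "c (i, P) = ?U + (- L2_state \<iota> ?U) *\<^sub>C L2_one \<iota>"
      by (simp add: c_def scaleC_minus_left)
    also have "\<dots> \<in> S i"
      using that U by (intro add scale one)
    finally show "c (i, P) \<in> S i" .
    show "L2_state \<iota> (c (i, P)) = 0"
      by (simp add: c_def L2_state_diff L2_state_scale L2_state_one)
  qed
  have word: "w \<noteq> [] \<Longrightarrow> (\<forall>(i, P)\<in>set w. i < length Xs) \<Longrightarrow> distinct_adj (map fst w) \<Longrightarrow>
      L2_prod_list A \<phi> \<iota> (map c w) \<in> T (fst (hd w))" for w
  proof (induction w)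
    case Nil
    then show ?case by simp
  next
    case (Cons x w)
    obtain i P where x: "x = (i, P)" by fastforce
    have i: "i < length Xs" using Cons.prems x by auto
    show ?case
    proof (cases w)
      case Nil
      then show ?thesis
        using base[OF i c(1)[OF i] c(2)[OF i], of P] x
        by (auto simp: L2_prod_list_def L2_mult_eq)
    next
      case (Cons y v)
      let ?W = "L2_prod_list A \<phi> \<iota> (map c w)"
      have W: "?W \<in> T (fst (hd w))"
        using Cons.IH Cons.prems Cons by (auto simp: distinct_adj_Cons)
      have j: "fst (hd w) < length Xs" "i \<noteq> fst (hd w)"
        using Cons.prems Cons x by (auto simp: distinct_adj_Cons)
      show ?thesis
        using step[OF i j c(1)[OF i] c(2)[OF i] W, of P] x
        by (auto simp: L2_prod_list_def L2_mult_eq)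
    qed
  qed
  show ?thesis
    unfolding L2_free_def c_def[symmetric]
  proof (intro allI impI, elim conjE)
    fix w :: "(nat \<times> complex poly) list"
    assume w: "w \<noteq> []" "\<forall>(i, P)\<in>set w. i < length Xs" "distinct_adj (map fst w)"
    then have "fst (hd w) < length Xs"
      by (cases w) auto
    then show "L2_state \<iota> (L2_prod_list A \<phi> \<iota> (map c w)) = 0"
      by (rule state) (rule word[OF w])
  qed
qed

end

section \<open>The norm of the product of free elements\<close>

context tracial_L2
begin

text \<open>By freeness the word \<open>X (Y\<^sup>2 - \<phi>(Y\<^sup>2)) X\<close> has expectation \<open>0\<close>, and \<open>X Y\<^sup>2 X = (XY) (XY)*\<close>.\<close>

lemma L2_free_norm_mult:
  assumes alg: "unital_star_algebra A \<phi> \<iota> V"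
    and unit_left: "\<And>U. U \<in> V \<Longrightarrow> has_product (L2_one \<iota>) U U"
    and unit_right: "\<And>U. U \<in> V \<Longrightarrow> has_product U (L2_one \<iota>) U"
    and X: "X \<in> V" "star X = X" "L2_state \<iota> X = 0"
    and Y: "Y \<in> V" "star Y = Y"
    and free: "L2_free A \<phi> \<iota> [X, Y]"
  defines "XY \<equiv> mul X Y"
  shows "cinner XY XY = cinner X X * cinner Y Y"
proof -
  note mult = alg[unfolded unital_star_algebra_def]
  have prod: "has_product U W (mul U W)" and
    closed: "mul U W \<in> V" if UW: "U \<in> V" "W \<in> V" for U W
  proof -
    obtain Z where Z: "Z \<in> V" "has_product U W Z"
      using mult UW by blast
    then show "has_product U W (mul U W)" "mul U W \<in> V"
      using L2_mult_eq[OF Z(2)] by simp_all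
  qed
  have assoc: "mul (mul U W) Z = mul U (mul W Z)"
    if "U \<in> V" "W \<in> V" "Z \<in> V" for U W Z
    using mult that by blast
  have X1: "mul X (L2_one \<iota>) = X" and Y1: "mul Y (L2_one \<iota>) = Y"
    using unit_right X(1) Y(1) by (auto intro: L2_mult_eq)
  let ?XX = "mul X X" and ?YY = "mul Y Y"
  let ?x = "[:0, 1:] :: complex poly" and ?x2 = "[:0, 0, 1:] :: complex poly"
  have px: "L2_poly A \<phi> \<iota> ?x X = X"
    by (simp add: L2_poly_def L2_prod_list_def scaleC_zero_left scaleC_one X1)
  have px2: "L2_poly A \<phi> \<iota> ?x2 Y = ?YY"
    by (simp add: L2_poly_def L2_prod_list_def scaleC_zero_left scaleC_one Y1 eval_nat_numeral)
  define d where "d = L2_state \<iota> ?YY"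
  have d: "d = cinner Y Y"
    unfolding d_def by (rule L2_state_prod_star) (use prod[OF Y(1) Y(1)] Y(2) in simp)
  have XX: "L2_state \<iota> ?XX = cinner X X"
    by (rule L2_state_prod_star) (use prod[OF X(1) X(1)] X(2) in simp)
  have centred: "mul (?YY - d *\<^sub>C L2_one \<iota>) X = mul ?YY X - d *\<^sub>C X"
    by (intro L2_mult_eq is_L2_prod_diff_left is_L2_prod_scale_left prod closed unit_left X Y)
  have XcX: "mul X (mul ?YY X - d *\<^sub>C X)
      = mul X (mul ?YY X) - d *\<^sub>C ?XX"
    by (intro L2_mult_eq is_L2_prod_diff_right is_L2_prod_scale_right prod closed X Y)
  have "L2_state \<iota> (mul X (mul (?YY - d *\<^sub>C L2_one \<iota>) X)) = 0"
    using free[unfolded L2_free_def, rule_format, of "[(0, ?x), (1, ?x2), (0, ?x)]"]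
    by (simp add: px px2 X(3) X1 scaleC_zero_left L2_prod_list_def d_def)
  then have "L2_state \<iota> (mul X (mul ?YY X)) = cinner X X * cinner Y Y"
    by (simp add: centred XcX L2_state_diff L2_state_scale XX d[symmetric])
  moreover have "mul X (mul ?YY X) = mul XY (mul Y X)"
    unfolding XY_def using X(1) Y(1) by (simp add: assoc closed)
  moreover have "star XY = mul Y X"
    unfolding XY_def using mult X Y by metis
  moreover have "has_product XY (mul Y X) (mul XY (mul Y X))"
    unfolding XY_def by (intro prod closed X Y)
  ultimately show ?thesis
    by (metis L2_state_prod_star)
qed

end

section \<open>Multiple integrals\<close>

locale multiple_integral_L2 = tracial_L2 A \<phi> \<iota>
  for A :: "'h::complex_hilbert_space op set" and \<phi> :: "'h op \<Rightarrow> complex"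
    and \<iota> :: "'h op \<Rightarrow> 'l::complex_hilbert_space" +
  fixes M :: "real \<Rightarrow> 'h op" and I :: "nat \<Rightarrow> kernel \<Rightarrow> 'l"
  assumes multiple_integral: "multiple_integral A \<phi> \<iota> M I"
begin

lemmas integral_clauses = multiple_integral[unfolded multiple_integral_def]

lemma I_const: "I 0 (\<lambda>_. c) = c *\<^sub>C L2_one \<iota>"
  by (rule integral_clauses[THEN conjunct1, rule_format])

lemma I_add: "f \<in> sq_integrable n \<Longrightarrow> g \<in> sq_integrable n \<Longrightarrow>
    I n (\<lambda>t. f t + g t) = I n f + I n g"
  by (rule integral_clauses[THEN conjunct2, THEN conjunct1, rule_format, THEN conjunct1])

lemma I_scale: "f \<in> sq_integrable n \<Longrightarrow> I n (\<lambda>t. c * f t) = c *\<^sub>C I n f"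
  by (rule integral_clauses[THEN conjunct2, THEN conjunct1, rule_format, THEN conjunct2])

lemma I_isometry: "f \<in> sq_integrable n \<Longrightarrow> g \<in> sq_integrable n \<Longrightarrow>
    cinner (I n f) (I n g) = (\<integral>t. f t * cnj (g t) \<partial>half_line_power n)"
  by (rule integral_clauses[THEN conjunct2, THEN conjunct2, THEN conjunct2, THEN conjunct1,
        rule_format])

lemma I_orthogonal: "f \<in> sq_integrable n \<Longrightarrow> g \<in> sq_integrable m \<Longrightarrow> n \<noteq> m \<Longrightarrow>
    cinner (I n f) (I m g) = 0"
  by (rule integral_clauses[THEN conjunct2, THEN conjunct2, THEN conjunct2, THEN conjunct2,
        THEN conjunct1, rule_format])

lemma I_star: "f \<in> sq_integrable n \<Longrightarrow> star (I n f) = I n (adj_kernel n f)"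
  by (rule integral_clauses[THEN conjunct2, THEN conjunct2, THEN conjunct2, THEN conjunct2,
        THEN conjunct2, rule_format])

lemma I_zero: "I n (\<lambda>_. 0) = 0"
  using I_scale[OF sq_integrable_zero, of n 0] by (simp add: scaleC_zero_left)

lemma const_sq_integrable_0: "(\<lambda>_. c) \<in> sq_integrable 0"
  by (simp add: sq_integrable_def half_line_power_def PiM_empty integrable_count_space)

lemma I_one: "I 0 (\<lambda>_. 1) = L2_one \<iota>"
  by (simp add: I_const scaleC_one)

lemma I_cong:
  assumes "f \<in> sq_integrable n" "g \<in> sq_integrable n" "AE t in half_line_power n. f t = g t"
  shows "I n f = I n g"
proof -
  let ?d = "\<lambda>t. f t + (-1) * g t"
  have d: "?d \<in> sq_integrable n"
    by (rule sq_integrable_add[OF assms(1) sq_integrable_scale[OF assms(2)]])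
  have "cinner (I n ?d) (I n ?d) = (\<integral>t. ?d t * cnj (?d t) \<partial>half_line_power n)"
    by (rule I_isometry[OF d d])
  also have "\<dots> = 0"
    using assms(3) by (intro integral_eq_zero_AE) auto
  finally have "I n ?d = 0" by (simp add: cinner_self)
  moreover have "I n ?d = I n f - I n g"
    using I_add[OF assms(1) sq_integrable_scale[OF assms(2), of "-1"]] I_scale[OF assms(2), of "-1"]
    by (simp add: scaleC_neg_one)
  ultimately show ?thesis by simp
qed

lemma I_eq_0_iff:
  assumes "f \<in> sq_integrable n"
  shows "I n f = 0 \<longleftrightarrow> (AE t in half_line_power n. f t = 0)"
proof
  assume "I n f = 0"
  then have "(\<integral>t. f t * cnj (f t) \<partial>half_line_power n) = 0"
    using I_isometry[OF assms assms] by simp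
  then have "(\<integral>t. complex_of_real ((cmod (f t))\<^sup>2) \<partial>half_line_power n) = 0"
    by (simp only: complex_norm_square)
  then have "(\<integral>t. (cmod (f t))\<^sup>2 \<partial>half_line_power n) = 0"
    by (simp only: integral_complex_of_real of_real_eq_0_iff)
  then have "AE t in half_line_power n. (cmod (f t))\<^sup>2 = 0"
    using assms by (subst (asm) integral_nonneg_eq_0_iff_AE) (auto simp: sq_integrable_def)
  then show "AE t in half_line_power n. f t = 0" by simp
next
  assume "AE t in half_line_power n. f t = 0"
  then show "I n f = 0"
    using I_cong[OF assms sq_integrable_zero] by (simp add: I_zero)
qed

lemma integral_span_memI:
  assumes "kernel_space C" "h \<in> C n"
  shows "I n h \<in> integral_span I C"
proof -
  let ?k = "\<lambda>j. if j = n then h else (\<lambda>_. 0)"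
  have "(\<Sum>j\<le>n. I j (?k j)) = (\<Sum>j\<le>n. if j = n then I n h else 0)"
    by (rule sum.cong) (auto simp: I_zero)
  then have "(\<Sum>j\<le>n. I j (?k j)) = I n h" by simp
  moreover have "\<forall>j\<le>n. ?k j \<in> C j"
    using assms kernel_spaceD(2) by auto
  ultimately show ?thesis
    unfolding integral_span_def by (intro CollectI exI[of _ n] exI[of _ ?k]) auto
qed

lemma integral_span_add:
  assumes C: "kernel_space C" and "U \<in> integral_span I C" "W \<in> integral_span I C"
  shows "U + W \<in> integral_span I C"
proof -
  obtain r k where U: "U = (\<Sum>j\<le>r. I j (k j))" "\<forall>j\<le>r. k j \<in> C j"
    using assms(2) by (auto simp: integral_span_def)
  obtain s l where W: "W = (\<Sum>j\<le>s. I j (l j))" "\<forall>j\<le>s. l j \<in> C j"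
    using assms(3) by (auto simp: integral_span_def)
  define k' l' where "k' j = (if j \<le> r then k j else (\<lambda>_. 0))"
    and "l' j = (if j \<le> s then l j else (\<lambda>_. 0))" for j
  have kl': "k' j \<in> C j" "l' j \<in> C j" for j
    using U(2) W(2) kernel_spaceD(2)[OF C] by (auto simp: k'_def l'_def)
  have "U = (\<Sum>j\<le>r + s. I j (k' j))"
    unfolding U(1) by (rule sum.mono_neutral_cong_left) (auto simp: k'_def I_zero)
  moreover have "W = (\<Sum>j\<le>r + s. I j (l' j))"
    unfolding W(1) by (rule sum.mono_neutral_cong_left) (auto simp: l'_def I_zero)
  ultimately have "U + W = (\<Sum>j\<le>r + s. I j (\<lambda>t. k' j t + l' j t))"
    using I_add kl' kernel_spaceD(1)[OF C] by (simp add: sum.distrib)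
  then show ?thesis
    using kernel_spaceD(3)[OF C kl'] unfolding integral_span_def
    by (intro CollectI exI[of _ "r + s"] exI[of _ "\<lambda>j t. k' j t + l' j t"]) auto
qed

lemma integral_span_scale:
  assumes C: "kernel_space C" and "U \<in> integral_span I C"
  shows "c *\<^sub>C U \<in> integral_span I C"
proof -
  obtain r k where U: "U = (\<Sum>j\<le>r. I j (k j))" "\<forall>j\<le>r. k j \<in> C j"
    using assms(2) by (auto simp: integral_span_def)
  have "c *\<^sub>C U = (\<Sum>j\<le>r. I j (\<lambda>t. c * k j t))"
    using U I_scale kernel_spaceD(1)[OF C] by (simp add: scaleC_sum_right)
  then show ?thesis
    using kernel_spaceD(4)[OF C] U(2) unfolding integral_span_def
    by (intro CollectI exI[of _ r] exI[of _ "\<lambda>j t. c * k j t"]) auto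
qed

lemma integral_span_sum:
  assumes "kernel_space C" "finite J" "\<And>j. j \<in> J \<Longrightarrow> U j \<in> integral_span I C"
  shows "(\<Sum>j\<in>J. U j) \<in> integral_span I C"
  using assms(2,3)
proof (induction J rule: finite_induct)
  case empty
  then show ?case
    using integral_span_memI[OF assms(1) kernel_spaceD(2)[OF assms(1)], of 0] by (simp add: I_zero)
qed (simp add: integral_span_add[OF assms(1)])

lemma integral_span_induct [consumes 1, case_names integral add]:
  assumes "U \<in> integral_span I C"
    and "\<And>n h. h \<in> C n \<Longrightarrow> P (I n h)"
    and "\<And>U W. P U \<Longrightarrow> P W \<Longrightarrow> P (U + W)"
  shows "P U"
proof -
  obtain r k where U: "U = (\<Sum>j\<le>r. I j (k j))" "\<forall>j\<le>r. k j \<in> C j"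
    using assms(1) by (auto simp: integral_span_def)
  have "s \<le> r \<Longrightarrow> P (\<Sum>j\<le>s. I j (k j))" for s
    by (induction s) (use U(2) assms(2,3) in auto)
  then show ?thesis using U(1) by simp
qed

lemma integral_span_mono:
  assumes "\<And>n. C n \<subseteq> D n"
  shows "integral_span I C \<subseteq> integral_span I D"
  using assms unfolding integral_span_def by blast

lemma integral_span_prod:
  assumes E: "kernel_space E"
    and "\<And>a b h k. h \<in> C a \<Longrightarrow> k \<in> D b \<Longrightarrow>
           \<exists>Z\<in>integral_span I E. has_product (I a h) (I b k) Z"
    and U: "U \<in> integral_span I C" and W: "W \<in> integral_span I D"
  shows "\<exists>Z\<in>integral_span I E. has_product U W Z"
  using U
proof (induction rule: integral_span_induct)
  case (integral a h)
  show ?case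
    using W
  proof (induction rule: integral_span_induct)
    case (integral b k)
    then show ?case using \<open>h \<in> C a\<close> assms(2) by blast
  qed (blast intro: is_L2_prod_add_right integral_span_add[OF E])
qed (blast intro: is_L2_prod_add_left integral_span_add[OF E])

lemma L2_state_I:
  assumes "h \<in> sq_integrable n" "n > 0"
  shows "L2_state \<iota> (I n h) = 0"
  unfolding L2_state_def I_one[symmetric]
  using assms by (intro I_orthogonal const_sq_integrable_0) auto

lemma L2_state_positive_span:
  assumes C: "kernel_space C" and "U \<in> integral_span I (positive_order C)"
  shows "L2_state \<iota> U = 0"
  using assms(2)
proof (induction rule: integral_span_induct)
  case (integral n h)
  then show ?case
    using L2_state_I[of h n] kernel_spaceD(1)[OF C]
    by (cases "n = 0") (auto simp: positive_order_def I_zero L2_state_def)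
qed (simp add: L2_state_add)

lemma I_0_eq:
  assumes "h \<in> sq_integrable 0"
  shows "I 0 h = h (\<lambda>_. undefined) *\<^sub>C L2_one \<iota>"
proof -
  have "I 0 h = I 0 (\<lambda>_. h (\<lambda>_. undefined))"
    by (intro I_cong assms const_sq_integrable_0 AE_I2) (simp add: space_half_line_power_0)
  then show ?thesis by (simp add: I_const)
qed

text \<open>Orders are orthogonal and an integral of order \<open>0\<close> is a multiple of \<open>1\<close>, so that the state is
  the coefficient of that multiple.\<close>

lemma centred_positive_span:
  assumes C: "kernel_space C" and U: "U \<in> integral_span I C" and "L2_state \<iota> U = 0"
  shows "U \<in> integral_span I (positive_order C)"
proof -
  have P: "kernel_space (positive_order C)"
    by (rule kernel_space_positive_order[OF C])
  have "\<exists>c. \<exists>W\<in>integral_span I (positive_order C). U = c *\<^sub>C L2_one \<iota> + W"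
    using U
  proof (induction rule: integral_span_induct)
    case (integral n h)
    show ?case
    proof (cases "n = 0")
      case True
      have "0 \<in> integral_span I (positive_order C)"
        using integral_span_memI[OF P kernel_spaceD(2)[OF P], of 0] by (simp add: I_zero)
      then show ?thesis
        using True I_0_eq[of h] kernel_spaceD(1)[OF C integral]
        by (intro exI[of _ "h (\<lambda>_. undefined)"] bexI[of _ 0]) auto
    next
      case False
      then have "I n h \<in> integral_span I (positive_order C)"
        using integral by (intro integral_span_memI[OF P]) (simp add: positive_order_def)
      then show ?thesis
        by (intro exI[of _ 0] bexI[of _ "I n h"]) (auto simp: scaleC_zero_left)
    qed
  next
    case (add U W)
    then obtain c U' d W' where "U = c *\<^sub>C L2_one \<iota> + U'" "W = d *\<^sub>C L2_one \<iota> + W'"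
      "U' \<in> integral_span I (positive_order C)" "W' \<in> integral_span I (positive_order C)"
      by blast
    then show ?case
      using integral_span_add[OF P]
      by (intro exI[of _ "c + d"] bexI[of _ "U' + W'"]) (auto simp: scaleC_add_left)
  qed
  then obtain c W where W: "W \<in> integral_span I (positive_order C)" "U = c *\<^sub>C L2_one \<iota> + W"
    by blast
  then have "c = 0"
    using assms(3) L2_state_positive_span[OF C W(1)]
    by (simp add: L2_state_add L2_state_scale L2_state_one)
  then show ?thesis using W by (simp add: scaleC_zero_left)
qed

text \<open>The class \<open>F i\<close> belongs to the \<open>i\<close>-th variable. The larger class \<open>L i\<close> collects the kernels that may
  arise when a word begins with a factor of type \<open>i\<close>: only their first variable is controlled.\<close>

lemma L2_free_kernel_classes:
  fixes F L :: "nat \<Rightarrow> nat \<Rightarrow> kernel set"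
  assumes F: "\<And>i. i < length Xs \<Longrightarrow> kernel_space (F i)"
    and L: "\<And>i. i < length Xs \<Longrightarrow> kernel_space (L i)"
    and const: "\<And>i c. i < length Xs \<Longrightarrow> (\<lambda>_. c) \<in> F i 0"
    and FL: "\<And>i a. i < length Xs \<Longrightarrow> 0 < a \<Longrightarrow> F i a \<subseteq> L i a"
    and unit_left: "\<And>i a h. i < length Xs \<Longrightarrow> h \<in> L i a \<Longrightarrow>
          has_product (L2_one \<iota>) (I a h) (I a h)"
    and unit_right: "\<And>i a h. i < length Xs \<Longrightarrow> h \<in> F i a \<Longrightarrow>
          has_product (I a h) (L2_one \<iota>) (I a h)"
    and prod: "\<And>i a b h k. i < length Xs \<Longrightarrow> h \<in> F i a \<Longrightarrow> k \<in> F i b \<Longrightarrow>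
          \<exists>Z\<in>integral_span I (F i). has_product (I a h) (I b k) Z"
    and step: "\<And>i j a b h k. i < length Xs \<Longrightarrow> j < length Xs \<Longrightarrow> i \<noteq> j \<Longrightarrow> 0 < a \<Longrightarrow> 0 < b \<Longrightarrow>
          h \<in> F i a \<Longrightarrow> k \<in> L j b \<Longrightarrow>
          \<exists>Z\<in>integral_span I (positive_order (L i)). has_product (I a h) (I b k) Z"
    and X: "\<And>i. i < length Xs \<Longrightarrow> \<exists>a. \<exists>h\<in>F i a. Xs ! i = I a h"
  shows "L2_free A \<phi> \<iota> Xs"
proof (rule L2_freeI[where S = "\<lambda>i. integral_span I (F i)"
      and T = "\<lambda>i. integral_span I (positive_order (L i))"])
  fix i assume i: "i < length Xs"
  show "L2_one \<iota> \<in> integral_span I (F i)"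
    using integral_span_memI[OF F[OF i] const[OF i], of 1] by (simp add: I_one)
  show "Xs ! i \<in> integral_span I (F i)"
    using X[OF i] integral_span_memI[OF F[OF i]] by auto
  show "U + W \<in> integral_span I (F i)"
    if "U \<in> integral_span I (F i)" "W \<in> integral_span I (F i)" for U W
    using integral_span_add[OF F[OF i] that] .
  show "c *\<^sub>C U \<in> integral_span I (F i)" if "U \<in> integral_span I (F i)" for c U
    using integral_span_scale[OF F[OF i] that] .
  show "\<exists>Z\<in>integral_span I (F i). has_product U W Z"
    if "U \<in> integral_span I (F i)" "W \<in> integral_span I (F i)" for U W
    using integral_span_prod[OF F[OF i] prod[OF i] that] by blast
  show "L2_state \<iota> Z = 0" if "Z \<in> integral_span I (positive_order (L i))" for Z
    using L2_state_positive_span[OF L[OF i] that] .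
next
  fix i U assume i: "i < length Xs" and U: "U \<in> integral_span I (F i)" "L2_state \<iota> U = 0"
  have "U \<in> integral_span I (positive_order (F i))"
    by (rule centred_positive_span[OF F[OF i] U])
  moreover have "positive_order (F i) n \<subseteq> positive_order (L i) n" for n
    using FL[OF i] by (auto simp: positive_order_def)
  ultimately have "U \<in> integral_span I (positive_order (L i))"
    using integral_span_mono by blast
  moreover have "has_product U (L2_one \<iota>) U"
    using U(1) by (induction rule: integral_span_induct)
      (auto intro: unit_right[OF i] is_L2_prod_add_left)
  ultimately show "\<exists>Z\<in>integral_span I (positive_order (L i)). has_product U (L2_one \<iota>) Z"
    by blast
next
  fix i j U W
  assume i: "i < length Xs" and j: "j < length Xs" and ij: "i \<noteq> j"
    and U: "U \<in> integral_span I (F i)" "L2_state \<iota> U = 0"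
    and W: "W \<in> integral_span I (positive_order (L j))"
  have P: "kernel_space (positive_order (L i))"
    by (rule kernel_space_positive_order[OF L[OF i]])
  have zero: "0 \<in> integral_span I (positive_order (L i))"
    using integral_span_memI[OF P kernel_spaceD(2)[OF P], of 0] by (simp add: I_zero)
  have "\<exists>Z\<in>integral_span I (positive_order (L i)). has_product (I a h) (I b k) Z"
    if h: "h \<in> positive_order (F i) a" and k: "k \<in> positive_order (L j) b" for a b h k
  proof -
    have k0: "has_product (L2_one \<iota>) (I b k) (I b k)"
      using unit_left[OF j, of k b] unit_left[OF j kernel_spaceD(2)[OF L[OF j]], of b] k
      by (cases "b = 0") (auto simp: positive_order_def)
    have h0: "has_product (I a h) (L2_one \<iota>) (I a h)"
      using unit_right[OF i, of h a] unit_right[OF i kernel_spaceD(2)[OF F[OF i]], of a] h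
      by (cases "a = 0") (auto simp: positive_order_def)
    consider "a = 0" | "b = 0" | "0 < a" "0 < b" by blast
    then show ?thesis
    proof cases
      case 1
      then have "I a h = 0" using h by (simp add: positive_order_def I_zero)
      then have "has_product (I a h) (I b k) 0"
        using is_L2_prod_diff_left[OF k0 k0] by simp
      then show ?thesis using zero by blast
    next
      case 2
      then have "I b k = 0" using k by (simp add: positive_order_def I_zero)
      then have "has_product (I a h) (I b k) 0"
        using is_L2_prod_diff_right[OF h0 h0] by simp
      then show ?thesis using zero by blast
    next
      case 3
      then show ?thesis
        using step[OF i j ij 3, of h k] h k by (simp add: positive_order_def)
    qed
  qed
  from integral_span_prod[OF P this centred_positive_span[OF F[OF i] U] W]
  show "\<exists>Z\<in>integral_span I (positive_order (L i)). has_product U W Z"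
    by blast
qed

end

section \<open>Null sets and Fubini's theorem on powers of the half line\<close>

abbreviation HL :: "nat \<Rightarrow> (nat \<Rightarrow> real) measure" where
  "HL \<equiv> half_line_power"

abbreviation half_line :: "real measure" where
  "half_line \<equiv> restrict_space lborel {0..}"

text \<open>All maps between powers of the half line that occur below are compositions of two kinds: \<open>glue a b\<close>
  concatenates points of dimensions \<open>a\<close> and \<open>b\<close>, and \<open>pull k \<sigma>\<close> selects the coordinates
  \<open>\<sigma> 0, \<dots>, \<sigma> (k - 1)\<close>. Measure-theoretic facts are proved once for each kind; what remains for a
  contraction is arithmetic on the index map \<open>\<sigma>\<close>.\<close>

definition glue :: "nat \<Rightarrow> nat \<Rightarrow> (nat \<Rightarrow> real) \<Rightarrow> (nat \<Rightarrow> real) \<Rightarrow> nat \<Rightarrow> real" where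
  "glue a b t s = (\<lambda>i\<in>{..<a + b}. if i < a then t i else s (i - a))"

definition pull :: "nat \<Rightarrow> (nat \<Rightarrow> nat) \<Rightarrow> (nat \<Rightarrow> real) \<Rightarrow> nat \<Rightarrow> real" where
  "pull k \<sigma> z = (\<lambda>i\<in>{..<k}. z (\<sigma> i))"

lemma sigma_finite_half_line: "sigma_finite_measure half_line"
  by (rule sigma_finite_measure_restrict_space) (simp_all add: lborel.sigma_finite_measure_axioms)

interpretation half_line: product_sigma_finite "\<lambda>_::nat. half_line"
  unfolding product_sigma_finite_def using sigma_finite_half_line by blast

interpretation HL: sigma_finite_measure "half_line_power n" for n
  unfolding half_line_power_def by (rule half_line.sigma_finite) simp

interpretation HL2: pair_sigma_finite "half_line_power a" "half_line_power b" for a b ..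

lemma emeasure_HL_box:
  "(\<And>i. i < n \<Longrightarrow> A i \<in> sets half_line) \<Longrightarrow>
    emeasure (HL n) (Pi\<^sub>E {..<n} A) = (\<Prod>i<n. emeasure half_line (A i))"
  unfolding half_line_power_def by (rule half_line.emeasure_PiM) auto

lemma HL_eqI:
  assumes "sets P = sets (HL n)"
    and "\<And>A. (\<And>i. i < n \<Longrightarrow> A i \<in> sets half_line) \<Longrightarrow>
           emeasure P (Pi\<^sub>E {..<n} A) = (\<Prod>i<n. emeasure half_line (A i))"
  shows "P = HL n"
  unfolding half_line_power_def
  by (rule half_line.PiM_eqI) (use assms in \<open>auto simp: half_line_power_def\<close>)

lemma space_HL: "space (HL n) = {..<n} \<rightarrow>\<^sub>E {0..}"
  by (simp add: half_line_power_def space_PiM space_restrict_space)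

lemma box_in_HL: "(\<And>i. i < n \<Longrightarrow> A i \<in> sets half_line) \<Longrightarrow> Pi\<^sub>E {..<n} A \<in> sets (HL n)"
  unfolding half_line_power_def by (rule sets_PiM_I_finite) auto

lemma measurable_HL_component [measurable]: "i < n \<Longrightarrow> (\<lambda>x. x i) \<in> HL n \<rightarrow>\<^sub>M half_line"
  unfolding half_line_power_def by (rule measurable_component_singleton) simp

lemma measurable_into_HL:
  assumes "\<And>i. i < n \<Longrightarrow> (\<lambda>x. f x i) \<in> M \<rightarrow>\<^sub>M half_line"
  shows "(\<lambda>x. \<lambda>i\<in>{..<n}. f x i) \<in> M \<rightarrow>\<^sub>M HL n"
  unfolding half_line_power_def by (rule measurable_restrict) (use assms in auto)

lemma measurable_pull:
  assumes "\<And>i. i < k \<Longrightarrow> \<sigma> i < n"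
  shows "pull k \<sigma> \<in> HL n \<rightarrow>\<^sub>M HL k"
  unfolding pull_def by (rule measurable_into_HL) (use assms in measurable)

lemma measurable_glue': "(\<lambda>p. glue a b (fst p) (snd p)) \<in> HL a \<Otimes>\<^sub>M HL b \<rightarrow>\<^sub>M HL (a + b)"
  unfolding glue_def
proof (rule measurable_into_HL)
  fix i assume "i < a + b"
  show "(\<lambda>p. if i < a then fst p i else snd p (i - a)) \<in> HL a \<Otimes>\<^sub>M HL b \<rightarrow>\<^sub>M half_line"
  proof (cases "i < a")
    case True
    then have "(\<lambda>p. fst p i) \<in> HL a \<Otimes>\<^sub>M HL b \<rightarrow>\<^sub>M half_line"
      by (intro measurable_compose[OF measurable_fst measurable_HL_component])
    then show ?thesis using True by simp
  next
    case False
    then have "(\<lambda>p. snd p (i - a)) \<in> HL a \<Otimes>\<^sub>M HL b \<rightarrow>\<^sub>M half_line"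
      using \<open>i < a + b\<close> by (intro measurable_compose[OF measurable_snd measurable_HL_component]) auto
    then show ?thesis using False by simp
  qed
qed

lemma measurable_glue [measurable (raw)]:
  assumes "f \<in> M \<rightarrow>\<^sub>M HL a" "g \<in> M \<rightarrow>\<^sub>M HL b"
  shows "(\<lambda>x. glue a b (f x) (g x)) \<in> M \<rightarrow>\<^sub>M HL (a + b)"
  using measurable_compose[OF measurable_Pair[OF assms] measurable_glue'] by simp

lemma pull_glue:
  "pull k \<sigma> (glue a b t s) = (\<lambda>i\<in>{..<k}. if \<sigma> i < a then t (\<sigma> i) else s (\<sigma> i - a))"
  if "\<And>i. i < k \<Longrightarrow> \<sigma> i < a + b"
  using that by (auto simp: pull_def glue_def)

lemma pull_pull: "(\<And>i. i < k \<Longrightarrow> \<sigma> i < n) \<Longrightarrow> pull k \<sigma> (pull n \<tau> z) = pull k (\<tau> \<circ> \<sigma>) z"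
  by (auto simp: pull_def)

lemma distr_glue: "distr (HL a \<Otimes>\<^sub>M HL b) (HL (a + b)) (\<lambda>p. glue a b (fst p) (snd p)) = HL (a + b)"
proof (rule HL_eqI)
  fix A :: "nat \<Rightarrow> real set" assume A: "\<And>i. i < a + b \<Longrightarrow> A i \<in> sets half_line"
  have pre: "(\<lambda>p. glue a b (fst p) (snd p)) -` Pi\<^sub>E {..<a + b} A \<inter> space (HL a \<Otimes>\<^sub>M HL b)
      = Pi\<^sub>E {..<a} A \<times> Pi\<^sub>E {..<b} (\<lambda>i. A (a + i))"
  proof (intro equalityI subsetI)
    fix p assume p: "p \<in> (\<lambda>p. glue a b (fst p) (snd p)) -` Pi\<^sub>E {..<a + b} A \<inter> space (HL a \<Otimes>\<^sub>M HL b)"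
    have mem: "glue a b (fst p) (snd p) i \<in> A i" if "i < a + b" for i
      using p that by auto
    have "fst p i \<in> A i" if "i < a" for i
      using mem[of i] that by (simp add: glue_def)
    moreover have "snd p i \<in> A (a + i)" if "i < b" for i
      using mem[of "a + i"] that by (simp add: glue_def)
    ultimately show "p \<in> Pi\<^sub>E {..<a} A \<times> Pi\<^sub>E {..<b} (\<lambda>i. A (a + i))"
      using p by (cases p) (auto simp: space_pair_measure space_HL PiE_iff)
  next
    fix p assume p: "p \<in> Pi\<^sub>E {..<a} A \<times> Pi\<^sub>E {..<b} (\<lambda>i. A (a + i))"
    then have "fst p i \<in> A i" if "i < a" for i
      using that by auto
    moreover have "snd p (i - a) \<in> A i" if "i < a + b" "\<not> i < a" for i
    proof -
      have "snd p (i - a) \<in> A (a + (i - a))"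
        using p that by (intro PiE_mem[of "snd p" "{..<b}" "\<lambda>i. A (a + i)"]) auto
      then show ?thesis using that by simp
    qed
    moreover have "p \<in> space (HL a \<Otimes>\<^sub>M HL b)"
    proof -
      have A0: "A i \<subseteq> {0..}" if "i < a + b" for i
        using sets.sets_into_space[OF A[OF that]] by (simp add: space_restrict_space)
      have "fst p i \<in> {0..}" if "i < a" for i
        using p A0[of i] that by auto
      moreover have "snd p i \<in> {0..}" if "i < b" for i
        using p A0[of "a + i"] that by auto
      ultimately show ?thesis
        using p by (cases p) (simp add: space_pair_measure space_HL PiE_iff)
    qed
    ultimately show "p \<in> (\<lambda>p. glue a b (fst p) (snd p)) -` Pi\<^sub>E {..<a + b} A \<inter> space (HL a \<Otimes>\<^sub>M HL b)"
      by (auto simp: glue_def)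
  qed
  have prod: "(\<Prod>i<a + b. emeasure half_line (A i))
      = (\<Prod>i<a. emeasure half_line (A i)) * (\<Prod>i<b. emeasure half_line (A (a + i)))"
    by (induction b) (simp_all add: mult.assoc)
  show "emeasure (distr (HL a \<Otimes>\<^sub>M HL b) (HL (a + b)) (\<lambda>p. glue a b (fst p) (snd p))) (Pi\<^sub>E {..<a + b} A)
      = (\<Prod>i<a + b. emeasure half_line (A i))"
    using A by (simp add: emeasure_distr measurable_glue' box_in_HL pre prod emeasure_HL_box
        HL.emeasure_pair_measure_Times)
qed simp

lemma distr_pull:
  assumes \<sigma>: "bij_betw \<sigma> {..<n} {..<n}"
  shows "distr (HL n) (HL n) (pull n \<sigma>) = HL n"
proof (rule HL_eqI)
  have lt: "\<sigma> i < n" if "i < n" for i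
    using \<sigma> that by (auto simp: bij_betw_def)
  fix A :: "nat \<Rightarrow> real set" assume A: "\<And>i. i < n \<Longrightarrow> A i \<in> sets half_line"
  define \<tau> where "\<tau> = the_inv_into {..<n} \<sigma>"
  have \<tau>: "bij_betw \<tau> {..<n} {..<n}"
    unfolding \<tau>_def by (rule bij_betw_the_inv_into[OF \<sigma>])
  have \<sigma>\<tau>: "\<sigma> (\<tau> i) = i" "\<tau> i < n" "\<tau> (\<sigma> i) = i" if "i < n" for i
    using that \<sigma> \<tau> unfolding \<tau>_def
    by (auto simp: bij_betw_def f_the_inv_into_f the_inv_into_f_f)
  have pre: "pull n \<sigma> -` Pi\<^sub>E {..<n} A \<inter> space (HL n) = Pi\<^sub>E {..<n} (\<lambda>i. A (\<tau> i))"
  proof (intro equalityI subsetI)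
    fix x assume x: "x \<in> pull n \<sigma> -` Pi\<^sub>E {..<n} A \<inter> space (HL n)"
    have "x i \<in> A (\<tau> i)" if "i < n" for i
    proof -
      have "pull n \<sigma> x (\<tau> i) \<in> A (\<tau> i)" using x \<sigma>\<tau>(2)[OF that] by auto
      then show ?thesis using \<sigma>\<tau>[OF that] by (simp add: pull_def)
    qed
    then show "x \<in> Pi\<^sub>E {..<n} (\<lambda>i. A (\<tau> i))"
      using x by (auto simp: space_HL PiE_iff)
  next
    fix x assume x: "x \<in> Pi\<^sub>E {..<n} (\<lambda>i. A (\<tau> i))"
    have "x (\<sigma> i) \<in> A i" if "i < n" for i
    proof -
      have "x (\<sigma> i) \<in> A (\<tau> (\<sigma> i))" using x lt[OF that] by auto
      then show ?thesis using \<sigma>\<tau>[OF that] by simp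
    qed
    moreover have "x i \<in> {0..}" if "i < n" for i
      using x sets.sets_into_space[OF A[OF \<sigma>\<tau>(2)[OF that]]] that
      by (auto simp: space_restrict_space)
    ultimately show "x \<in> pull n \<sigma> -` Pi\<^sub>E {..<n} A \<inter> space (HL n)"
      using x by (auto simp: pull_def space_HL PiE_iff)
  qed
  have "(\<Prod>i<n. emeasure half_line (A (\<tau> i))) = (\<Prod>i<n. emeasure half_line (A i))"
    by (rule prod.reindex_bij_betw[OF \<tau>])
  then show "emeasure (distr (HL n) (HL n) (pull n \<sigma>)) (Pi\<^sub>E {..<n} A)
      = (\<Prod>i<n. emeasure half_line (A i))"
    using A \<sigma>\<tau> by (simp add: emeasure_distr measurable_pull lt box_in_HL pre emeasure_HL_box)
qed simp

lemma nn_integral_glue: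
  assumes [measurable]: "F \<in> borel_measurable (HL (a + b))"
  shows "(\<integral>\<^sup>+z. F z \<partial>HL (a + b)) = (\<integral>\<^sup>+t. \<integral>\<^sup>+s. F (glue a b t s) \<partial>HL b \<partial>HL a)"
proof -
  have "(\<integral>\<^sup>+z. F z \<partial>HL (a + b)) = (\<integral>\<^sup>+p. F (glue a b (fst p) (snd p)) \<partial>(HL a \<Otimes>\<^sub>M HL b))"
    by (subst distr_glue[symmetric], rule nn_integral_distr) (simp_all add: measurable_glue')
  also have "\<dots> = (\<integral>\<^sup>+t. \<integral>\<^sup>+s. F (glue a b t s) \<partial>HL b \<partial>HL a)"
    using measurable_compose[OF measurable_glue' assms] by (subst HL.nn_integral_fst[symmetric]) auto
  finally show ?thesis .
qed

lemma nn_integral_pull: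
  assumes "F \<in> borel_measurable (HL n)" and \<sigma>: "bij_betw \<sigma> {..<n} {..<n}"
  shows "(\<integral>\<^sup>+z. F (pull n \<sigma> z) \<partial>HL n) = (\<integral>\<^sup>+z. F z \<partial>HL n)"
proof -
  have "pull n \<sigma> \<in> HL n \<rightarrow>\<^sub>M HL n"
    using \<sigma> by (intro measurable_pull) (auto simp: bij_betw_def)
  then have "(\<integral>\<^sup>+z. F z \<partial>distr (HL n) (HL n) (pull n \<sigma>)) = (\<integral>\<^sup>+z. F (pull n \<sigma> z) \<partial>HL n)"
    using assms(1) by (intro nn_integral_distr) simp_all
  then show ?thesis by (simp add: distr_pull[OF \<sigma>])
qed

lemma integral_glue:
  fixes F :: "(nat \<Rightarrow> real) \<Rightarrow> complex"
  assumes F: "integrable (HL (a + b)) F"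
  shows "(\<integral>z. F z \<partial>HL (a + b)) = (\<integral>t. \<integral>s. F (glue a b t s) \<partial>HL b \<partial>HL a)"
proof -
  have F': "integrable (distr (HL a \<Otimes>\<^sub>M HL b) (HL (a + b)) (\<lambda>p. glue a b (fst p) (snd p))) F"
    using F by (simp add: distr_glue)
  have int: "integrable (HL a \<Otimes>\<^sub>M HL b) (\<lambda>p. F (glue a b (fst p) (snd p)))"
    using F' by (subst (asm) integrable_distr_eq) (use F measurable_glue' in auto)
  have "(\<integral>z. F z \<partial>HL (a + b)) = (\<integral>p. F (glue a b (fst p) (snd p)) \<partial>(HL a \<Otimes>\<^sub>M HL b))"
    by (subst distr_glue[symmetric], rule integral_distr) (use F in \<open>simp_all add: measurable_glue'\<close>)
  also have "\<dots> = (\<integral>t. \<integral>s. F (glue a b t s) \<partial>HL b \<partial>HL a)"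
    using HL2.integral_fst'[OF int] by simp
  finally show ?thesis .
qed

lemma AE_glueD:
  assumes "AE z in HL (a + b). P z"
  shows "AE t in HL a. AE s in HL b. P (glue a b t s)"
proof -
  have "AE p in HL a \<Otimes>\<^sub>M HL b. P (glue a b (fst p) (snd p))"
    by (rule AE_distrD[OF measurable_glue']) (unfold distr_glue, rule assms)
  from HL2.AE_pair[OF this] show ?thesis by simp
qed

lemma AE_glueI:
  assumes meas: "{z \<in> space (HL (a + b)). P z} \<in> sets (HL (a + b))"
    and "AE t in HL a. AE s in HL b. P (glue a b t s)"
  shows "AE z in HL (a + b). P z"
proof -
  have "{p \<in> space (HL a \<Otimes>\<^sub>M HL b). P (glue a b (fst p) (snd p))}
      = (\<lambda>p. glue a b (fst p) (snd p)) -` {z \<in> space (HL (a + b)). P z} \<inter> space (HL a \<Otimes>\<^sub>M HL b)"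
    using measurable_space[OF measurable_glue'[of a b]] by blast
  then have "{p \<in> space (HL a \<Otimes>\<^sub>M HL b). P (glue a b (fst p) (snd p))} \<in> sets (HL a \<Otimes>\<^sub>M HL b)"
    using measurable_sets[OF measurable_glue' meas] by (simp only:)
  then have "AE p in HL a \<Otimes>\<^sub>M HL b. P (glue a b (fst p) (snd p))"
    using assms(2) by (intro HL2.AE_pair_measure) simp_all
  then have "AE z in distr (HL a \<Otimes>\<^sub>M HL b) (HL (a + b)) (\<lambda>p. glue a b (fst p) (snd p)). P z"
    by (simp add: AE_distr_iff[OF measurable_glue' meas])
  then show ?thesis unfolding distr_glue .
qed

lemma AE_pull_bij:
  assumes "AE x in HL n. P x" and \<sigma>: "bij_betw \<sigma> {..<n} {..<n}"
  shows "AE z in HL n. P (pull n \<sigma> z)"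
proof -
  have "pull n \<sigma> \<in> HL n \<rightarrow>\<^sub>M HL n"
    using \<sigma> by (intro measurable_pull) (auto simp: bij_betw_def)
  moreover have "AE z in distr (HL n) (HL n) (pull n \<sigma>). P z"
    unfolding distr_pull[OF \<sigma>] by (rule assms(1))
  ultimately show ?thesis by (rule AE_distrD)
qed

text \<open>Null sets pull back to null sets along the map that selects and reorders coordinates, as long
  as no coordinate is used twice.\<close>

lemma AE_pull:
  assumes P: "AE x in HL k. P x" and inj: "inj_on \<sigma> {..<k}" and lt: "\<And>i. i < k \<Longrightarrow> \<sigma> i < n"
  shows "AE z in HL n. P (pull k \<sigma> z)"
proof -
  have sub: "\<sigma> ` {..<k} \<subseteq> {..<n}" using lt by auto
  have kn: "k \<le> n"
    using card_mono[OF _ sub] card_image[OF inj] by simp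
  have "card ({..<n} - \<sigma> ` {..<k}) = card {k..<n}"
    using card_Diff_subset[OF _ sub] card_image[OF inj] by simp
  then obtain e where e: "bij_betw e {k..<n} ({..<n} - \<sigma> ` {..<k})"
    using finite_same_card_bij[of "{k..<n}" "{..<n} - \<sigma> ` {..<k}"] by auto
  define \<tau> where "\<tau> i = (if i < k then \<sigma> i else e i)" for i
  have "bij_betw \<tau> {..<k} (\<sigma> ` {..<k})"
    using inj by (auto simp: bij_betw_def \<tau>_def inj_on_def)
  moreover have "bij_betw \<tau> {k..<n} ({..<n} - \<sigma> ` {..<k})"
    using e by (subst bij_betw_cong[where g = e]) (auto simp: \<tau>_def)
  ultimately have "bij_betw \<tau> ({..<k} \<union> {k..<n}) (\<sigma> ` {..<k} \<union> ({..<n} - \<sigma> ` {..<k}))"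
    by (rule bij_betw_combine) auto
  moreover have "{..<k} \<union> {k..<n} = {..<n}" "\<sigma> ` {..<k} \<union> ({..<n} - \<sigma> ` {..<k}) = {..<n}"
    using kn sub by auto
  ultimately have \<tau>: "bij_betw \<tau> {..<n} {..<n}" by simp
  \<comment> \<open>Up to the permutation \<open>\<tau>\<close>, which extends \<open>\<sigma>\<close>, the map keeps the first \<open>k\<close> coordinates.\<close>
  obtain N where N: "N \<in> null_sets (HL k)" "{x \<in> space (HL k). \<not> P x} \<subseteq> N"
    using P unfolding eventually_ae_filter by blast
  have nN: "AE x in HL k. x \<notin> N"
    using N(1) by (rule AE_not_in)
  have id: "pull k id \<in> HL (k + (n - k)) \<rightarrow>\<^sub>M HL k"
    by (rule measurable_pull) simp
  have "AE w in HL (k + (n - k)). pull k id w \<notin> N"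
  proof (rule AE_glueI)
    have "N \<in> sets (HL k)" using N(1) by auto
    moreover have "{w \<in> space (HL (k + (n - k))). pull k id w \<notin> N}
        = pull k id -` (space (HL k) - N) \<inter> space (HL (k + (n - k)))"
      using measurable_space[OF id] by blast
    ultimately show "{w \<in> space (HL (k + (n - k))). pull k id w \<notin> N} \<in> sets (HL (k + (n - k)))"
      using measurable_sets[OF id, of "space (HL k) - N"] by auto
    have eq: "pull k id (glue k (n - k) t s) = t" if "t \<in> space (HL k)" for t s
      using that by (auto simp: pull_def glue_def space_HL PiE_iff extensional_def)
    show "AE t in HL k. AE s in HL (n - k). pull k id (glue k (n - k) t s) \<notin> N"
      by (rule AE_mp[OF nN AE_I2]) (simp add: eq)
  qed
  moreover have "k + (n - k) = n" using kn by simp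
  ultimately have "AE w in HL n. pull k id w \<notin> N" by (simp only:)
  from AE_pull_bij[OF this \<tau>] have "AE z in HL n. pull k id (pull n \<tau> z) \<notin> N" .
  moreover have "pull k id (pull n \<tau> z) = pull k \<sigma> z" for z
    using kn by (auto simp: pull_def \<tau>_def)
  ultimately have N': "AE z in HL n. pull k \<sigma> z \<notin> N" by simp
  have "pull k \<sigma> z \<in> space (HL k)" if "z \<in> space (HL n)" for z
    using measurable_space[OF measurable_pull[OF lt] that] .
  then show ?thesis
    by (intro AE_mp[OF N' AE_I2]) (use N(2) in blast)
qed

lemma AE_pull_glue:
  assumes "AE x in HL k. P x" and "inj_on \<sigma> {..<k}" and "\<And>i. i < k \<Longrightarrow> \<sigma> i < a + b"
  shows "AE t in HL a. AE s in HL b. P (pull k \<sigma> (glue a b t s))"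
  by (rule AE_glueD) (rule AE_pull[OF assms])

text \<open>Fubini's theorem with superfluous coordinates: the parameters of the slice may contain
  coordinates on which the function does not depend.\<close>

lemma AE_slice_nn_integral_finite:
  assumes F [measurable]: "F \<in> borel_measurable (HL a)" and fin: "(\<integral>\<^sup>+x. F x \<partial>HL a) < \<infinity>"
    and inj: "inj_on \<sigma> {..<a}" and lt: "\<And>i. i < a \<Longrightarrow> \<sigma> i < N + p"
    and onto: "{N..<N + p} \<subseteq> \<sigma> ` {..<a}"
  shows "AE t in HL N. (\<integral>\<^sup>+s. F (pull a \<sigma> (glue N p t s)) \<partial>HL p) < \<infinity>"
proof -
  define J where "J = {i. i < a \<and> \<sigma> i < N}"
  have img: "\<sigma> ` ({..<a} - J) = {N..<N + p}"
  proof (intro equalityI subsetI)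
    fix x assume "x \<in> {N..<N + p}"
    then obtain i where "i < a" "x = \<sigma> i" "N \<le> x" using onto by force
    then show "x \<in> \<sigma> ` ({..<a} - J)" by (auto simp: J_def)
  qed (use lt in \<open>auto simp: J_def\<close>)
  have "card ({..<a} - J) = p"
    using card_image[of \<sigma> "{..<a} - J"] inj img by (simp add: inj_on_diff)
  moreover have "card ({..<a} - J) = a - card J"
    using card_Diff_subset[of J "{..<a}"] by (auto simp: J_def)
  moreover have "card J \<le> a"
    using card_mono[of "{..<a}" J] by (auto simp: J_def)
  moreover define q where "q = card J"
  ultimately have a: "a = q + p" by simp
  have "finite J" by (simp add: J_def)
  then obtain e where e: "bij_betw e {..<q} J"
    using ex_bij_betw_nat_finite[of J] by (auto simp: q_def atLeast0LessThan)
  define e' where "e' = the_inv_into {..<q} e"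
  have e': "e' i < q" "e (e' i) = i" if "i \<in> J" for i
    using bij_betwE[OF bij_betw_the_inv_into[OF e]] f_the_inv_into_f_bij_betw[OF e] that
    by (auto simp: e'_def)
  \<comment> \<open>Only the \<open>q\<close> coordinates of \<open>t\<close> in \<open>\<sigma> ` J\<close> enter; on \<open>q + p\<close> coordinates the map becomes a
    permutation, to which Fubini's theorem applies.\<close>
  define \<rho> where "\<rho> i = (if \<sigma> i < N then e' i else q + (\<sigma> i - N))" for i
  have \<rho>_lt: "\<rho> i < a" if "i < a" for i
    using lt[OF that] e'(1)[of i] that by (auto simp: \<rho>_def J_def a)
  have "inj_on \<rho> {..<a}"
  proof (rule inj_onI)
    fix i j assume ij: "i \<in> {..<a}" "j \<in> {..<a}" "\<rho> i = \<rho> j"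
    consider "i \<in> J" "j \<in> J" | "i \<in> J" "j \<notin> J" | "i \<notin> J" "j \<in> J" | "i \<notin> J" "j \<notin> J" by blast
    then show "i = j"
    proof cases
      case 1
      then have "e' i = e' j" using ij by (simp add: \<rho>_def J_def)
      then show ?thesis using e'(2) 1 by metis
    next
      case 2
      then show ?thesis using ij e'(1)[of i] by (auto simp: \<rho>_def J_def)
    next
      case 3
      then show ?thesis using ij e'(1)[of j] by (auto simp: \<rho>_def J_def)
    next
      case 4
      then have "\<sigma> i = \<sigma> j" using ij by (auto simp: \<rho>_def J_def)
      then show ?thesis using inj ij by (auto dest: inj_onD)
    qed
  qed
  moreover have "\<rho> ` {..<a} = {..<a}"
    using \<open>inj_on \<rho> {..<a}\<close> \<rho>_lt by (intro card_subset_eq) (auto simp: card_image)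
  ultimately have \<rho>: "bij_betw \<rho> {..<a} {..<a}" by (simp add: bij_betw_def)
  have pull: "pull a \<rho> \<in> HL (q + p) \<rightarrow>\<^sub>M HL a"
    by (rule measurable_pull) (use \<rho>_lt in \<open>simp add: a[symmetric]\<close>)
  have "(\<integral>\<^sup>+y. \<integral>\<^sup>+s. F (pull a \<rho> (glue q p y s)) \<partial>HL p \<partial>HL q) = (\<integral>\<^sup>+x. F (pull a \<rho> x) \<partial>HL (q + p))"
    by (rule nn_integral_glue[OF measurable_compose[OF pull F], symmetric])
  also have "\<dots> = (\<integral>\<^sup>+x. F x \<partial>HL a)"
    using nn_integral_pull[OF F \<rho>] by (simp only: a)
  finally have "(\<integral>\<^sup>+y. \<integral>\<^sup>+s. F (pull a \<rho> (glue q p y s)) \<partial>HL p \<partial>HL q) \<noteq> \<infinity>"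
    using fin by simp
  moreover have "(\<lambda>y. \<integral>\<^sup>+s. F (pull a \<rho> (glue q p y s)) \<partial>HL p) \<in> borel_measurable (HL q)"
    using measurable_compose[OF measurable_glue' measurable_compose[OF pull F]]
    by (intro HL.borel_measurable_nn_integral) (simp add: split_beta')
  ultimately have "AE y in HL q. (\<integral>\<^sup>+s. F (pull a \<rho> (glue q p y s)) \<partial>HL p) \<noteq> \<infinity>"
    by (rule nn_integral_PInf_AE[rotated])
  moreover have "inj_on (\<sigma> \<circ> e) {..<q}"
    using e inj by (intro comp_inj_on) (auto simp: bij_betw_def J_def intro: inj_on_subset)
  moreover have "(\<sigma> \<circ> e) i < N" if "i < q" for i
    using bij_betwE[OF e] that by (auto simp: J_def)
  ultimately have "AE t in HL N. (\<integral>\<^sup>+s. F (pull a \<rho> (glue q p (pull q (\<sigma> \<circ> e) t) s)) \<partial>HL p) \<noteq> \<infinity>"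
    by (rule AE_pull)
  moreover have "pull a \<rho> (glue q p (pull q (\<sigma> \<circ> e) t) s) = pull a \<sigma> (glue N p t s)" for t s
  proof
    fix i
    show "pull a \<rho> (glue q p (pull q (\<sigma> \<circ> e) t) s) i = pull a \<sigma> (glue N p t s) i"
      using lt[of i] \<rho>_lt[of i] e'[of i] a
      by (cases "i < a"; cases "\<sigma> i < N") (auto simp: pull_def glue_def \<rho>_def J_def)
  qed
  ultimately show ?thesis by (simp add: less_top)
qed

section \<open>Contractions as pairings\<close>

text \<open>A contraction integrates over \<open>s \<in> \<real>\<^sub>+\<^sup>p\<close> a product of values of the two kernels at points whose
  coordinates are coordinates of the point \<open>glue N p t s\<close>. The following index maps say which ones,
  for the first and the second kernel and the two kinds of contractions.\<close>

definition contr_left :: "nat \<Rightarrow> nat \<Rightarrow> nat \<Rightarrow> nat \<Rightarrow> nat" where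
  "contr_left n m p i = (if i < n - p then i else (n + m - 2 * p) + (i - (n - p)))"

definition contr_right :: "nat \<Rightarrow> nat \<Rightarrow> nat \<Rightarrow> nat \<Rightarrow> nat" where
  "contr_right n m p i = (if i < p then (n + m - 2 * p) + (p - 1 - i) else n - p + (i - p))"

definition star_left :: "nat \<Rightarrow> nat \<Rightarrow> nat \<Rightarrow> nat \<Rightarrow> nat" where
  "star_left n m p i =
     (if i < n - p + 1 then i else (n + m - 2 * p + 1) + (p - 2 - (i - (n - p + 1))))"

definition star_right :: "nat \<Rightarrow> nat \<Rightarrow> nat \<Rightarrow> nat \<Rightarrow> nat" where
  "star_right n m p i =
     (if i < p - 1 then (n + m - 2 * p + 1) + i else n - p + (i - (p - 1)))"

definition pairing :: "nat \<Rightarrow> (nat \<Rightarrow> nat) \<Rightarrow> nat \<Rightarrow> (nat \<Rightarrow> nat) \<Rightarrow> nat \<Rightarrow> nat \<Rightarrow> kernel \<Rightarrow> kernel \<Rightarrow> kernel"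
  where "pairing a \<sigma> b \<tau> N p h k =
    (\<lambda>t. \<integral>s. h (pull a \<sigma> (glue N p t s)) * k (pull b \<tau> (glue N p t s)) \<partial>HL p)"

lemma contr_left_lt: "p \<le> min n m \<Longrightarrow> i < n \<Longrightarrow> contr_left n m p i < (n + m - 2 * p) + p"
  and contr_right_lt: "p \<le> min n m \<Longrightarrow> i < m \<Longrightarrow> contr_right n m p i < (n + m - 2 * p) + p"
  by (auto simp: contr_left_def contr_right_def)

lemma inj_contr_left: "p \<le> min n m \<Longrightarrow> inj_on (contr_left n m p) {..<n}"
  and inj_contr_right: "p \<le> min n m \<Longrightarrow> inj_on (contr_right n m p) {..<m}"
  by (auto simp: contr_left_def contr_right_def inj_on_def split: if_splits)

text \<open>Every integrated variable occurs in both kernels.\<close>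

lemma contr_left_onto:
  assumes p: "p \<le> min n m"
  shows "{n + m - 2 * p..<n + m - 2 * p + p} \<subseteq> contr_left n m p ` {..<n}"
proof
  fix c assume c: "c \<in> {n + m - 2 * p..<n + m - 2 * p + p}"
  then have "contr_left n m p (n - p + (c - (n + m - 2 * p))) = c"
    by (auto simp: contr_left_def)
  moreover have "n - p + (c - (n + m - 2 * p)) < n" using c p by auto
  ultimately show "c \<in> contr_left n m p ` {..<n}" by (metis imageI lessThan_iff)
qed

lemma contr_right_onto:
  assumes p: "p \<le> min n m"
  shows "{n + m - 2 * p..<n + m - 2 * p + p} \<subseteq> contr_right n m p ` {..<m}"
proof
  fix c assume c: "c \<in> {n + m - 2 * p..<n + m - 2 * p + p}"
  then have "contr_right n m p (p - 1 - (c - (n + m - 2 * p))) = c"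
    by (auto simp: contr_right_def)
  moreover have "p - 1 - (c - (n + m - 2 * p)) < m" using c p by auto
  ultimately show "c \<in> contr_right n m p ` {..<m}" by (metis imageI lessThan_iff)
qed

lemma star_left_lt: "p \<in> {1..min n m} \<Longrightarrow> i < n \<Longrightarrow> star_left n m p i < (n + m - 2 * p + 1) + (p - 1)"
  and star_right_lt: "p \<in> {1..min n m} \<Longrightarrow> i < m \<Longrightarrow> star_right n m p i < (n + m - 2 * p + 1) + (p - 1)"
  by (auto simp: star_left_def star_right_def)

lemma inj_star_left: "p \<in> {1..min n m} \<Longrightarrow> inj_on (star_left n m p) {..<n}"
  and inj_star_right: "p \<in> {1..min n m} \<Longrightarrow> inj_on (star_right n m p) {..<m}"
  by (auto simp: star_left_def star_right_def inj_on_def split: if_splits)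

lemma contraction_eq_pairing:
  assumes "p \<le> min n m"
  shows "contraction n m p f g
    = pairing n (contr_left n m p) m (contr_right n m p) (n + m - 2 * p) p f g"
proof -
  have l: "pull n (contr_left n m p) (glue (n + m - 2 * p) p t s)
      = (\<lambda>i\<in>{..<n}. if i < n - p then t i else s (i - (n - p)))" for t s
    using assms by (subst pull_glue) (auto simp: contr_left_lt contr_left_def intro!: restrict_ext)
  have r: "pull m (contr_right n m p) (glue (n + m - 2 * p) p t s)
      = (\<lambda>i\<in>{..<m}. if i < p then s (p - 1 - i) else t (n - p + (i - p)))" for t s
    using assms by (subst pull_glue) (auto simp: contr_right_lt contr_right_def intro!: restrict_ext)
  show ?thesis
    by (simp add: contraction_def pairing_def l r)
qed

lemma glue_left: "i < a \<Longrightarrow> glue a b t s i = t i"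
  and glue_right: "i < b \<Longrightarrow> glue a b t s (a + i) = s i"
  by (simp_all add: glue_def)

lemma star_contraction_eq_pairing:
  assumes "p \<in> {1..min n m}"
  shows "star_contraction n m p f g
    = pairing n (star_left n m p) m (star_right n m p) (n + m - 2 * p + 1) (p - 1) f g"
proof -
  have "glue (n + m - 2 * p + 1) (p - 1) t s (star_left n m p i)
      = (if i < n - p + 1 then t i else s (p - 2 - (i - (n - p + 1))))" if "i < n" for t s i
  proof (cases "i < n - p + 1")
    case True
    then have "i < n + m - 2 * p + 1" using assms by auto
    then show ?thesis using True by (simp add: star_left_def glue_left)
  next
    case False
    then have "p - 2 - (i - (n - p + 1)) < p - 1" using assms that by auto
    then show ?thesis
      using False by (simp add: star_left_def glue_right del: add_Suc add_Suc_right)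
  qed
  then have l: "pull n (star_left n m p) (glue (n + m - 2 * p + 1) (p - 1) t s)
      = (\<lambda>i\<in>{..<n}. if i < n - p + 1 then t i else s (p - 2 - (i - (n - p + 1))))" for t s
    by (auto simp: pull_def)
  have "glue (n + m - 2 * p + 1) (p - 1) t s (star_right n m p i)
      = (if i < p - 1 then s i else t (n - p + (i - (p - 1))))" if "i < m" for t s i
  proof (cases "i < p - 1")
    case True
    then show ?thesis by (simp add: star_right_def glue_right del: add_Suc add_Suc_right)
  next
    case False
    then have "n - p + (i - (p - 1)) < n + m - 2 * p + 1" using assms that by auto
    then show ?thesis using False by (simp add: star_right_def glue_left)
  qed
  then have r: "pull m (star_right n m p) (glue (n + m - 2 * p + 1) (p - 1) t s)
      = (\<lambda>i\<in>{..<m}. if i < p - 1 then s i else t (n - p + (i - (p - 1))))" for t s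
    by (auto simp: pull_def)
  show ?thesis
    by (simp add: star_contraction_def pairing_def l r del: One_nat_def)
qed

lemma measure_HL_0: "measure (HL 0) (space (HL 0)) = 1"
  by (simp add: half_line_power_def PiM_empty)

lemma contraction_0:
  "contraction n m 0 f g = (\<lambda>t. f (\<lambda>i\<in>{..<n}. t i) * g (\<lambda>i\<in>{..<m}. t (n + i)))"
  by (simp add: contraction_def measure_HL_0 cong: restrict_cong)

lemma star_contraction_1:
  assumes "n \<ge> 1"
  shows "star_contraction n m 1 f g
    = (\<lambda>t. f (\<lambda>i\<in>{..<n}. t i) * g (\<lambda>i\<in>{..<m}. t (n - 1 + i)))"
  using assms by (simp add: star_contraction_def measure_HL_0 cong: restrict_cong)

lemma restrict_space_HL: "t \<in> space (HL n) \<Longrightarrow> (\<lambda>i\<in>{..<n}. t i) = t"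
  by (auto simp: space_HL PiE_iff extensional_def)

lemma sq_integrable_iff:
  "f \<in> sq_integrable n \<longleftrightarrow>
     f \<in> borel_measurable (HL n) \<and> (\<integral>\<^sup>+t. ennreal ((cmod (f t))\<^sup>2) \<partial>HL n) < \<infinity>"
  unfolding sq_integrable_def by (auto simp: integrable_iff_bounded)

lemma sq_integrable_pull:
  assumes f: "f \<in> sq_integrable n" and \<sigma>: "bij_betw \<sigma> {..<n} {..<n}"
  shows "(\<lambda>t. f (pull n \<sigma> t)) \<in> sq_integrable n"
proof -
  have "pull n \<sigma> \<in> HL n \<rightarrow>\<^sub>M HL n"
    using \<sigma> by (intro measurable_pull) (auto simp: bij_betw_def)
  moreover have "(\<integral>\<^sup>+t. ennreal ((cmod (f (pull n \<sigma> t)))\<^sup>2) \<partial>HL n)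
      = (\<integral>\<^sup>+t. ennreal ((cmod (f t))\<^sup>2) \<partial>HL n)"
    using f by (intro nn_integral_pull[OF _ \<sigma>]) (auto simp: sq_integrable_iff)
  ultimately show ?thesis
    using f by (auto simp: sq_integrable_iff intro: measurable_compose)
qed

lemma bij_betw_rev: "bij_betw (\<lambda>i. n - 1 - i) {..<n::nat} {..<n}"
  by (rule bij_betw_byWitness[where f' = "\<lambda>i. n - 1 - i"]) auto

lemma adj_kernel_eq_pull: "adj_kernel n f = (\<lambda>t. cnj (f (pull n (\<lambda>i. n - 1 - i) t)))"
  by (simp add: adj_kernel_def pull_def)

lemma sq_integrable_adj_kernel:
  assumes "f \<in> sq_integrable n"
  shows "adj_kernel n f \<in> sq_integrable n"
proof -
  have "(\<lambda>t. cnj (f (pull n (\<lambda>i. n - 1 - i) t))) \<in> borel_measurable (HL n)"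
    using sq_integrable_pull[OF assms bij_betw_rev]
    by (intro borel_measurable_continuous_on[where f = cnj] continuous_intros)
      (simp add: sq_integrable_iff)
  then show ?thesis
    using sq_integrable_pull[OF assms bij_betw_rev] by (simp add: adj_kernel_eq_pull sq_integrable_iff)
qed

lemma symmetric_kernelD:
  assumes "symmetric_kernel n f" "\<sigma> permutes {..<n}"
  shows "AE t in HL n. f t = f (pull n \<sigma> t)"
  using assms unfolding symmetric_kernel_def pull_def by blast

lemma adj_kernel_symmetric:
  assumes "symmetric_kernel n f"
  shows "AE t in HL n. adj_kernel n f t = f t"
proof -
  define \<sigma> where "\<sigma> i = (if i < n then n - 1 - i else i)" for i
  have "bij_betw \<sigma> {..<n} {..<n} \<longleftrightarrow> bij_betw (\<lambda>i. n - 1 - i) {..<n} {..<n}"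
    by (rule bij_betw_cong) (simp add: \<sigma>_def)
  then have "bij_betw \<sigma> {..<n} {..<n}" by (simp only: bij_betw_rev)
  then have "\<sigma> permutes {..<n}"
    by (rule bij_imp_permutes) (simp add: \<sigma>_def)
  moreover have "pull n \<sigma> = pull n (\<lambda>i. n - 1 - i)"
    by (auto simp: pull_def \<sigma>_def fun_eq_iff)
  ultimately have "AE t in HL n. f t = f (pull n (\<lambda>i. n - 1 - i) t)"
    using symmetric_kernelD[OF assms] by metis
  moreover have "AE t in HL n. f t \<in> \<real>"
    using assms by (simp add: symmetric_kernel_def)
  ultimately show ?thesis
    by eventually_elim (metis adj_kernel_eq_pull Reals_cnj_iff)
qed

lemma nn_integral_tensor:
  assumes f: "f \<in> sq_integrable n" and g: "g \<in> sq_integrable m"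
  shows "(\<integral>\<^sup>+t. ennreal ((cmod (contraction n m 0 f g t))\<^sup>2) \<partial>HL (n + m))
    = (\<integral>\<^sup>+t. ennreal ((cmod (f t))\<^sup>2) \<partial>HL n) * (\<integral>\<^sup>+t. ennreal ((cmod (g t))\<^sup>2) \<partial>HL m)"
    (is "?I = ?F * ?G")
    and measurable_tensor: "contraction n m 0 f g \<in> borel_measurable (HL (n + m))"
proof -
  have [measurable]: "f \<in> borel_measurable (HL n)" "g \<in> borel_measurable (HL m)"
    using f g by (simp_all add: sq_integrable_iff)
  have [measurable]: "(\<lambda>t. f (\<lambda>i\<in>{..<n}. t i)) \<in> borel_measurable (HL (n + m))"
    "(\<lambda>t. g (\<lambda>i\<in>{..<m}. t (n + i))) \<in> borel_measurable (HL (n + m))"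
    by (auto intro!: measurable_compose[OF measurable_into_HL] measurable_HL_component)
  show meas: "contraction n m 0 f g \<in> borel_measurable (HL (n + m))"
    unfolding contraction_0 by measurable
  have "?I = (\<integral>\<^sup>+t. \<integral>\<^sup>+s. ennreal ((cmod (contraction n m 0 f g (glue n m t s)))\<^sup>2) \<partial>HL m \<partial>HL n)"
    using meas by (intro nn_integral_glue) simp
  also have "\<dots> = (\<integral>\<^sup>+t. \<integral>\<^sup>+s. ennreal ((cmod (f t))\<^sup>2) * ennreal ((cmod (g s))\<^sup>2) \<partial>HL m \<partial>HL n)"
  proof (intro nn_integral_cong)
    fix t s assume ts: "t \<in> space (HL n)" "s \<in> space (HL m)"
    have "(\<lambda>i\<in>{..<n}. glue n m t s i) = t" "(\<lambda>i\<in>{..<m}. glue n m t s (n + i)) = s"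
      using ts by (auto simp: glue_def space_HL PiE_iff extensional_def)
    then show "ennreal ((cmod (contraction n m 0 f g (glue n m t s)))\<^sup>2)
        = ennreal ((cmod (f t))\<^sup>2) * ennreal ((cmod (g s))\<^sup>2)"
      by (simp add: contraction_0 norm_mult power_mult_distrib ennreal_mult)
  qed
  also have "\<dots> = ?F * ?G"
    by (simp add: nn_integral_cmult nn_integral_multc)
  finally show "?I = ?F * ?G" .
qed

lemma tensor_sq_integrable:
  assumes "f \<in> sq_integrable n" "g \<in> sq_integrable m"
  shows "contraction n m 0 f g \<in> sq_integrable (n + m)"
  using nn_integral_tensor[OF assms] measurable_tensor[OF assms] assms
  by (simp add: sq_integrable_iff ennreal_mult_less_top)

section \<open>Free integrals have vanishing contractions\<close>

lemma orthogonal_sum_eq_0: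
  fixes x :: "'i \<Rightarrow> 'a::complex_hilbert_space"
  assumes "finite J" and orth: "\<And>i j. i \<in> J \<Longrightarrow> j \<in> J \<Longrightarrow> i \<noteq> j \<Longrightarrow> cinner (x i) (x j) = 0"
    and j0: "j0 \<in> J" and norm: "cinner (\<Sum>j\<in>J. x j) (\<Sum>j\<in>J. x j) = cinner (x j0) (x j0)"
    and j: "j \<in> J" "j \<noteq> j0"
  shows "x j = 0"
proof -
  have "cinner (\<Sum>j\<in>J. x j) (\<Sum>j\<in>J. x j) = (\<Sum>i\<in>J. \<Sum>j\<in>J. cinner (x i) (x j))"
    unfolding cinner_sum_left unfolding cinner_sum_right ..
  also have "\<dots> = (\<Sum>i\<in>J. \<Sum>j\<in>J. if j = i then cinner (x i) (x i) else 0)"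
    by (intro sum.cong refl) (auto simp: orth)
  also have "\<dots> = (\<Sum>i\<in>J. cinner (x i) (x i))"
    using assms(1) by simp
  also have "\<dots> = complex_of_real (\<Sum>i\<in>J. (norm (x i))\<^sup>2)"
    by (simp add: cinner_self)
  finally have "(\<Sum>i\<in>J. (norm (x i))\<^sup>2) = (norm (x j0))\<^sup>2"
    using norm by (simp only: cinner_self of_real_eq_iff)
  then have "(\<Sum>i\<in>J - {j0}. (norm (x i))\<^sup>2) = 0"
    using assms(1) j0 by (simp add: sum.remove)
  then have "(norm (x j))\<^sup>2 = 0"
    using assms(1) j by (subst (asm) sum_nonneg_eq_0_iff) auto
  then show ?thesis by simp
qed

context multiple_integral_L2
begin

lemma norm_I_sq:
  assumes "f \<in> sq_integrable n"
  shows "ennreal ((norm (I n f))\<^sup>2) = (\<integral>\<^sup>+t. ennreal ((cmod (f t))\<^sup>2) \<partial>HL n)"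
proof -
  have "complex_of_real ((norm (I n f))\<^sup>2) = (\<integral>t. complex_of_real ((cmod (f t))\<^sup>2) \<partial>HL n)"
    using I_isometry[OF assms assms] by (simp only: cinner_self complex_norm_square)
  then have "(norm (I n f))\<^sup>2 = (\<integral>t. (cmod (f t))\<^sup>2 \<partial>HL n)"
    by (simp only: integral_complex_of_real of_real_eq_iff)
  then show ?thesis
    using assms by (subst nn_integral_eq_integral) (auto simp: sq_integrable_def)
qed

lemma cinner_I_tensor:
  assumes "f \<in> sq_integrable n" "g \<in> sq_integrable m"
  shows "cinner (I (n + m) (contraction n m 0 f g)) (I (n + m) (contraction n m 0 f g))
    = cinner (I n f) (I n f) * cinner (I m g) (I m g)"
proof -
  have "ennreal ((norm (I (n + m) (contraction n m 0 f g)))\<^sup>2)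
      = ennreal ((norm (I n f))\<^sup>2 * (norm (I m g))\<^sup>2)"
    using nn_integral_tensor[OF assms] assms
    by (simp add: norm_I_sq tensor_sq_integrable ennreal_mult)
  then have "(norm (I (n + m) (contraction n m 0 f g)))\<^sup>2 = (norm (I n f))\<^sup>2 * (norm (I m g))\<^sup>2"
    by (subst (asm) ennreal_inj) auto
  then show ?thesis
    by (simp only: cinner_self of_real_mult)
qed

lemma I_star_symmetric:
  assumes "f \<in> sq_integrable n" "symmetric_kernel n f"
  shows "star (I n f) = I n f"
  unfolding I_star[OF assms(1)]
  by (intro I_cong sq_integrable_adj_kernel assms adj_kernel_symmetric)

text \<open>The tensor product alone already exhausts the norm that freeness allows for the product, so
  that Pythagoras leaves no room for the other terms of the product formula.\<close>

lemma free_imp_terms_0: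
  assumes alg: "unital_star_algebra A \<phi> \<iota> (integral_span I C)" and C: "kernel_space C"
    and unit_left: "\<And>a h. h \<in> C a \<Longrightarrow> has_product (L2_one \<iota>) (I a h) (I a h)"
    and unit_right: "\<And>a h. h \<in> C a \<Longrightarrow> has_product (I a h) (L2_one \<iota>) (I a h)"
    and f: "f \<in> C n" "symmetric_kernel n f" "n \<ge> 1"
    and g: "g \<in> C m" "symmetric_kernel m g"
    and J: "finite J" and ord: "inj_on ord J" and k: "\<And>j. j \<in> J \<Longrightarrow> k j \<in> sq_integrable (ord j)"
    and j0: "j0 \<in> J" "ord j0 = n + m" "k j0 = contraction n m 0 f g"
    and prod: "has_product (I n f) (I m g) (\<Sum>j\<in>J. I (ord j) (k j))"
    and free: "L2_free A \<phi> \<iota> [I n f, I m g]"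
    and j: "j \<in> J" "j \<noteq> j0"
  shows "AE t in HL (ord j). k j t = 0"
proof -
  let ?V = "integral_span I C"
  have sq: "f \<in> sq_integrable n" "g \<in> sq_integrable m"
    using f g kernel_spaceD(1)[OF C] by auto
  have left: "has_product (L2_one \<iota>) U U" if "U \<in> ?V" for U
    using that by (induction rule: integral_span_induct) (auto intro: unit_left is_L2_prod_add_right)
  have right: "has_product U (L2_one \<iota>) U" if "U \<in> ?V" for U
    using that by (induction rule: integral_span_induct) (auto intro: unit_right is_L2_prod_add_left)
  let ?XY = "\<Sum>j\<in>J. I (ord j) (k j)"
  have "cinner ?XY ?XY = cinner (I n f) (I n f) * cinner (I m g) (I m g)"
    using L2_free_norm_mult[OF alg left right integral_span_memI[OF C f(1)]
        I_star_symmetric[OF sq(1) f(2)] L2_state_I[OF sq(1)] integral_span_memI[OF C g(1)]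
        I_star_symmetric[OF sq(2) g(2)] free] f(3)
    by (simp add: L2_mult_eq[OF prod])
  also have "\<dots> = cinner (I (ord j0) (k j0)) (I (ord j0) (k j0))"
    using cinner_I_tensor[OF sq] j0 by simp
  finally have "I (ord j) (k j) = 0"
    using J ord k j0(1) j
    by (intro orthogonal_sum_eq_0[where x = "\<lambda>j. I (ord j) (k j)" and J = J and ?j0.0 = j0])
       (auto intro!: I_orthogonal dest: inj_onD)
  then show ?thesis
    using I_eq_0_iff[OF k[OF j(1)]] by simp
qed

lemma I_unit_kernel:
  assumes "h \<in> sq_integrable b"
  shows "I (0 + b) (contraction 0 b 0 (\<lambda>_. 1) h) = I b h"
    and "I (b + 0) (contraction b 0 0 h (\<lambda>_. 1)) = I b h"
proof -
  have "(\<lambda>_. 1) \<in> sq_integrable 0" by (rule const_sq_integrable_0)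
  then have "contraction 0 b 0 (\<lambda>_. 1) h \<in> sq_integrable b"
    "contraction b 0 0 h (\<lambda>_. 1) \<in> sq_integrable b"
    using tensor_sq_integrable[of "\<lambda>_. 1" 0 h b] tensor_sq_integrable[of h b "\<lambda>_. 1" 0] assms by auto
  then show "I (0 + b) (contraction 0 b 0 (\<lambda>_. 1) h) = I b h"
    "I (b + 0) (contraction b 0 0 h (\<lambda>_. 1)) = I b h"
    using assms by (auto intro!: I_cong AE_I2 simp: contraction_0 restrict_space_HL)
qed

end

section \<open>Free Poisson integrals\<close>

definition coord_in :: "real set \<Rightarrow> nat \<Rightarrow> nat \<Rightarrow> kernel \<Rightarrow> bool" where
  "coord_in B n i h \<longleftrightarrow> (AE t in HL n. h t \<noteq> 0 \<longrightarrow> t i \<in> B)"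

lemma coord_in_zero: "coord_in B n i (\<lambda>_. 0)"
  by (simp add: coord_in_def)

lemma coord_in_add: "coord_in B n i f \<Longrightarrow> coord_in B n i g \<Longrightarrow> coord_in B n i (\<lambda>t. f t + g t)"
  unfolding coord_in_def by (erule (1) AE_mp[OF _ AE_mp]) (rule AE_I2, auto)

lemma coord_in_scale: "coord_in B n i f \<Longrightarrow> coord_in B n i (\<lambda>t. c * f t)"
  unfolding coord_in_def by (erule AE_mp) (rule AE_I2, auto)

text \<open>A coordinate that the contraction takes over from \<open>h\<close> is still confined to \<open>B\<close>: elsewhere the
  integrand vanishes.\<close>

lemma coord_in_pairing_left:
  assumes h: "coord_in B a j h" and j: "j < a" "\<sigma> j < N"
    and inj: "inj_on \<sigma> {..<a}" and lt: "\<And>i. i < a \<Longrightarrow> \<sigma> i < N + p"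
  shows "coord_in B N (\<sigma> j) (pairing a \<sigma> b \<tau> N p h k)"
proof -
  have "AE t in HL N. AE s in HL p.
      h (pull a \<sigma> (glue N p t s)) \<noteq> 0 \<longrightarrow> pull a \<sigma> (glue N p t s) j \<in> B"
    by (rule AE_pull_glue[OF h[unfolded coord_in_def] inj]) (rule lt)
  then show ?thesis
    unfolding coord_in_def
  proof (rule AE_mp, intro AE_I2 impI)
    fix t
    assume ae: "AE s in HL p.
        h (pull a \<sigma> (glue N p t s)) \<noteq> 0 \<longrightarrow> pull a \<sigma> (glue N p t s) j \<in> B"
      and nz: "pairing a \<sigma> b \<tau> N p h k t \<noteq> 0"
    have eq: "pull a \<sigma> (glue N p t s) j = t (\<sigma> j)" for s
      using j by (simp add: pull_def glue_def)
    show "t (\<sigma> j) \<in> B"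
    proof (rule ccontr)
      assume "t (\<sigma> j) \<notin> B"
      then have "AE s in HL p. h (pull a \<sigma> (glue N p t s)) * k (pull b \<tau> (glue N p t s)) = 0"
        by (intro AE_mp[OF ae AE_I2]) (auto simp: eq)
      then have "pairing a \<sigma> b \<tau> N p h k t = 0"
        unfolding pairing_def by (rule integral_eq_zero_AE)
      then show False using nz by simp
    qed
  qed
qed

lemma pairing_commute: "pairing a \<sigma> b \<tau> N p h k = pairing b \<tau> a \<sigma> N p k h"
  by (simp add: pairing_def mult.commute)

text \<open>The shared coordinate would have to lie in both \<open>B\<close> and \<open>C\<close>.\<close>

lemma pairing_disjoint:
  assumes h: "coord_in B a j h" and k: "coord_in C b j' k" and BC: "B \<inter> C = {}"
    and j: "j < a" "j' < b" "\<sigma> j = \<tau> j'"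
    and \<sigma>: "inj_on \<sigma> {..<a}" "\<And>i. i < a \<Longrightarrow> \<sigma> i < N + p"
    and \<tau>: "inj_on \<tau> {..<b}" "\<And>i. i < b \<Longrightarrow> \<tau> i < N + p"
  shows "AE t in HL N. pairing a \<sigma> b \<tau> N p h k t = 0"
proof -
  have "AE t in HL N. AE s in HL p.
      h (pull a \<sigma> (glue N p t s)) \<noteq> 0 \<longrightarrow> pull a \<sigma> (glue N p t s) j \<in> B"
    by (rule AE_pull_glue[OF h[unfolded coord_in_def] \<sigma>(1)]) (rule \<sigma>(2))
  moreover have "AE t in HL N. AE s in HL p.
      k (pull b \<tau> (glue N p t s)) \<noteq> 0 \<longrightarrow> pull b \<tau> (glue N p t s) j' \<in> C"
    by (rule AE_pull_glue[OF k[unfolded coord_in_def] \<tau>(1)]) (rule \<tau>(2))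
  ultimately show ?thesis
  proof eventually_elim
    case (elim t)
    then have "AE s in HL p. h (pull a \<sigma> (glue N p t s)) * k (pull b \<tau> (glue N p t s)) = 0"
    proof eventually_elim
      case (elim s)
      have "pull a \<sigma> (glue N p t s) j = pull b \<tau> (glue N p t s) j'"
        using j by (simp add: pull_def)
      then show ?case using elim BC by auto
    qed
    then show ?case unfolding pairing_def by (rule integral_eq_zero_AE)
  qed
qed

lemma symmetric_coord_in:
  assumes sym: "symmetric_kernel n f" and i: "i < n" "j < n" and f: "coord_in B n j f"
  shows "coord_in B n i f"
proof -
  define \<sigma> where "\<sigma> = Transposition.transpose i j"
  have perm: "\<sigma> permutes {..<n}"
    unfolding \<sigma>_def using i by (intro permutes_swap_id) auto
  have "AE t in HL n. f (pull n \<sigma> t) \<noteq> 0 \<longrightarrow> pull n \<sigma> t j \<in> B"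
    using AE_pull_bij[OF f[unfolded coord_in_def] permutes_imp_bij[OF perm]] .
  moreover have "pull n \<sigma> t j = t i" for t
    using i by (simp add: pull_def \<sigma>_def)
  ultimately have "AE t in HL n. f (pull n \<sigma> t) \<noteq> 0 \<longrightarrow> t i \<in> B" by simp
  then show ?thesis
    using symmetric_kernelD[OF sym perm] unfolding coord_in_def by eventually_elim simp
qed

lemma nn_integral_glue_swap:
  assumes F: "F \<in> borel_measurable (HL (a + b))"
  shows "(\<integral>\<^sup>+z. F z \<partial>HL (a + b)) = (\<integral>\<^sup>+s. \<integral>\<^sup>+t. F (glue a b t s) \<partial>HL a \<partial>HL b)"
proof -
  have "(\<lambda>(t, s). F (glue a b t s)) \<in> borel_measurable (HL a \<Otimes>\<^sub>M HL b)"
    using measurable_compose[OF measurable_glue' F] by (simp add: split_beta')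
  then show ?thesis
    unfolding nn_integral_glue[OF F] by (rule HL2.Fubini'[symmetric])
qed

text \<open>\<open>B\<close> consists of the points at which the slice of \<open>f\<close> in its last variable does not vanish
  almost everywhere; \<open>g\<close> has to vanish whenever its first variable is such a point.\<close>

lemma separating_set:
  assumes f: "f \<in> borel_measurable (HL (n' + 1))" and g: "g \<in> borel_measurable (HL (1 + m'))"
    and ae: "AE z in HL (n' + 1 + m'). f (pull (n' + 1) id z) * g (pull (1 + m') (\<lambda>i. n' + i) z) = 0"
  shows "\<exists>B. coord_in B (n' + 1) n' f \<and> coord_in (- B) (1 + m') 0 g"
proof -
  define \<Phi> where "\<Phi> s = (\<integral>\<^sup>+y. ennreal (cmod (f (glue n' 1 y s))) \<partial>HL n')" for s
  define B where "B = {r. \<Phi> (\<lambda>i\<in>{..<1}. r) \<noteq> 0}"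
  have f_glue: "(\<lambda>y. f (glue n' 1 y s)) \<in> borel_measurable (HL n')" if "s \<in> space (HL 1)" for s
    by (rule measurable_compose[OF measurable_glue f]) (use that in measurable)
  have meas_\<Phi>: "\<Phi> \<in> borel_measurable (HL 1)"
  proof -
    have "(\<lambda>p. f (glue n' 1 (snd p) (fst p))) \<in> borel_measurable (HL 1 \<Otimes>\<^sub>M HL n')"
      by (rule measurable_compose[OF measurable_glue f]) measurable
    then have "(\<lambda>(s, y). ennreal (cmod (f (glue n' 1 y s)))) \<in> borel_measurable (HL 1 \<Otimes>\<^sub>M HL n')"
      by (simp add: split_beta')
    then show ?thesis
      unfolding \<Phi>_def by (rule HL.borel_measurable_nn_integral)
  qed
  have \<Phi>_0: "\<Phi> s = 0 \<longleftrightarrow> (AE y in HL n'. f (glue n' 1 y s) = 0)" if "s \<in> space (HL 1)" for s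
    unfolding \<Phi>_def using f_glue[OF that] by (subst nn_integral_0_iff_AE) auto
  have B_iff: "s 0 \<in> B \<longleftrightarrow> \<Phi> s \<noteq> 0" if "s \<in> space (HL 1)" for s
  proof -
    have "(\<lambda>i\<in>{..<1}. s 0) = s"
      using that by (auto simp: space_HL PiE_iff extensional_def)
    then show ?thesis by (simp add: B_def)
  qed
  have meas_coord: "(\<lambda>z. \<Phi> (\<lambda>i\<in>{..<1}. z j)) \<in> borel_measurable (HL a)" if "j < a" for j a
    by (rule measurable_compose[OF measurable_into_HL meas_\<Phi>])
      (use that in \<open>auto intro: measurable_HL_component\<close>)
  have "coord_in B (n' + 1) n' f"
  proof -
    define F where "F z = (if \<Phi> (\<lambda>i\<in>{..<1}. z n') = 0 then ennreal (cmod (f z)) else 0)" for z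
    have [measurable]: "(\<lambda>z. \<Phi> (\<lambda>i\<in>{..<1}. z n')) \<in> borel_measurable (HL (n' + 1))"
      by (rule meas_coord) simp
    note f [measurable]
    have F: "F \<in> borel_measurable (HL (n' + 1))"
      unfolding F_def by measurable
    \<comment> \<open>Fubini with the last variable outermost: where it is outside \<open>B\<close>, the inner integral is
      \<open>\<Phi> s = 0\<close>.\<close>
    have "(\<integral>\<^sup>+z. F z \<partial>HL (n' + 1)) = (\<integral>\<^sup>+s. \<integral>\<^sup>+y. F (glue n' 1 y s) \<partial>HL n' \<partial>HL 1)"
      by (rule nn_integral_glue_swap[OF F])
    also have "\<dots> = (\<integral>\<^sup>+s. 0 \<partial>HL 1)"
    proof (rule nn_integral_cong)
      fix s assume s: "s \<in> space (HL 1)"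
      have "glue n' 1 y s n' = s 0" for y by (simp add: glue_def)
      then have "F (glue n' 1 y s) = (if \<Phi> s = 0 then ennreal (cmod (f (glue n' 1 y s))) else 0)" for y
        using B_iff[OF s] by (simp add: F_def B_def)
      then show "(\<integral>\<^sup>+y. F (glue n' 1 y s) \<partial>HL n') = 0"
        by (cases "\<Phi> s = 0") (simp_all add: \<Phi>_def)
    qed
    also have "\<dots> = 0" by simp
    finally have "AE z in HL (n' + 1). F z = 0"
      by (simp only: nn_integral_0_iff_AE[OF F])
    then show ?thesis
      unfolding coord_in_def
      by (rule AE_mp) (auto intro!: AE_I2 simp: F_def B_def split: if_splits)
  qed
  moreover have "coord_in (- B) (1 + m') 0 g"
  proof -
    \<comment> \<open>\<open>\<sigma>\<close> moves the shared variable to the front.\<close>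
    define \<sigma> where "\<sigma> i = (if i < n' then 1 + i else if i = n' then 0 else i)" for i
    have "AE z in HL (1 + (n' + m')). f (pull (n' + 1) id (pull (n' + 1 + m') \<sigma> z))
        * g (pull (1 + m') (\<lambda>i. n' + i) (pull (n' + 1 + m') \<sigma> z)) = 0"
      by (rule AE_pull[OF ae]) (auto simp: \<sigma>_def inj_on_def split: if_splits)
    then have ae1: "AE s in HL 1. AE v in HL (n' + m'). f (pull (n' + 1) \<sigma> (glue 1 (n' + m') s v))
        * g (pull (1 + m') (\<lambda>i. \<sigma> (n' + i)) (glue 1 (n' + m') s v)) = 0"
      by (intro AE_glueD) (simp add: pull_pull comp_def)
    have ae2: "AE s in HL 1. AE y in HL n'. AE w in HL m'.
        f (glue n' 1 y s) * g (glue 1 m' s w) = 0"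
    proof (rule AE_mp[OF ae1], rule AE_I2, rule impI)
      fix s
      assume "AE v in HL (n' + m'). f (pull (n' + 1) \<sigma> (glue 1 (n' + m') s v))
        * g (pull (1 + m') (\<lambda>i. \<sigma> (n' + i)) (glue 1 (n' + m') s v)) = 0"
      from AE_glueD[OF this]
      have "AE y in HL n'. AE w in HL m'. f (pull (n' + 1) \<sigma> (glue 1 (n' + m') s (glue n' m' y w)))
        * g (pull (1 + m') (\<lambda>i. \<sigma> (n' + i)) (glue 1 (n' + m') s (glue n' m' y w))) = 0" .
      moreover have "pull (n' + 1) \<sigma> (glue 1 (n' + m') s (glue n' m' y w)) = glue n' 1 y s" for y w
        by (auto simp: pull_def glue_def \<sigma>_def fun_eq_iff)
      moreover have "pull (1 + m') (\<lambda>i. \<sigma> (n' + i)) (glue 1 (n' + m') s (glue n' m' y w))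
          = glue 1 m' s w" for y w
        by (auto simp: pull_def glue_def \<sigma>_def fun_eq_iff)
      ultimately show "AE y in HL n'. AE w in HL m'. f (glue n' 1 y s) * g (glue 1 m' s w) = 0"
        by simp
    qed
    have ae3: "AE s in HL 1. AE w in HL m'. g (glue 1 m' s w) \<noteq> 0 \<longrightarrow> s 0 \<in> - B"
    proof (rule AE_mp[OF ae2], rule AE_I2, rule impI)
      fix s assume s: "s \<in> space (HL 1)"
        and prod: "AE y in HL n'. AE w in HL m'. f (glue n' 1 y s) * g (glue 1 m' s w) = 0"
      show "AE w in HL m'. g (glue 1 m' s w) \<noteq> 0 \<longrightarrow> s 0 \<in> - B"
      proof (cases "AE w in HL m'. g (glue 1 m' s w) = 0")
        case True
        then show ?thesis by (rule AE_mp) simp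
      next
        case False
        have "AE y in HL n'. f (glue n' 1 y s) = 0"
        proof (rule AE_mp[OF prod], intro AE_I2 impI)
          fix y assume y: "AE w in HL m'. f (glue n' 1 y s) * g (glue 1 m' s w) = 0"
          show "f (glue n' 1 y s) = 0"
          proof (rule ccontr)
            assume "f (glue n' 1 y s) \<noteq> 0"
            then have "AE w in HL m'. g (glue 1 m' s w) = 0" using y by simp
            then show False using False by simp
          qed
        qed
        then show ?thesis using \<Phi>_0[OF s] B_iff[OF s] by simp
      qed
    qed
    have "{z \<in> space (HL (1 + m')). g z \<noteq> 0 \<longrightarrow> z 0 \<in> - B} \<in> sets (HL (1 + m'))"
    proof -
      have [measurable]: "(\<lambda>z. \<Phi> (\<lambda>i\<in>{..<1}. z 0)) \<in> borel_measurable (HL (1 + m'))"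
        by (rule meas_coord) simp
      note g [measurable]
      have "{z \<in> space (HL (1 + m')). g z \<noteq> 0 \<longrightarrow> \<Phi> (\<lambda>i\<in>{..<1}. z 0) = 0} \<in> sets (HL (1 + m'))"
        by measurable
      then show ?thesis by (simp add: B_def)
    qed
    moreover have "glue 1 m' s w 0 = s 0" for s w by (simp add: glue_def)
    ultimately show ?thesis
      unfolding coord_in_def using ae3 by (intro AE_glueI) auto
  qed
  ultimately show ?thesis by blast
qed

text \<open>The contraction \<open>f \<star>\<^sub>n\<^sup>n\<^sup>-\<^sup>1 f\<close> has order \<open>1\<close>, and its tensor powers reach every positive order.\<close>

lemma stable_kernels_nonempty:
  assumes K: "stable_kernels K" and f: "f \<in> K n" "n \<ge> 1"
  shows "K j \<noteq> {}"
proof -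
  have star: "star_contraction n n n f f \<in> K (n + n - 2 * n + 1)"
    using K f unfolding stable_kernels_def by (metis atLeastAtMost_iff min.idem order_refl)
  then obtain h where h: "h \<in> K 1" by auto
  show ?thesis
  proof (induction j)
    case 0
    then show ?case using K unfolding stable_kernels_def by blast
  next
    case (Suc j)
    then obtain k where "k \<in> K j" by blast
    then have "contraction j 1 0 k h \<in> K (j + 1 - 2 * 0)"
      using K h unfolding stable_kernels_def by (metis le0)
    then show ?case by auto
  qed
qed

lemma stable_kernels_space:
  assumes K: "stable_kernels K" and f: "f \<in> K n" "n \<ge> 1"
  shows "kernel_space K"
proof -
  have "(\<lambda>_. 0) \<in> K j" for j
  proof -
    obtain k where "k \<in> K j" using stable_kernels_nonempty[OF assms] by blast
    then have "(\<lambda>t. 0 * k t) \<in> K j" using K unfolding stable_kernels_def by blast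
    then show ?thesis by simp
  qed
  then show ?thesis
    using K unfolding stable_kernels_def kernel_space_def by blast
qed

context multiple_integral_L2
begin

context
  fixes K :: "nat \<Rightarrow> kernel set"
  assumes poisson: "free_poisson_algebra A \<phi> \<iota> I K"
begin

lemma K_stable: "stable_kernels K"
  and K_algebra: "unital_star_algebra A \<phi> \<iota> (integral_span I K)"
  and poisson_prod: "f \<in> K n \<Longrightarrow> g \<in> K m \<Longrightarrow> has_product (I n f) (I m g)
      ((\<Sum>p\<le>min n m. I (n + m - 2 * p) (contraction n m p f g)) +
       (\<Sum>p=1..min n m. I (n + m - 2 * p + 1) (star_contraction n m p f g)))"
  using poisson by (auto simp: free_poisson_algebra_def)

lemma K_sq: "f \<in> K n \<Longrightarrow> f \<in> sq_integrable n"
  and K_const: "(\<lambda>_. c) \<in> K 0"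
  using K_stable unfolding stable_kernels_def by blast+

lemma K_contraction: "f \<in> K n \<Longrightarrow> g \<in> K m \<Longrightarrow> p \<le> min n m \<Longrightarrow>
    contraction n m p f g \<in> K (n + m - 2 * p)"
  and K_star: "f \<in> K n \<Longrightarrow> g \<in> K m \<Longrightarrow> p \<in> {1..min n m} \<Longrightarrow>
    star_contraction n m p f g \<in> K (n + m - 2 * p + 1)"
  using K_stable unfolding stable_kernels_def by blast+

lemma poisson_units:
  assumes "h \<in> K a"
  shows "has_product (L2_one \<iota>) (I a h) (I a h)"
    and "has_product (I a h) (L2_one \<iota>) (I a h)"
  using poisson_prod[OF K_const assms, of 1] poisson_prod[OF assms K_const, of 1]
    I_unit_kernel[OF K_sq[OF assms]]
  by (simp_all add: I_one)

lemma poisson_free_imp: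
  assumes f: "f \<in> K n" "symmetric_kernel n f" "n \<ge> 1"
    and g: "g \<in> K m" "symmetric_kernel m g" "m \<ge> 1"
    and free: "L2_free A \<phi> \<iota> [I n f, I m g]"
  shows "AE t in HL (n + m - 1). star_contraction n m 1 f g t = 0"
proof -
  \<comment> \<open>The orders in the two sums of the product formula differ in parity, hence they are distinct.\<close>
  define J :: "(nat + nat) set" where "J = {..min n m} <+> {1..min n m}"
  define ord where "ord = case_sum (\<lambda>p. n + m - 2 * p) (\<lambda>p. n + m - 2 * p + 1)"
  define k where "k = case_sum (\<lambda>p. contraction n m p f g) (\<lambda>p. star_contraction n m p f g)"
  have "(\<Sum>j\<in>J. I (ord j) (k j)) = (\<Sum>p\<le>min n m. I (n + m - 2 * p) (contraction n m p f g)) +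
       (\<Sum>p=1..min n m. I (n + m - 2 * p + 1) (star_contraction n m p f g))"
    unfolding J_def by (subst sum.Plus) (simp_all add: ord_def k_def)
  then have prod: "has_product (I n f) (I m g) (\<Sum>j\<in>J. I (ord j) (k j))"
    using poisson_prod[OF f(1) g(1)] by simp
  have par: "n + m - 2 * p \<noteq> Suc (n + m - 2 * q)" "Suc (n + m - 2 * q) \<noteq> n + m - 2 * p"
    if "p \<le> n" "p \<le> m" "q \<le> n" "q \<le> m" for p q
  proof -
    have "2 * p \<le> n + m" "2 * q \<le> n + m" using that by auto
    then show "n + m - 2 * p \<noteq> Suc (n + m - 2 * q)" "Suc (n + m - 2 * q) \<noteq> n + m - 2 * p"
      by presburger+
  qed
  have "AE t in HL (ord (Inr 1)). k (Inr 1) t = 0"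
  proof (rule free_imp_terms_0[OF K_algebra stable_kernels_space[OF K_stable f(1,3)] poisson_units
        f g(1,2) _ _ _ _ _ _ prod free, where ?j0.0 = "Inl 0"])
    show "finite J" by (simp add: J_def)
    show "inj_on ord J"
    proof (rule inj_onI)
      fix i j assume "i \<in> J" "j \<in> J" "ord i = ord j"
      then show "i = j"
        using par by (cases i; cases j) (auto simp: J_def ord_def)
    qed
    show "k j \<in> sq_integrable (ord j)" if "j \<in> J" for j
      using that K_sq K_contraction[OF f(1) g(1)] K_star[OF f(1) g(1)]
      by (auto simp: J_def k_def ord_def)
  qed (use f g in \<open>auto simp: J_def ord_def k_def\<close>)
  moreover have "ord (Inr 1) = n + m - 1"
    using f(3) g(3) by (simp add: ord_def)
  ultimately show ?thesis by (simp only: k_def sum.case)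
qed

lemma poisson_imp_free:
  assumes f: "f \<in> K n" "symmetric_kernel n f" "n \<ge> 1"
    and g: "g \<in> K m" "symmetric_kernel m g" "m \<ge> 1"
    and ae: "AE t in HL (n + m - 1). star_contraction n m 1 f g t = 0"
  shows "L2_free A \<phi> \<iota> [I n f, I m g]"
proof -
  obtain n' m' where n': "n = n' + 1" and m': "m = 1 + m'"
    using f(3) g(3) by (metis add.commute le_Suc_ex)
  have K: "kernel_space K"
    by (rule stable_kernels_space[OF K_stable f(1,3)])
  note K_add = kernel_spaceD(3)[OF K] and K_scale = kernel_spaceD(4)[OF K]
    and K_zero = kernel_spaceD(2)[OF K]
  have "\<exists>B. coord_in B (n' + 1) n' f \<and> coord_in (- B) (1 + m') 0 g"
  proof (rule separating_set)
    show "f \<in> borel_measurable (HL (n' + 1))" "g \<in> borel_measurable (HL (1 + m'))"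
      using K_sq[OF f(1)] K_sq[OF g(1)] n' m' by (simp_all add: sq_integrable_iff)
    have nm: "n + m - 1 = n' + 1 + m'" using n' m' by simp
    have "star_contraction n m 1 f g z
        = f (pull (n' + 1) id z) * g (pull (1 + m') (\<lambda>i. n' + i) z)" for z
      unfolding star_contraction_1[OF f(3)] unfolding pull_def n' m' by simp
    then show "AE z in HL (n' + 1 + m'). f (pull (n' + 1) id z) * g (pull (1 + m') (\<lambda>i. n' + i) z) = 0"
      using ae unfolding nm by (simp only:)
  qed
  then obtain B where B: "coord_in B n n' f" "coord_in (- B) m 0 g"
    using n' m' by auto
  define D where "D i = (if i = 0 then B else - B)" for i :: nat
  have disj: "D i \<inter> D j = {}" if "i < 2" "j < 2" "i \<noteq> j" for i j
    using that by (auto simp: D_def)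
  define F where "F i a = {h \<in> K a. \<forall>j<a. coord_in (D i) a j h}" for i a
  define L where "L i a = {h \<in> K a. coord_in (D i) a 0 h}" for i a
  have F_space: "kernel_space (F i)" and L_space: "kernel_space (L i)" for i
    unfolding kernel_space_def F_def L_def
    using K_sq K_zero K_add K_scale coord_in_zero coord_in_add coord_in_scale by auto
  have contraction_F: "contraction a b p h k \<in> F i (a + b - 2 * p)"
    if h: "h \<in> F i a" and k: "k \<in> F i b" and p: "p \<le> min a b" for i a b p h k
  proof -
    have "coord_in (D i) (a + b - 2 * p) j (contraction a b p h k)" if "j < a + b - 2 * p" for j
    proof (cases "j < a - p")
      case True
      then have "contr_left a b p j = j" by (simp add: contr_left_def)
      then show ?thesis
        using coord_in_pairing_left[where j = j and \<sigma> = "contr_left a b p",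
            OF _ _ _ inj_contr_left[OF p] contr_left_lt[OF p]] h True that
        by (simp add: contraction_eq_pairing[OF p] F_def)
    next
      case False
      then have "contr_right a b p (j - (a - p) + p) = j" "j - (a - p) + p < b"
        using that p by (auto simp: contr_right_def)
      then show ?thesis
        using coord_in_pairing_left[where j = "j - (a - p) + p" and \<sigma> = "contr_right a b p",
            OF _ _ _ inj_contr_right[OF p] contr_right_lt[OF p]] k that
        by (simp add: contraction_eq_pairing[OF p] F_def pairing_commute[of a])
    qed
    then show ?thesis
      using h k K_contraction p by (simp add: F_def)
  qed
  have star_F: "star_contraction a b p h k \<in> F i (a + b - 2 * p + 1)"
    if h: "h \<in> F i a" and k: "k \<in> F i b" and p: "p \<in> {1..min a b}" for i a b p h k
  proof -
    have "coord_in (D i) (a + b - 2 * p + 1) j (star_contraction a b p h k)"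
      if "j < a + b - 2 * p + 1" for j
    proof (cases "j < a - p + 1")
      case True
      then have "star_left a b p j = j" "j < a" using p by (auto simp: star_left_def)
      then show ?thesis
        using coord_in_pairing_left[where j = j and \<sigma> = "star_left a b p",
            OF _ _ _ inj_star_left[OF p] star_left_lt[OF p]] h that
        by (simp add: star_contraction_eq_pairing[OF p] F_def)
    next
      case False
      then have "star_right a b p (j - (a - p) + (p - 1)) = j" "j - (a - p) + (p - 1) < b"
        using that p by (auto simp: star_right_def)
      then show ?thesis
        using coord_in_pairing_left[where j = "j - (a - p) + (p - 1)" and \<sigma> = "star_right a b p",
            OF _ _ _ inj_star_right[OF p] star_right_lt[OF p]] k that
        by (simp add: star_contraction_eq_pairing[OF p] F_def pairing_commute[of a])
    qed
    then show ?thesis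
      using h k K_star[OF _ _ p] by (simp add: F_def)
  qed
  show ?thesis
  proof (rule L2_free_kernel_classes[where F = F and L = L])
    fix i a assume "0 < (a::nat)"
    then show "F i a \<subseteq> L i a" by (auto simp: F_def L_def)
  next
    fix i c show "(\<lambda>_. c) \<in> F i 0" by (simp add: F_def K_const)
  next
    fix i a h assume "h \<in> L i a"
    then show "has_product (L2_one \<iota>) (I a h) (I a h)"
      by (intro poisson_units) (simp add: L_def)
  next
    fix i a h assume "h \<in> F i a"
    then show "has_product (I a h) (L2_one \<iota>) (I a h)"
      by (intro poisson_units) (simp add: F_def)
  next
    fix i a b h k assume hk: "h \<in> F i a" "k \<in> F i b"
    show "\<exists>Z\<in>integral_span I (F i). has_product (I a h) (I b k) Z"
    proof (intro bexI)
      show "has_product (I a h) (I b k)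
        ((\<Sum>p\<le>min a b. I (a + b - 2 * p) (contraction a b p h k)) +
         (\<Sum>p=1..min a b. I (a + b - 2 * p + 1) (star_contraction a b p h k)))"
        using hk by (intro poisson_prod) (simp_all add: F_def)
      show "(\<Sum>p\<le>min a b. I (a + b - 2 * p) (contraction a b p h k)) +
         (\<Sum>p=1..min a b. I (a + b - 2 * p + 1) (star_contraction a b p h k)) \<in> integral_span I (F i)"
        using contraction_F[OF hk] star_F[OF hk]
        by (intro integral_span_add[OF F_space] integral_span_sum[OF F_space]
            integral_span_memI[OF F_space]) auto
    qed
  next
    fix i j a b h k
    assume "i < length [I n f, I m g]" "j < length [I n f, I m g]" and ij: "i \<noteq> j"
      and ab: "0 < (a::nat)" "0 < (b::nat)" and h: "h \<in> F i a" and k: "k \<in> L j b"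
    then have ij2: "i < 2" "j < 2" by auto
    have hK: "h \<in> K a" "k \<in> K b" using h k by (auto simp: F_def L_def)
    have last: "coord_in (D i) a (a - 1) h" and first: "coord_in (D j) b 0 k"
      using h k ab by (auto simp: F_def L_def)
    have "I (a + b - 2 * p) (contraction a b p h k) = 0" if p: "p \<in> {1..min a b}" for p
    proof -
      have p': "p \<le> min a b" using p by simp
      have "AE t in HL (a + b - 2 * p). contraction a b p h k t = 0"
        unfolding contraction_eq_pairing[OF p']
        using ab p by (intro pairing_disjoint[OF last first disj[OF ij2 ij]] inj_contr_left[OF p']
            inj_contr_right[OF p'] contr_left_lt[OF p'] contr_right_lt[OF p'])
          (auto simp: contr_left_def contr_right_def)
      then show ?thesis
        using I_eq_0_iff[OF K_sq[OF K_contraction[OF hK p']]] by simp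
    qed
    moreover have "I (a + b - 2 * p + 1) (star_contraction a b p h k) = 0"
      if p: "p \<in> {1..min a b}" for p
    proof -
      have "AE t in HL (a + b - 2 * p + 1). star_contraction a b p h k t = 0"
        unfolding star_contraction_eq_pairing[OF p]
        using ab p by (intro pairing_disjoint[OF last first disj[OF ij2 ij]] inj_star_left[OF p]
            inj_star_right[OF p] star_left_lt[OF p] star_right_lt[OF p])
          (auto simp: star_left_def star_right_def)
      then show ?thesis
        using I_eq_0_iff[OF K_sq[OF K_star[OF hK p]]] by simp
    qed
    moreover have "{..min a b} = insert 0 {1..min a b}" by auto
    ultimately have "has_product (I a h) (I b k) (I (a + b) (contraction a b 0 h k))"
      using poisson_prod[OF hK] by simp
    moreover have "contraction a b 0 h k \<in> positive_order (L i) (a + b)"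
    proof -
      have p0: "0 \<le> min a b" by simp
      have "coord_in (D i) (a + b - 2 * 0) (contr_left a b 0 0) (contraction a b 0 h k)"
        unfolding contraction_eq_pairing[OF p0]
        using h ab by (intro coord_in_pairing_left inj_contr_left[OF p0] contr_left_lt[OF p0])
          (auto simp: F_def contr_left_def)
      then have "coord_in (D i) (a + b) 0 (contraction a b 0 h k)"
        using ab by (simp add: contr_left_def)
      then show ?thesis
        using K_contraction[OF hK, of 0] ab by (simp add: positive_order_def L_def)
    qed
    ultimately show "\<exists>Z\<in>integral_span I (positive_order (L i)). has_product (I a h) (I b k) Z"
      using integral_span_memI[OF kernel_space_positive_order[OF L_space]] by blast
  next
    fix i assume "i < length [I n f, I m g]"
    then consider "i = 0" | "i = 1" by force
    then show "\<exists>a. \<exists>h\<in>F i a. [I n f, I m g] ! i = I a h"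
    proof cases
      case 1
      have "f \<in> F 0 n"
        using f(1) symmetric_coord_in[OF f(2) _ _ B(1)] n' by (simp add: F_def D_def)
      then show ?thesis using 1 by auto
    next
      case 2
      have "g \<in> F 1 m"
        using g(1) symmetric_coord_in[OF g(2) _ _ B(2)] m' by (simp add: F_def D_def)
      then show ?thesis using 2 by auto
    qed
  qed (use F_space L_space in auto)
qed

end

end

section \<open>Separability of \<open>L\<^sup>2(\<real>\<^sub>+)\<close>\<close>

text \<open>On measurable functions, the square of the norm of \<open>L\<^sup>2(M)\<close>, with value \<open>\<infinity>\<close> outside this
  space.\<close>

definition energy :: "'a measure \<Rightarrow> ('a \<Rightarrow> 'b::real_normed_vector) \<Rightarrow> ennreal" where
  "energy M v = (\<integral>\<^sup>+x. ennreal ((norm (v x))\<^sup>2) \<partial>M)"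

definition L2 :: "'a measure \<Rightarrow> ('a \<Rightarrow> complex) set" where
  "L2 M = {v \<in> borel_measurable M. energy M v < \<infinity>}"

lemma energy_add_le:
  fixes u v :: "'a \<Rightarrow> 'b::{real_normed_vector, second_countable_topology}"
  assumes [measurable]: "u \<in> borel_measurable M" "v \<in> borel_measurable M"
  shows "energy M (\<lambda>x. u x + v x) \<le> 2 * energy M u + 2 * energy M v"
proof -
  have "energy M (\<lambda>x. u x + v x)
      \<le> (\<integral>\<^sup>+x. 2 * ennreal ((norm (u x))\<^sup>2) + 2 * ennreal ((norm (v x))\<^sup>2) \<partial>M)"
    unfolding energy_def
  proof (rule nn_integral_mono)
    fix x
    have "ennreal ((norm (u x + v x))\<^sup>2) \<le> ennreal (2 * (norm (u x))\<^sup>2 + 2 * (norm (v x))\<^sup>2)"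
      by (rule ennreal_leI[OF norm_add_sq_le])
    then show "ennreal ((norm (u x + v x))\<^sup>2)
        \<le> 2 * ennreal ((norm (u x))\<^sup>2) + 2 * ennreal ((norm (v x))\<^sup>2)"
      by (simp add: ennreal_plus ennreal_mult ennreal_numeral[symmetric] del: ennreal_numeral)
  qed
  also have "\<dots> = 2 * energy M u + 2 * energy M v"
    unfolding energy_def by (subst nn_integral_add) (auto simp: nn_integral_cmult)
  finally show ?thesis .
qed

lemma energy_cong: "(\<And>x. x \<in> space M \<Longrightarrow> u x = v x) \<Longrightarrow> energy M u = energy M v"
  unfolding energy_def by (intro nn_integral_cong) auto

lemma ennreal_quarters_less:
  assumes "a < ennreal (e / 4)" "b < ennreal (e / 4)"
  shows "2 * a + 2 * b < ennreal e"
proof -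
  have "a < top" "b < top" using assms by (auto intro: less_trans)
  then obtain x y where xy: "a = ennreal x" "x \<ge> 0" "b = ennreal y" "y \<ge> 0"
    by (cases a; cases b) auto
  then have "x < e / 4" "y < e / 4" using assms by (auto simp: ennreal_less_iff)
  then have "ennreal (2 * x + 2 * y) < ennreal e"
    using xy by (intro ennreal_lessI) auto
  then show ?thesis
    using xy by (simp add: ennreal_plus ennreal_mult)
qed

lemma energy_triangle:
  fixes u v w :: "'a \<Rightarrow> 'b::{real_normed_vector, second_countable_topology}"
  assumes "u \<in> borel_measurable M" "v \<in> borel_measurable M" "w \<in> borel_measurable M"
    and "energy M (\<lambda>x. u x - w x) < ennreal (e / 4)" "energy M (\<lambda>x. w x - v x) < ennreal (e / 4)"
  shows "energy M (\<lambda>x. u x - v x) < ennreal e"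
proof -
  have "energy M (\<lambda>x. (u x - w x) + (w x - v x))
      \<le> 2 * energy M (\<lambda>x. u x - w x) + 2 * energy M (\<lambda>x. w x - v x)"
    using assms(1-3) by (intro energy_add_le) auto
  also have "\<dots> < ennreal e" by (rule ennreal_quarters_less[OF assms(4,5)])
  finally show ?thesis by simp
qed

text \<open>Step functions with rational values and jumps. They are parametrized by a countable type, and the
  half-lines \<open>{..a}\<close> have finite length in \<open>\<real>\<^sub>+\<close>.\<close>

definition step :: "(rat \<times> rat) list \<Rightarrow> real \<Rightarrow> real" where
  "step l x = (\<Sum>(p, a)\<leftarrow>l. of_rat p * indicator {..of_rat a} x)"

definition step_limit :: "(real \<Rightarrow> real) \<Rightarrow> bool" where
  "step_limit u \<longleftrightarrow> u \<in> borel_measurable half_line \<and>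
     (\<forall>e>0. \<exists>l. energy half_line (\<lambda>x. u x - step l x) < ennreal e)"

lemma measurable_step [measurable]: "step l \<in> borel_measurable half_line"
proof -
  have "step l \<in> borel_measurable borel"
    unfolding step_def by (induction l) (auto simp: split_beta')
  then show ?thesis by (intro measurable_restrict_space1) simp
qed

lemma step_append: "step (k @ l) x = step k x + step l x"
  by (simp add: step_def)

lemma step_scale: "step (map (\<lambda>(p, a). (r * p, a)) l) x = of_rat r * step l x"
  by (induction l) (auto simp: step_def of_rat_mult algebra_simps)

lemma step_limit_add:
  assumes "step_limit u" "step_limit v"
  shows "step_limit (\<lambda>x. u x + v x)"
  unfolding step_limit_def
proof (intro conjI allI impI)
  note [measurable] = assms[unfolded step_limit_def, THEN conjunct1]
  show "(\<lambda>x. u x + v x) \<in> borel_measurable half_line" by measurable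
  fix e :: real assume "e > 0"
  then have "e / 4 > 0" by simp
  then obtain k l where kl: "energy half_line (\<lambda>x. u x - step k x) < ennreal (e / 4)"
    "energy half_line (\<lambda>x. v x - step l x) < ennreal (e / 4)"
    using assms unfolding step_limit_def by metis
  have "energy half_line (\<lambda>x. (u x - step k x) + (v x - step l x))
      \<le> 2 * energy half_line (\<lambda>x. u x - step k x) + 2 * energy half_line (\<lambda>x. v x - step l x)"
    by (rule energy_add_le) measurable
  also have "\<dots> < ennreal e" by (rule ennreal_quarters_less[OF kl])
  finally show "\<exists>l. energy half_line (\<lambda>x. u x + v x - step l x) < ennreal e"
    by (intro exI[of _ "k @ l"]) (simp add: step_append algebra_simps)
qed

lemma step_limit_cong:
  assumes "\<And>x. x \<in> space half_line \<Longrightarrow> u x = v x"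
  shows "step_limit u \<longleftrightarrow> step_limit v"
proof -
  have "energy half_line (\<lambda>x. u x - step l x) = energy half_line (\<lambda>x. v x - step l x)" for l
    by (rule energy_cong) (simp only: assms)
  moreover have "u \<in> borel_measurable half_line \<longleftrightarrow> v \<in> borel_measurable half_line"
    by (rule measurable_cong) (rule assms)
  ultimately show ?thesis unfolding step_limit_def by (simp only:)
qed

text \<open>This closure property is what turns pointwise approximation into approximation in \<open>L\<^sup>2\<close>.\<close>

lemma step_limit_dominated:
  assumes w: "\<And>i. step_limit (w i)" and u [measurable]: "u \<in> borel_measurable half_line"
    and lim: "\<And>x. x \<in> space half_line \<Longrightarrow> (\<lambda>i. w i x) \<longlonglongrightarrow> u x"
    and b [measurable]: "b \<in> borel_measurable half_line" and fin: "energy half_line b < \<infinity>"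
    and dom: "\<And>i x. x \<in> space half_line \<Longrightarrow> \<bar>u x - w i x\<bar> \<le> \<bar>b x\<bar>"
  shows "step_limit u"
  unfolding step_limit_def
proof (intro conjI allI impI)
  fix e :: real assume "e > 0"
  have [measurable]: "w i \<in> borel_measurable half_line" for i
    using w by (simp add: step_limit_def)
  have "(\<lambda>i. energy half_line (\<lambda>x. u x - w i x)) \<longlonglongrightarrow> (\<integral>\<^sup>+x. 0 \<partial>half_line)"
    unfolding energy_def
  proof (rule nn_integral_dominated_convergence)
    show "AE x in half_line. ennreal ((norm (u x - w i x))\<^sup>2) \<le> ennreal ((norm (b x))\<^sup>2)" for i
      using dom by (intro AE_I2 ennreal_leI power_mono) auto
    show "(\<integral>\<^sup>+x. ennreal ((norm (b x))\<^sup>2) \<partial>half_line) < \<infinity>"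
      using fin by (simp add: energy_def)
    show "AE x in half_line. (\<lambda>i. ennreal ((norm (u x - w i x))\<^sup>2)) \<longlonglongrightarrow> 0"
    proof (rule AE_I2)
      fix x assume "x \<in> space half_line"
      then have "(\<lambda>i. (norm (u x - w i x))\<^sup>2) \<longlonglongrightarrow> (norm (u x - u x))\<^sup>2"
        by (intro tendsto_intros lim)
      then have "(\<lambda>i. ennreal ((norm (u x - w i x))\<^sup>2)) \<longlonglongrightarrow> ennreal 0"
        by (intro tendsto_ennrealI) simp
      then show "(\<lambda>i. ennreal ((norm (u x - w i x))\<^sup>2)) \<longlonglongrightarrow> 0" by simp
    qed
  qed measurable
  then have "eventually (\<lambda>i. energy half_line (\<lambda>x. u x - w i x) < ennreal (e / 4)) sequentially"
    using \<open>e > 0\<close> by (intro order_tendstoD(2)) auto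
  then obtain i where i: "energy half_line (\<lambda>x. u x - w i x) < ennreal (e / 4)"
    by (auto simp: eventually_sequentially)
  obtain l where l: "energy half_line (\<lambda>x. w i x - step l x) < ennreal (e / 4)"
    using w[of i] \<open>e > 0\<close> unfolding step_limit_def by (meson divide_pos_pos zero_less_numeral)
  have "energy half_line (\<lambda>x. u x - step l x) < ennreal e"
    by (rule energy_triangle[OF _ _ _ i l]) measurable
  then show "\<exists>l. energy half_line (\<lambda>x. u x - step l x) < ennreal e" ..
qed (rule u)

lemma step_limit_step: "step_limit (step l)"
  unfolding step_limit_def by (auto simp: energy_def intro!: exI[of _ l])

lemma step_limit_scale_rat:
  assumes "step_limit u"
  shows "step_limit (\<lambda>x. of_rat r * u x)"
  unfolding step_limit_def
proof (intro conjI allI impI)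
  note u [measurable] = assms[unfolded step_limit_def, THEN conjunct1]
  show "(\<lambda>x. of_rat r * u x) \<in> borel_measurable half_line" by measurable
  fix e :: real assume "e > 0"
  define c where "c = 1 + (of_rat r :: real)\<^sup>2"
  have c: "c > 0" by (simp add: c_def add_pos_nonneg)
  then obtain l where l: "energy half_line (\<lambda>x. u x - step l x) < ennreal (e / c)"
    using assms \<open>e > 0\<close> unfolding step_limit_def by (meson divide_pos_pos)
  have "energy half_line (\<lambda>x. of_rat r * u x - step (map (\<lambda>(p, a). (r * p, a)) l) x)
      = (\<integral>\<^sup>+x. ennreal ((of_rat r)\<^sup>2) * ennreal ((norm (u x - step l x))\<^sup>2) \<partial>half_line)"
    unfolding energy_def by (intro nn_integral_cong)
      (simp add: step_scale right_diff_distrib[symmetric] power_mult_distrib ennreal_mult[symmetric])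
  also have "\<dots> = ennreal ((of_rat r)\<^sup>2) * energy half_line (\<lambda>x. u x - step l x)"
    unfolding energy_def by (rule nn_integral_cmult) measurable
  also have "\<dots> \<le> ennreal c * energy half_line (\<lambda>x. u x - step l x)"
    by (intro mult_right_mono ennreal_leI) (auto simp: c_def)
  also have "\<dots> < ennreal c * ennreal (e / c)"
    using l c by (intro ennreal_mult_strict_left_mono) auto
  also have "\<dots> = ennreal e"
    using c \<open>e > 0\<close> by (subst ennreal_mult[symmetric]) auto
  finally show "\<exists>l. energy half_line (\<lambda>x. of_rat r * u x - step l x) < ennreal e" by blast
qed

text \<open>Real factors are limits of rational ones.\<close>

lemma step_limit_scale:
  assumes u: "step_limit u" and fin: "energy half_line u < \<infinity>"
  shows "step_limit (\<lambda>x. c * u x)"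
proof -
  have "\<exists>r :: rat. c < of_rat r \<and> of_rat r < c + 1 / real (Suc i)" for i
    by (rule of_rat_dense) simp
  then obtain r :: "nat \<Rightarrow> rat" where r: "\<And>i. c < of_rat (r i)" "\<And>i. of_rat (r i) < c + 1 / real (Suc i)"
    by metis
  have upper: "(\<lambda>i. c + 1 / real (Suc i)) \<longlonglongrightarrow> c"
    using tendsto_add[OF tendsto_const[of c] LIMSEQ_inverse_real_of_nat]
    by (simp add: inverse_eq_divide)
  have lim: "(\<lambda>i. of_rat (r i) :: real) \<longlonglongrightarrow> c"
  proof (rule tendsto_sandwich)
    show "(\<lambda>i. c) \<longlonglongrightarrow> c" by (rule tendsto_const)
    show "(\<lambda>i. c + 1 / real (Suc i)) \<longlonglongrightarrow> c" by (rule upper)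
  qed (intro always_eventually allI less_imp_le r)+
  note [measurable] = u[unfolded step_limit_def, THEN conjunct1]
  show ?thesis
  proof (rule step_limit_dominated)
    show "step_limit (\<lambda>x. of_rat (r i) * u x)" for i by (rule step_limit_scale_rat[OF u])
    show "(\<lambda>i. of_rat (r i) * u x) \<longlonglongrightarrow> c * u x" for x by (intro tendsto_intros lim)
    show "\<bar>c * u x - of_rat (r i) * u x\<bar> \<le> \<bar>u x\<bar>" for i x
    proof -
      have "1 / real (Suc i) \<le> 1" by simp
      then have "\<bar>c - of_rat (r i)\<bar> \<le> 1" using r[of i] by linarith
      then have "\<bar>c - of_rat (r i)\<bar> * \<bar>u x\<bar> \<le> 1 * \<bar>u x\<bar>" by (rule mult_right_mono) simp
      then show ?thesis by (simp add: abs_mult[symmetric] left_diff_distrib)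
    qed
  qed (use fin in measurable)
qed

lemma energy_indicator_bounded: "energy half_line (indicator (A \<inter> {0..real k}) :: real \<Rightarrow> real) < \<infinity>"
proof -
  have "energy half_line (indicator (A \<inter> {0..real k}) :: real \<Rightarrow> real)
      \<le> (\<integral>\<^sup>+x. indicator {0..real k} x \<partial>half_line)"
    unfolding energy_def by (intro nn_integral_mono) (auto simp: indicator_def)
  also have "\<dots> = (\<integral>\<^sup>+x. indicator {0..real k} x \<partial>lborel)"
    by (subst nn_integral_restrict_space) (simp, rule nn_integral_cong, simp split: split_indicator)
  also have "\<dots> < \<infinity>" by (simp add: emeasure_lborel_Icc_eq)
  finally show ?thesis .
qed

text \<open>The sets whose indicator functions on \<open>[0,k]\<close> are limits of step functions form a Dynkin system
  containing the half-lines.\<close>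

lemma step_limit_indicator_bounded:
  assumes "A \<in> sets borel"
  shows "step_limit (indicator (A \<inter> {0..real k}))"
proof -
  have meas: "(indicator (A \<inter> {0..real k}) :: real \<Rightarrow> real) \<in> borel_measurable half_line"
    if "A \<in> sets borel" for A k
    using that by (intro measurable_restrict_space1) simp
  have A: "A \<in> sigma_sets UNIV (range (\<lambda>a::real. {..a}))"
    using assms by (simp add: borel_eq_atMost)
  have borel: "sigma_sets UNIV (range (\<lambda>a::real. {..a})) = sets borel"
    by (simp add: borel_eq_atMost)
  have subset_Pow: "range (\<lambda>a::real. {..a}) \<subseteq> Pow UNIV" by simp
  have "Int_stable (range (\<lambda>a::real. {..a}))"
    by (auto simp: Int_stable_def)
  from this subset_Pow A show ?thesis
  proof (induction rule: sigma_sets_induct_disjoint)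
    case (basic A)
    then obtain a where a: "A = {..a}" by auto
    define m where "m = min a (real k)"
    have "\<exists>r :: rat. m < of_rat r \<and> of_rat r < m + 1 / real (Suc i)" for i
      by (rule of_rat_dense) simp
    then obtain r :: "nat \<Rightarrow> rat" where r: "\<And>i. m < of_rat (r i)" "\<And>i. of_rat (r i) < m + 1 / real (Suc i)"
      by metis
    show ?case
    proof (rule step_limit_dominated)
      show "step_limit (step [(1, r i)])" for i by (rule step_limit_step)
      show "(indicator (A \<inter> {0..real k}) :: real \<Rightarrow> real) \<in> borel_measurable half_line"
        by (rule meas) (simp add: a)
      show "(indicator (UNIV \<inter> {0..real (nat \<lceil>m + 1\<rceil>)}) :: real \<Rightarrow> real) \<in> borel_measurable half_line"
        by (rule meas) simp
      show "energy half_line (indicator (UNIV \<inter> {0..real (nat \<lceil>m + 1\<rceil>)}) :: real \<Rightarrow> real) < \<infinity>"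
        by (rule energy_indicator_bounded)
      fix x assume x: "x \<in> space half_line"
      have ind: "indicator (A \<inter> {0..real k}) x = (indicator {..m} x :: real)"
        using x by (auto simp: a m_def indicator_def space_restrict_space)
      show "(\<lambda>i. step [(1, r i)] x) \<longlonglongrightarrow> indicator (A \<inter> {0..real k}) x"
      proof (cases "x \<le> m")
        case True
        then have "step [(1, r i)] x = 1" for i
          using r(1)[of i] by (simp add: step_def)
        then show ?thesis using True by (simp add: ind)
      next
        case False
        then obtain N where N: "1 / real (Suc N) < x - m"
          using nat_approx_posE[of "x - m"] by auto
        have "step [(1, r i)] x = 0" if "i \<ge> N" for i
        proof -
          have "1 / real (Suc i) \<le> 1 / real (Suc N)" using that by (simp add: frac_le)
          then show ?thesis using r(2)[of i] N by (simp add: step_def)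
        qed
        then have "eventually (\<lambda>i. step [(1, r i)] x = 0) sequentially"
          by (auto simp: eventually_sequentially)
        then show ?thesis using False by (simp add: ind tendsto_eventually)
      qed
      fix i
      have "1 / real (Suc i) \<le> 1" by simp
      then have "of_rat (r i) \<le> m + 1" using r(2)[of i] by linarith
      then show "\<bar>indicator (A \<inter> {0..real k}) x - step [(1, r i)] x\<bar>
          \<le> \<bar>indicator (UNIV \<inter> {0..real (nat \<lceil>m + 1\<rceil>)}) x :: real\<bar>"
        using x r(1)[of i] unfolding ind
        by (auto simp: step_def indicator_def space_restrict_space) linarith+
    qed
  next
    case empty
    have "indicator ({} \<inter> {0..real k}) = step []" by (auto simp: step_def)
    then show ?case by (simp only: step_limit_step)
  next
    case (compl A)
    have "step_limit (indicator ({..real k} \<inter> {0..real k}))"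
    proof -
      have "step_limit (step [(1, of_nat k)])" by (rule step_limit_step)
      moreover have "indicator ({..real k} \<inter> {0..real k}) x = step [(1, of_nat k)] x"
        if "x \<in> space half_line" for x
        using that by (auto simp: step_def indicator_def space_restrict_space)
      ultimately show ?thesis
        using step_limit_cong by blast
    qed
    moreover have "step_limit (\<lambda>x. (-1) * indicator (A \<inter> {0..real k}) x)"
      by (rule step_limit_scale[OF compl.IH energy_indicator_bounded])
    ultimately have "step_limit (\<lambda>x. indicator ({..real k} \<inter> {0..real k}) x
        + (-1) * indicator (A \<inter> {0..real k}) x)"
      by (rule step_limit_add)
    moreover have "(\<lambda>x. indicator ({..real k} \<inter> {0..real k}) x + (-1) * indicator (A \<inter> {0..real k}) x)
        = (indicator ((UNIV - A) \<inter> {0..real k}) :: real \<Rightarrow> real)"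
      by (auto simp: indicator_def)
    ultimately show ?case by simp
  next
    case (union A)
    have sets: "A i \<in> sets borel" for i
      using union(2) borel by auto
    have fin: "step_limit (indicator ((\<Union>i<n. A i) \<inter> {0..real k}))" for n
    proof (induction n)
      case 0
      have "indicator ((\<Union>i<0. A i) \<inter> {0..real k}) = step []" by (auto simp: step_def)
      then show ?case by (simp only: step_limit_step)
    next
      case (Suc n)
      have disj: "x \<notin> A n" if "x \<in> (\<Union>i<n. A i)" for x
      proof -
        obtain i where "i < n" "x \<in> A i" using \<open>x \<in> (\<Union>i<n. A i)\<close> by auto
        then show ?thesis using disjoint_family_onD[OF union(1), of i n] by auto
      qed
      have "indicator ((\<Union>i<Suc n. A i) \<inter> {0..real k}) x
          = (indicator ((\<Union>i<n. A i) \<inter> {0..real k}) x + indicator (A n \<inter> {0..real k}) x :: real)" for x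
      proof -
        have "x \<in> (\<Union>i<Suc n. A i) \<longleftrightarrow> x \<in> (\<Union>i<n. A i) \<or> x \<in> A n"
          by (auto simp: lessThan_Suc)
        then show ?thesis using disj[of x] unfolding indicator_def Int_iff by auto
      qed
      then show ?case using step_limit_add[OF Suc.IH union(3)[of n]] by (simp only:)
    qed
    show ?case
    proof (rule step_limit_dominated)
      show "step_limit (indicator ((\<Union>i<n. A i) \<inter> {0..real k}))" for n by (rule fin)
      show "(indicator ((\<Union>i. A i) \<inter> {0..real k}) :: real \<Rightarrow> real) \<in> borel_measurable half_line"
        using sets by (intro meas) auto
      show "(indicator (UNIV \<inter> {0..real k}) :: real \<Rightarrow> real) \<in> borel_measurable half_line"
        by (rule meas) simp
      show "energy half_line (indicator (UNIV \<inter> {0..real k}) :: real \<Rightarrow> real) < \<infinity>"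
        by (rule energy_indicator_bounded)
      fix x :: real
      show "(\<lambda>n. indicator ((\<Union>i<n. A i) \<inter> {0..real k}) x :: real)
          \<longlonglongrightarrow> indicator ((\<Union>i. A i) \<inter> {0..real k}) x"
      proof (cases "x \<in> (\<Union>i. A i)")
        case True
        then obtain i where "x \<in> A i" by auto
        then have "eventually (\<lambda>n. indicator ((\<Union>i<n. A i) \<inter> {0..real k}) x
            = (indicator ((\<Union>i. A i) \<inter> {0..real k}) x :: real)) sequentially"
          by (intro eventually_sequentiallyI[of "Suc i"]) (auto simp: indicator_def)
        then show ?thesis by (rule tendsto_eventually)
      next
        case False
        then have "indicator ((\<Union>i<n. A i) \<inter> {0..real k}) x = (0 :: real)" for n
          by (auto simp: indicator_def)
        moreover have "indicator ((\<Union>i. A i) \<inter> {0..real k}) x = (0 :: real)"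
          using False by (auto simp: indicator_def)
        ultimately show ?thesis by simp
      qed
      show "\<bar>indicator ((\<Union>i. A i) \<inter> {0..real k}) x - indicator ((\<Union>i<n. A i) \<inter> {0..real k}) x\<bar>
          \<le> \<bar>indicator (UNIV \<inter> {0..real k}) x :: real\<bar>" for n
        by (auto simp: indicator_def)
    qed
  qed
qed

text \<open>Monotone approximation by simple functions; the summands occurring in the induction are dominated
  by \<open>u\<close> and thus stay in \<open>L\<^sup>2\<close>.\<close>

lemma step_limit_nonneg:
  assumes "u \<in> borel_measurable half_line" "\<And>x. 0 \<le> u x" "energy half_line u < \<infinity>"
  shows "step_limit u"
  using assms
proof (induction rule: borel_measurable_induct_real)
  case (set A)
  have A: "A \<in> sets borel" "A \<subseteq> {0..}"
    using set(1) by (auto simp: sets_restrict_space)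
  show ?case
  proof (rule step_limit_dominated)
    show "step_limit (indicator (A \<inter> {0..real k}))" for k
      by (rule step_limit_indicator_bounded[OF A(1)])
    show "indicator A \<in> borel_measurable half_line" "indicator A \<in> borel_measurable half_line"
      using set(1) by simp_all
    fix x :: real
    obtain N where "x \<le> real N" using real_arch_simple by blast
    then have "eventually (\<lambda>k. indicator (A \<inter> {0..real k}) x = (indicator A x :: real)) sequentially"
      using A(2) by (intro eventually_sequentiallyI[of N]) (auto simp: indicator_def)
    then show "(\<lambda>k. indicator (A \<inter> {0..real k}) x :: real) \<longlonglongrightarrow> indicator A x"
      by (rule tendsto_eventually)
    show "\<bar>indicator A x - indicator (A \<inter> {0..real k}) x\<bar> \<le> \<bar>indicator A x :: real\<bar>" for k
      by (auto simp: indicator_def)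
  qed (use set in auto)
next
  case (mult u c)
  show ?case
  proof (cases "c = 0")
    case True
    have "(\<lambda>x. c * u x) = step []" by (simp add: step_def True fun_eq_iff)
    then show ?thesis by (simp only: step_limit_step)
  next
    case False
    have "energy half_line (\<lambda>x. c * u x) = ennreal (c\<^sup>2) * energy half_line u"
      unfolding energy_def using mult(2)
      by (subst nn_integral_cmult[symmetric]) (auto simp: power_mult_distrib ennreal_mult)
    then have "energy half_line u < \<infinity>"
      using mult.prems False by (auto simp: ennreal_mult_less_top)
    then show ?thesis using step_limit_scale mult.IH by blast
  qed
next
  case (add u v)
  have "energy half_line u \<le> energy half_line (\<lambda>x. v x + u x)"
    "energy half_line v \<le> energy half_line (\<lambda>x. v x + u x)"
    unfolding energy_def using add(2,4)
    by (auto intro!: nn_integral_mono ennreal_leI power_mono)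
  then have "energy half_line u < \<infinity>" "energy half_line v < \<infinity>"
    using add.prems by (auto intro: order.strict_trans1)
  then show ?case using add.IH by (intro step_limit_add) auto
next
  case (seq U)
  have le: "U i x \<le> u x" if "x \<in> space half_line" for i x
    using seq(3) seq(4)[OF that] by (intro incseq_le) (auto simp: incseq_def le_fun_def)
  have "energy half_line (U i) \<le> energy half_line u" for i
    unfolding energy_def using seq(2)
    by (intro nn_integral_mono ennreal_leI power_mono) (auto intro: order_trans[OF le abs_ge_self])
  then have "energy half_line (U i) < \<infinity>" for i
    using seq.prems by (auto intro: order.strict_trans1)
  then have "step_limit (U i)" for i by (rule seq.IH)
  then show ?case
  proof (rule step_limit_dominated)
    show "\<bar>u x - U i x\<bar> \<le> \<bar>u x\<bar>" if "x \<in> space half_line" for i x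
      using le[OF that, of i] seq(2)[of i x] by simp
  qed (use seq assms in auto)
qed

lemma step_limit_real:
  assumes u: "u \<in> borel_measurable half_line" and fin: "energy half_line u < \<infinity>"
  shows "step_limit u"
proof -
  have part: "step_limit (\<lambda>x. max 0 (s * u x))" "energy half_line (\<lambda>x. max 0 (s * u x)) < \<infinity>"
    if "s \<in> {1, -1}" for s
  proof -
    have "energy half_line (\<lambda>x. max 0 (s * u x)) \<le> energy half_line u"
      unfolding energy_def
    proof (intro nn_integral_mono ennreal_leI)
      fix x show "(norm (max 0 (s * u x)))\<^sup>2 \<le> (norm (u x))\<^sup>2"
        using that by (intro power_mono) (auto simp: max_def)
    qed
    then show "energy half_line (\<lambda>x. max 0 (s * u x)) < \<infinity>"
      using fin by (rule order.strict_trans1)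
    then show "step_limit (\<lambda>x. max 0 (s * u x))"
      using u by (intro step_limit_nonneg) auto
  qed
  have "step_limit (\<lambda>x. max 0 (1 * u x) + (-1) * max 0 ((-1) * u x))"
    by (intro step_limit_add step_limit_scale part) auto
  moreover have "(\<lambda>x. max 0 (1 * u x) + (-1) * max 0 ((-1) * u x)) = u"
    by (auto simp: max_def)
  ultimately show ?thesis by simp
qed

lemma energy_HL_1:
  assumes "v \<in> borel_measurable (HL 1)"
  shows "energy (HL 1) v = energy half_line (\<lambda>r. v (\<lambda>i\<in>{..<1}. r))"
proof -
  have "(\<lambda>r. \<lambda>i\<in>{..<1}. r) \<in> half_line \<rightarrow>\<^sub>M HL 1"
    by (rule measurable_into_HL) simp
  then have m: "(\<lambda>r. ennreal ((norm (v (\<lambda>i\<in>{..<1}. r)))\<^sup>2)) \<in> borel_measurable half_line"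
    using assms by (auto intro: measurable_compose)
  have "energy (HL 1) v = (\<integral>\<^sup>+x. ennreal ((norm (v (\<lambda>i\<in>{..<1}. x 0)))\<^sup>2) \<partial>HL 1)"
    unfolding energy_def
  proof (rule nn_integral_cong)
    fix x assume "x \<in> space (HL 1)"
    then have "(\<lambda>i\<in>{..<1}. x 0) = x"
      by (auto simp: space_HL PiE_iff extensional_def)
    then show "ennreal ((norm (v x))\<^sup>2) = ennreal ((norm (v (\<lambda>i\<in>{..<1}. x 0)))\<^sup>2)" by simp
  qed
  also have "\<dots> = energy half_line (\<lambda>r. v (\<lambda>i\<in>{..<1}. r))"
    using half_line.product_nn_integral_singleton[OF m, of 0]
    by (simp add: half_line_power_def energy_def lessThan_Suc)
  finally show ?thesis .
qed

text \<open>The pairs of step functions with rational data form a countable dense set.\<close>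

lemma L2_HL_1_dense_sequence:
  "\<exists>q :: nat \<Rightarrow> (nat \<Rightarrow> real) \<Rightarrow> complex. (\<forall>n. q n \<in> borel_measurable (HL 1)) \<and>
     (\<forall>v\<in>L2 (HL 1). \<forall>e>0. \<exists>n. energy (HL 1) (\<lambda>x. v x - q n x) < ennreal e)"
proof -
  define Q where "Q = (\<lambda>(k, l) (x :: nat \<Rightarrow> real). Complex (step k (x 0)) (step l (x 0)))"
  have meas_Q: "Q kl \<in> borel_measurable (HL 1)" for kl
  proof (cases kl)
    case (Pair k l)
    have [measurable]: "(\<lambda>x. step k (x 0)) \<in> borel_measurable (HL 1)"
      "(\<lambda>x. step l (x 0)) \<in> borel_measurable (HL 1)"
      by (auto intro!: measurable_compose[OF _ measurable_step] measurable_HL_component)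
    have "(\<lambda>x. of_real (step k (x 0)) + \<i> * of_real (step l (x 0)) :: complex) \<in> borel_measurable (HL 1)"
      by measurable
    then show ?thesis by (simp add: Q_def Pair Complex_eq)
  qed
  have "\<exists>kl. energy (HL 1) (\<lambda>x. v x - Q kl x) < ennreal e" if v: "v \<in> L2 (HL 1)" and e: "e > 0" for v e
  proof -
    define v' where "v' = (\<lambda>r. v (\<lambda>i\<in>{..<1}. r))"
    have meas_v: "v \<in> borel_measurable (HL 1)" using v by (simp add: L2_def)
    have "(\<lambda>r. \<lambda>i\<in>{..<1}. r) \<in> half_line \<rightarrow>\<^sub>M HL 1"
      by (rule measurable_into_HL) simp
    from measurable_compose[OF this meas_v] have v' [measurable]: "v' \<in> borel_measurable half_line"
      unfolding v'_def .
    have fin: "energy half_line v' < \<infinity>"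
      using v energy_HL_1[OF meas_v] unfolding v'_def L2_def by simp
    have "energy half_line (\<lambda>r. Re (v' r)) \<le> energy half_line v'"
      "energy half_line (\<lambda>r. Im (v' r)) \<le> energy half_line v'"
      unfolding energy_def by (intro nn_integral_mono ennreal_leI power_mono;
          simp add: abs_Re_le_cmod abs_Im_le_cmod)+
    then have "energy half_line (\<lambda>r. Re (v' r)) < \<infinity>" "energy half_line (\<lambda>r. Im (v' r)) < \<infinity>"
      using fin by (auto intro: order.strict_trans1)
    then have "step_limit (\<lambda>r. Re (v' r))" "step_limit (\<lambda>r. Im (v' r))"
      by (auto intro!: step_limit_real)
    moreover have "e / 2 > 0" using e by simp
    ultimately obtain k l where k: "energy half_line (\<lambda>r. Re (v' r) - step k r) < ennreal (e / 2)"
      and l: "energy half_line (\<lambda>r. Im (v' r) - step l r) < ennreal (e / 2)"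
      unfolding step_limit_def by meson
    have "energy (HL 1) (\<lambda>x. v x - Q (k, l) x)
        = energy half_line (\<lambda>r. v' r - Complex (step k r) (step l r))"
      using energy_HL_1[of "\<lambda>x. v x - Q (k, l) x"] meas_v meas_Q[of "(k, l)"]
      by (simp add: Q_def v'_def)
    also have "\<dots> = (\<integral>\<^sup>+r. ennreal ((norm (Re (v' r) - step k r))\<^sup>2)
        + ennreal ((norm (Im (v' r) - step l r))\<^sup>2) \<partial>half_line)"
      unfolding energy_def
      by (intro nn_integral_cong) (simp add: cmod_power2 ennreal_plus[symmetric] del: ennreal_plus)
    also have "\<dots> = energy half_line (\<lambda>r. Re (v' r) - step k r) + energy half_line (\<lambda>r. Im (v' r) - step l r)"
      unfolding energy_def by (rule nn_integral_add) measurable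
    also have "\<dots> < ennreal (e / 2) + ennreal (e / 2)"
      using k l by (rule add_strict_mono)
    also have "\<dots> = ennreal e"
      using e by (simp add: ennreal_plus[symmetric] del: ennreal_plus)
    finally show ?thesis by blast
  qed
  then have "\<exists>n. energy (HL 1) (\<lambda>x. v x - Q (from_nat n) x) < ennreal e"
    if "v \<in> L2 (HL 1)" "e > 0" for v e
    using that by (metis from_nat_to_nat)
  then show ?thesis
    using meas_Q by (intro exI[of _ "\<lambda>n. Q (from_nat n)"]) auto
qed

text \<open>As in any separable metric space: next to each member of a dense sequence and for each precision
  one element of \<open>E\<close> is picked, if there is any.\<close>

lemma L2_HL_1_subset_separable:
  assumes E: "E \<subseteq> L2 (HL 1)"
  shows "\<exists>D\<subseteq>E. countable D \<and>
    (\<forall>v\<in>E. \<forall>e>0. \<exists>d\<in>D. energy (HL 1) (\<lambda>x. v x - d x) < ennreal e)"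
proof -
  obtain q :: "nat \<Rightarrow> (nat \<Rightarrow> real) \<Rightarrow> complex" where q: "\<And>n. q n \<in> borel_measurable (HL 1)"
    and dense: "\<And>v e. v \<in> L2 (HL 1) \<Longrightarrow> e > 0 \<Longrightarrow> \<exists>n. energy (HL 1) (\<lambda>x. v x - q n x) < ennreal e"
    using L2_HL_1_dense_sequence by blast
  define near where "near n k d \<longleftrightarrow> d \<in> E \<and> energy (HL 1) (\<lambda>x. d x - q n x) < ennreal (1 / real (Suc k))"
    for n k d
  define D where "D = {SOME d. near n k d | n k. \<exists>d. near n k d}"
  have D_near: "near n k (SOME d. near n k d)" if "\<exists>d. near n k d" for n k
    using that by (rule someI_ex)
  have "D \<subseteq> (\<lambda>(n, k). SOME d. near n k d) ` UNIV"
    unfolding D_def by auto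
  then have "countable D"
    by (rule countable_subset) (intro countable_image uncountable_def; simp)
  moreover have "D \<subseteq> E"
    using D_near unfolding D_def near_def by blast
  moreover have "\<exists>d\<in>D. energy (HL 1) (\<lambda>x. v x - d x) < ennreal e" if v: "v \<in> E" and e: "e > 0" for v e
  proof -
    obtain k where k: "1 / real (Suc k) < e / 4"
      using nat_approx_posE[of "e / 4"] e by auto
    obtain n where n: "energy (HL 1) (\<lambda>x. v x - q n x) < ennreal (1 / real (Suc k))"
      using dense[of v "1 / real (Suc k)"] v E by auto
    define d where "d = (SOME d. near n k d)"
    have ex: "\<exists>d. near n k d" using v n by (auto simp: near_def)
    have d: "near n k d" unfolding d_def by (rule D_near[OF ex])
    have le: "ennreal (1 / real (Suc k)) \<le> ennreal (e / 4)"
      using k by (intro ennreal_leI) simp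
    have meas: "v \<in> borel_measurable (HL 1)" "d \<in> borel_measurable (HL 1)"
      using v d E by (auto simp: near_def L2_def)
    have "energy (HL 1) (\<lambda>x. q n x - d x) = energy (HL 1) (\<lambda>x. d x - q n x)"
      unfolding energy_def by (simp add: norm_minus_commute)
    then have "energy (HL 1) (\<lambda>x. v x - d x) < ennreal e"
      using d n le by (intro energy_triangle[OF meas q[of n]])
        (auto simp: near_def intro: order.strict_trans2)
    moreover have "d \<in> D" using ex unfolding D_def d_def by blast
    ultimately show ?thesis by blast
  qed
  ultimately show ?thesis by blast
qed

section \<open>Orthogonality of slices\<close>

lemma Cauchy_Schwarz_integral:
  fixes u v :: "'a \<Rightarrow> complex"
  assumes [measurable]: "u \<in> borel_measurable M" "v \<in> borel_measurable M"
  shows "(\<integral>\<^sup>+x. ennreal (cmod (u x * v x)) \<partial>M)\<^sup>2 \<le> energy M u * energy M v"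
    and "ennreal ((cmod (\<integral>x. u x * v x \<partial>M))\<^sup>2) \<le> energy M u * energy M v"
proof -
  have "(\<integral>\<^sup>+x. ennreal (cmod (u x)) * ennreal (cmod (v x)) \<partial>M) = (\<integral>\<^sup>+x. ennreal (cmod (u x * v x)) \<partial>M)"
    by (simp add: norm_mult ennreal_mult)
  then show CS: "(\<integral>\<^sup>+x. ennreal (cmod (u x * v x)) \<partial>M)\<^sup>2 \<le> energy M u * energy M v"
    using Cauchy_Schwarz_nn_integral[of "\<lambda>x. ennreal (cmod (u x))" M "\<lambda>x. ennreal (cmod (v x))"]
    by (simp add: energy_def ennreal_power)
  show "ennreal ((cmod (\<integral>x. u x * v x \<partial>M))\<^sup>2) \<le> energy M u * energy M v"
  proof (cases "integrable M (\<lambda>x. u x * v x)")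
    case True
    have "ennreal (cmod (\<integral>x. u x * v x \<partial>M)) \<le> (\<integral>\<^sup>+x. ennreal (cmod (u x * v x)) \<partial>M)"
      by (rule integral_norm_bound_ennreal[OF True])
    then have "(ennreal (cmod (\<integral>x. u x * v x \<partial>M)))\<^sup>2 \<le> (\<integral>\<^sup>+x. ennreal (cmod (u x * v x)) \<partial>M)\<^sup>2"
      by (rule power_mono) simp
    then show ?thesis using CS by (simp add: ennreal_power)
  qed (simp add: not_integrable_integral_eq)
qed

lemma L2_mult_integrable:
  assumes u: "u \<in> L2 M" and v: "v \<in> L2 M"
  shows "integrable M (\<lambda>x. u x * v x)"
proof -
  have meas [measurable]: "u \<in> borel_measurable M" "v \<in> borel_measurable M"
    using u v by (simp_all add: L2_def)
  have "(\<integral>\<^sup>+x. ennreal (cmod (u x * v x)) \<partial>M)\<^sup>2 < \<infinity>"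
    using Cauchy_Schwarz_integral(1)[OF meas] u v
    by (auto simp: L2_def ennreal_mult_less_top intro: order.strict_trans1)
  then have "(\<integral>\<^sup>+x. ennreal (cmod (u x * v x)) \<partial>M) < \<infinity>"
    by (simp add: power2_eq_square ennreal_mult_less_top)
      (metis ennreal_mult_eq_top_iff less_top ennreal_zero_neq_top not_gr_zero)
  then show ?thesis by (simp add: integrable_iff_bounded)
qed

lemma orthogonal_to_L2_limit:
  assumes v: "v \<in> L2 M" and r: "r \<in> L2 M"
    and approx: "\<And>e. e > 0 \<Longrightarrow> \<exists>d\<in>L2 M. (\<integral>x. d x * r x \<partial>M) = 0 \<and> energy M (\<lambda>x. v x - d x) < ennreal e"
  shows "(\<integral>x. v x * r x \<partial>M) = 0"
proof (rule ccontr)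
  assume nz: "(\<integral>x. v x * r x \<partial>M) \<noteq> 0"
  define c where "c = (cmod (\<integral>x. v x * r x \<partial>M))\<^sup>2"
  have c: "c > 0" using nz by (simp add: c_def)
  obtain R where R: "energy M r = ennreal R" "R \<ge> 0"
    using r by (cases "energy M r") (auto simp: L2_def)
  have "c / (R + 1) > 0" using c R by simp
  then obtain d where d: "d \<in> L2 M" "(\<integral>x. d x * r x \<partial>M) = 0"
    and e: "energy M (\<lambda>x. v x - d x) < ennreal (c / (R + 1))"
    using approx by blast
  have "(\<lambda>x. v x - d x) \<in> borel_measurable M" "r \<in> borel_measurable M"
    using v d r by (auto simp: L2_def)
  from Cauchy_Schwarz_integral(2)[OF this]
  have "ennreal ((cmod (\<integral>x. (v x - d x) * r x \<partial>M))\<^sup>2) \<le> energy M (\<lambda>x. v x - d x) * ennreal R"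
    by (simp add: R)
  moreover have "(\<integral>x. (v x - d x) * r x \<partial>M) = (\<integral>x. v x * r x \<partial>M)"
    using L2_mult_integrable[OF v r] L2_mult_integrable[OF d(1) r] d(2)
    by (simp add: left_diff_distrib)
  ultimately have "ennreal c \<le> energy M (\<lambda>x. v x - d x) * ennreal R"
    by (simp add: c_def)
  also have "\<dots> \<le> ennreal (c / (R + 1)) * ennreal R"
    using e by (intro mult_right_mono) auto
  also have "\<dots> = ennreal (c / (R + 1) * R)"
    using c R by (subst ennreal_mult) auto
  finally have "c \<le> c / (R + 1) * R"
    using c R by (subst (asm) ennreal_le_iff) auto
  moreover have "c / (R + 1) * R < c"
    using c R by (simp add: field_simps)
  ultimately show False by simp
qed

text \<open>Orthogonality of almost all pairs of slices improves to orthogonality of all pairs taken from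
  two sets of full measure: the slices \<open>H y\<close> have a countable dense subset, and countably many null
  sets of parameters \<open>w\<close> suffice.\<close>

lemma orthogonal_slices_uniform:
  fixes H :: "'y \<Rightarrow> (nat \<Rightarrow> real) \<Rightarrow> complex" and R :: "'w \<Rightarrow> (nat \<Rightarrow> real) \<Rightarrow> complex"
  assumes H: "AE y in Y. H y \<in> L2 (HL 1)" and R: "AE w in W. R w \<in> L2 (HL 1)"
    and orth: "AE y in Y. AE w in W. (\<integral>x. H y x * R w x \<partial>HL 1) = 0"
  shows "\<exists>P Q. (AE y in Y. P y) \<and> (AE w in W. Q w) \<and>
    (\<forall>y. P y \<longrightarrow> H y \<in> L2 (HL 1)) \<and> (\<forall>w. Q w \<longrightarrow> R w \<in> L2 (HL 1)) \<and>
    (\<forall>y w. P y \<longrightarrow> Q w \<longrightarrow> (\<integral>x. H y x * R w x \<partial>HL 1) = 0)"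
proof -
  define P where "P y \<longleftrightarrow> H y \<in> L2 (HL 1) \<and> (AE w in W. (\<integral>x. H y x * R w x \<partial>HL 1) = 0)" for y
  have "H ` Collect P \<subseteq> L2 (HL 1)" by (auto simp: P_def)
  from L2_HL_1_subset_separable[OF this] obtain D where D: "D \<subseteq> H ` Collect P" "countable D"
    and dense: "\<And>y e. P y \<Longrightarrow> e > 0 \<Longrightarrow> \<exists>d\<in>D. energy (HL 1) (\<lambda>x. H y x - d x) < ennreal e"
    by auto
  define Q where "Q w \<longleftrightarrow> R w \<in> L2 (HL 1) \<and> (\<forall>d\<in>D. (\<integral>x. d x * R w x \<partial>HL 1) = 0)" for w
  have "AE w in W. \<forall>d\<in>D. (\<integral>x. d x * R w x \<partial>HL 1) = 0"
    using D by (intro AE_ball_countable') (auto simp: P_def)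
  with R have "AE w in W. Q w"
    unfolding Q_def by eventually_elim simp
  moreover from H orth have "AE y in Y. P y"
    unfolding P_def by eventually_elim simp
  moreover have "(\<integral>x. H y x * R w x \<partial>HL 1) = 0" if y: "P y" and w: "Q w" for y w
  proof (rule orthogonal_to_L2_limit)
    show "H y \<in> L2 (HL 1)" "R w \<in> L2 (HL 1)"
      using y w by (simp_all add: P_def Q_def)
    fix e :: real assume "e > 0"
    then obtain d where d: "d \<in> D" "energy (HL 1) (\<lambda>x. H y x - d x) < ennreal e"
      using dense[OF y] by blast
    moreover have "d \<in> L2 (HL 1)" using d(1) D(1) by (auto simp: P_def)
    moreover have "(\<integral>x. d x * R w x \<partial>HL 1) = 0" using d(1) w by (simp add: Q_def)
    ultimately show "\<exists>d\<in>L2 (HL 1). (\<integral>x. d x * R w x \<partial>HL 1) = 0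
        \<and> energy (HL 1) (\<lambda>x. H y x - d x) < ennreal e" by blast
  qed
  moreover have "P y \<Longrightarrow> H y \<in> L2 (HL 1)" "Q w \<Longrightarrow> R w \<in> L2 (HL 1)" for y w
    by (simp_all add: P_def Q_def)
  ultimately show ?thesis
    by (intro exI[of _ P] exI[of _ Q] conjI allI impI)
qed

section \<open>Slices of kernels and contractions\<close>

text \<open>A slice \<open>x \<mapsto> h (insert_at a i t x)\<close> of \<open>h\<close> in the \<open>i\<close>-th variable is parametrized by the whole point
  \<open>t\<close>, whose \<open>i\<close>-th coordinate is overwritten. In this way inserting a variable commutes with \<open>pull\<close>
  without any shift of indices.\<close>

definition insert_at :: "nat \<Rightarrow> nat \<Rightarrow> (nat \<Rightarrow> real) \<Rightarrow> (nat \<Rightarrow> real) \<Rightarrow> nat \<Rightarrow> real" where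
  "insert_at a i t x = pull a (\<lambda>k. if k = i then a else k) (glue a 1 t x)"

lemma insert_at_eq: "insert_at a i t x = (\<lambda>k\<in>{..<a}. if k = i then x 0 else t k)"
  by (auto simp: insert_at_def pull_def glue_def)

lemma measurable_pull_glue:
  assumes t: "t \<in> space (HL N)" and lt: "\<And>k. k < a \<Longrightarrow> \<sigma> k < N + p"
    and h: "h \<in> borel_measurable (HL a)"
  shows "(\<lambda>s. h (pull a \<sigma> (glue N p t s))) \<in> borel_measurable (HL p)"
proof -
  have "(\<lambda>s. glue N p t s) \<in> HL p \<rightarrow>\<^sub>M HL (N + p)"
    using t by measurable
  from measurable_compose[OF this measurable_compose[OF measurable_pull h]] lt show ?thesis
    by blast
qed

lemma AE_slice_L2:
  assumes h: "h \<in> sq_integrable a" and inj: "inj_on \<sigma> {..<a}"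
    and lt: "\<And>i. i < a \<Longrightarrow> \<sigma> i < N + p" and onto: "{N..<N + p} \<subseteq> \<sigma> ` {..<a}"
  shows "AE t in HL N. (\<lambda>s. h (pull a \<sigma> (glue N p t s))) \<in> L2 (HL p)"
proof -
  have h': "h \<in> borel_measurable (HL a)" "(\<integral>\<^sup>+t. ennreal ((cmod (h t))\<^sup>2) \<partial>HL a) < \<infinity>"
    using h by (simp_all add: sq_integrable_iff)
  have "AE t in HL N. (\<integral>\<^sup>+s. ennreal ((cmod (h (pull a \<sigma> (glue N p t s))))\<^sup>2) \<partial>HL p) < \<infinity>"
    by (rule AE_slice_nn_integral_finite[OF _ h'(2) inj _ onto]) (use h'(1) lt in auto)
  then show ?thesis
    by (rule AE_mp) (intro AE_I2 impI, use measurable_pull_glue[OF _ lt h'(1)] in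
        \<open>simp add: L2_def energy_def\<close>)
qed

lemma AE_insert_at_L2:
  assumes "h \<in> sq_integrable a" "i < a"
  shows "AE t in HL a. (\<lambda>x. h (insert_at a i t x)) \<in> L2 (HL 1)"
  unfolding insert_at_def
  by (rule AE_slice_L2[OF assms(1)]) (use assms(2) in \<open>auto simp: inj_on_def image_iff\<close>)

lemma measurable_pairing:
  assumes "h \<in> borel_measurable (HL a)" "k \<in> borel_measurable (HL b)"
    and "\<And>i. i < a \<Longrightarrow> \<sigma> i < N + p" "\<And>i. i < b \<Longrightarrow> \<tau> i < N + p"
  shows "pairing a \<sigma> b \<tau> N p h k \<in> borel_measurable (HL N)"
proof -
  have "(\<lambda>z. h (pull a \<sigma> z) * k (pull b \<tau> z)) \<in> borel_measurable (HL (N + p))"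
    using measurable_compose[OF measurable_pull assms(1), of \<sigma> "N + p"]
      measurable_compose[OF measurable_pull assms(2), of \<tau> "N + p"] assms(3,4)
    by (intro borel_measurable_times) blast+
  from measurable_compose[OF measurable_glue' this]
  show ?thesis
    unfolding pairing_def by (intro HL.borel_measurable_lebesgue_integral) (simp add: split_beta')
qed

text \<open>By the Cauchy-Schwarz inequality in the contracted variables.\<close>

lemma contraction_sq_integrable:
  assumes h: "h \<in> sq_integrable n" and k: "k \<in> sq_integrable m" and p: "p \<le> min n m"
  shows "contraction n m p h k \<in> sq_integrable (n + m - 2 * p)"
proof -
  define \<rho> where "\<rho> i = (if i < p then (m - p) + (p - 1 - i) else i - p)" for i
  have np: "n - p + p = n" "m - p + p = m" "(n - p) + (m - p) = n + m - 2 * p"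
    using p by auto
  have meas: "h \<in> borel_measurable (HL n)" "k \<in> borel_measurable (HL m)"
    using h k by (simp_all add: sq_integrable_iff)
  have \<rho>_lt: "\<rho> i < m - p + p" if "i < m" for i
    using that p by (auto simp: \<rho>_def)
  have "inj_on \<rho> {..<m}"
    using p by (auto simp: \<rho>_def inj_on_def split: if_splits)
  moreover from this have "\<rho> ` {..<m} = {..<m}"
    using \<rho>_lt np(2) by (intro card_subset_eq) (auto simp: card_image)
  ultimately have \<rho>: "bij_betw \<rho> {..<m} {..<m}" by (simp add: bij_betw_def)
  define a where "a t = (\<integral>\<^sup>+s. ennreal ((cmod (h (glue (n - p) p t s)))\<^sup>2) \<partial>HL p)" for t
  define b where "b t = (\<integral>\<^sup>+s. ennreal ((cmod (k (pull m \<rho> (glue (m - p) p t s))))\<^sup>2) \<partial>HL p)" for t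
  have mh: "(\<lambda>z. ennreal ((cmod (h z))\<^sup>2)) \<in> borel_measurable (HL (n - p + p))"
    using meas(1) by (simp add: np)
  have mk: "(\<lambda>z. ennreal ((cmod (k (pull m \<rho> z)))\<^sup>2)) \<in> borel_measurable (HL (m - p + p))"
    using measurable_compose[OF measurable_pull[OF \<rho>_lt] meas(2)] by simp
  have ma: "a \<in> borel_measurable (HL (n - p))"
    unfolding a_def using measurable_compose[OF measurable_glue' mh]
    by (intro HL.borel_measurable_nn_integral) (simp add: split_beta')
  have mb: "b \<in> borel_measurable (HL (m - p))"
    unfolding b_def using measurable_compose[OF measurable_glue' mk]
    by (intro HL.borel_measurable_nn_integral) (simp add: split_beta')
  have int_a: "(\<integral>\<^sup>+t. a t \<partial>HL (n - p)) < \<infinity>"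
    using nn_integral_glue[OF mh] h unfolding np a_def by (simp add: sq_integrable_iff)
  have "(\<integral>\<^sup>+t. b t \<partial>HL (m - p)) = (\<integral>\<^sup>+z. ennreal ((cmod (k (pull m \<rho> z)))\<^sup>2) \<partial>HL m)"
    using nn_integral_glue[OF mk] unfolding np b_def by simp
  also have "\<dots> = (\<integral>\<^sup>+z. ennreal ((cmod (k z))\<^sup>2) \<partial>HL m)"
    by (rule nn_integral_pull[OF _ \<rho>]) (use meas in simp)
  finally have int_b: "(\<integral>\<^sup>+t. b t \<partial>HL (m - p)) < \<infinity>"
    using k by (simp add: sq_integrable_iff)
  have mc: "contraction n m p h k \<in> borel_measurable (HL (n + m - 2 * p))"
    unfolding contraction_eq_pairing[OF p]
    by (intro measurable_pairing meas contr_left_lt[OF p] contr_right_lt[OF p])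
  have "(\<integral>\<^sup>+t. ennreal ((cmod (contraction n m p h k t))\<^sup>2) \<partial>HL (n + m - 2 * p))
      = (\<integral>\<^sup>+t1. \<integral>\<^sup>+t2. ennreal ((cmod (contraction n m p h k (glue (n - p) (m - p) t1 t2)))\<^sup>2)
          \<partial>HL (m - p) \<partial>HL (n - p))"
    unfolding np(3)[symmetric] using mc by (intro nn_integral_glue) (simp add: np)
  also have "\<dots> \<le> (\<integral>\<^sup>+t1. \<integral>\<^sup>+t2. a t1 * b t2 \<partial>HL (m - p) \<partial>HL (n - p))"
  proof (intro nn_integral_mono)
    fix t1 t2 assume t: "t1 \<in> space (HL (n - p))" "t2 \<in> space (HL (m - p))"
    let ?h = "\<lambda>s. h (glue (n - p) p t1 s)" and ?k = "\<lambda>s. k (pull m \<rho> (glue (m - p) p t2 s))"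
    have l: "pull n (contr_left n m p) (glue (n + m - 2 * p) p (glue (n - p) (m - p) t1 t2) s)
        = glue (n - p) p t1 s" for s
      using p by (auto simp: pull_def glue_def contr_left_def fun_eq_iff)
    have "glue (n + m - 2 * p) p (glue (n - p) (m - p) t1 t2) s (contr_right n m p i)
        = glue (m - p) p t2 s (\<rho> i)" if "i < m" for s i
    proof (cases "i < p")
      case True
      then have "p - 1 - i < p" by simp
      then show ?thesis by (simp only: contr_right_def \<rho>_def True if_True glue_right)
    next
      case False
      then have "n - p + (i - p) < n + m - 2 * p" "i - p < m - p" using that p by auto
      then show ?thesis
        by (simp only: contr_right_def \<rho>_def False if_False glue_left glue_right)
    qed
    then have r: "pull m (contr_right n m p) (glue (n + m - 2 * p) p (glue (n - p) (m - p) t1 t2) s)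
        = pull m \<rho> (glue (m - p) p t2 s)" for s
      by (auto simp: pull_def)
    have eq: "contraction n m p h k (glue (n - p) (m - p) t1 t2) = (\<integral>s. ?h s * ?k s \<partial>HL p)"
      unfolding contraction_eq_pairing[OF p] pairing_def l r ..
    have mh': "?h \<in> borel_measurable (HL p)"
    proof -
      have "h \<in> borel_measurable (HL (n - p + p))" using meas(1) by (simp only: np)
      moreover have "(\<lambda>s. glue (n - p) p t1 s) \<in> HL p \<rightarrow>\<^sub>M HL (n - p + p)"
        using t(1) by measurable
      ultimately show ?thesis by (rule measurable_compose[rotated])
    qed
    have mk': "?k \<in> borel_measurable (HL p)"
      by (rule measurable_pull_glue[OF t(2) \<rho>_lt meas(2)])
    show "ennreal ((cmod (contraction n m p h k (glue (n - p) (m - p) t1 t2)))\<^sup>2) \<le> a t1 * b t2"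
      unfolding eq using Cauchy_Schwarz_integral(2)[OF mh' mk']
      by (simp add: energy_def a_def b_def)
  qed
  also have "\<dots> = (\<integral>\<^sup>+t. a t \<partial>HL (n - p)) * (\<integral>\<^sup>+t. b t \<partial>HL (m - p))"
    using ma mb by (simp add: nn_integral_cmult nn_integral_multc)
  also have "\<dots> < \<infinity>"
    using int_a int_b by (simp add: ennreal_mult_less_top)
  finally show ?thesis using mc by (simp add: sq_integrable_iff)
qed

definition slices_orth :: "((nat \<Rightarrow> real) \<Rightarrow> complex) set \<Rightarrow> nat \<Rightarrow> nat \<Rightarrow> kernel \<Rightarrow> bool" where
  "slices_orth V a i h \<longleftrightarrow>
     (AE t in HL a. \<forall>v\<in>V. (\<integral>x. h (insert_at a i t x) * v x \<partial>HL 1) = 0)"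

lemma slices_orth_zero: "slices_orth V a i (\<lambda>_. 0)"
  by (simp add: slices_orth_def)

lemma slices_orth_scale: "slices_orth V a i h \<Longrightarrow> slices_orth V a i (\<lambda>t. c * h t)"
  unfolding slices_orth_def by (erule AE_mp) (rule AE_I2, simp add: mult.assoc)

lemma slices_orth_add:
  assumes V: "V \<subseteq> L2 (HL 1)" and i: "i < a"
    and h: "h \<in> sq_integrable a" "slices_orth V a i h"
    and k: "k \<in> sq_integrable a" "slices_orth V a i k"
  shows "slices_orth V a i (\<lambda>t. h t + k t)"
  using AE_insert_at_L2[OF h(1) i] AE_insert_at_L2[OF k(1) i] h(2) k(2)
  unfolding slices_orth_def
proof eventually_elim
  case (elim t)
  show ?case
  proof
    fix v assume v: "v \<in> V"
    then have "v \<in> L2 (HL 1)" using V by blast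
    from L2_mult_integrable[OF elim(1) this] L2_mult_integrable[OF elim(2) this]
    show "(\<integral>x. (h (insert_at a i t x) + k (insert_at a i t x)) * v x \<partial>HL 1) = 0"
      using elim(3,4) v by (simp add: distrib_right)
  qed
qed

text \<open>The slice of the pairing is an average of slices of \<open>h\<close>, by Fubini's theorem.\<close>

lemma slices_orth_pairing:
  assumes V: "V \<subseteq> L2 (HL 1)"
    and h: "h \<in> sq_integrable a" "slices_orth V a j h" and k: "k \<in> sq_integrable b"
    and j: "j < a" "\<sigma> j < N" "\<sigma> j \<notin> \<tau> ` {..<b}"
    and \<sigma>: "inj_on \<sigma> {..<a}" "\<And>i. i < a \<Longrightarrow> \<sigma> i < N + p" "{N..<N + p} \<subseteq> \<sigma> ` {..<a}"
    and \<tau>: "inj_on \<tau> {..<b}" "\<And>i. i < b \<Longrightarrow> \<tau> i < N + p" "{N..<N + p} \<subseteq> \<tau> ` {..<b}"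
  shows "slices_orth V N (\<sigma> j) (pairing a \<sigma> b \<tau> N p h k)"
proof -
  \<comment> \<open>The variable \<open>x\<close> inserted into \<open>h\<close> becomes an additional coordinate, in front of those of \<open>s\<close>.\<close>
  define \<sigma>' where "\<sigma>' i = (if i = j then N else if \<sigma> i < N then \<sigma> i else Suc (\<sigma> i))" for i
  have \<sigma>j: "\<sigma> i = \<sigma> j \<longleftrightarrow> i = j" if "i < a" for i
    using \<sigma>(1) j(1) that by (auto dest: inj_onD)
  have \<sigma>'_inj: "inj_on \<sigma>' {..<a}"
    using \<sigma>(1) by (auto simp: inj_on_def \<sigma>'_def split: if_splits)
  have \<sigma>'_lt: "\<sigma>' i < N + (1 + p)" if "i < a" for i
    using \<sigma>(2)[OF that] by (auto simp: \<sigma>'_def)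
  have \<sigma>'_onto: "{N..<N + (1 + p)} \<subseteq> \<sigma>' ` {..<a}"
  proof
    fix c assume c: "c \<in> {N..<N + (1 + p)}"
    show "c \<in> \<sigma>' ` {..<a}"
    proof (cases "c = N")
      case True
      then show ?thesis using j(1) by (intro image_eqI[of _ _ j]) (auto simp: \<sigma>'_def)
    next
      case False
      then have "c - 1 \<in> {N..<N + p}" using c by auto
      then obtain i where i: "i < a" "c - 1 = \<sigma> i" using \<sigma>(3) by blast
      then have "\<sigma>' i = c" using False c j(2) by (auto simp: \<sigma>'_def)
      then show ?thesis using i(1) by blast
    qed
  qed
  have meas: "h \<in> borel_measurable (HL a)"
    using h(1) by (simp add: sq_integrable_iff)
  have "AE t in HL N. AE s in HL p. \<forall>v\<in>V.
      (\<integral>x. h (insert_at a j (pull a \<sigma> (glue N p t s)) x) * v x \<partial>HL 1) = 0"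
    by (rule AE_pull_glue[OF h(2)[unfolded slices_orth_def] \<sigma>(1)]) (rule \<sigma>(2))
  moreover have "AE t in HL N. (\<lambda>z. h (pull a \<sigma>' (glue N (1 + p) t z))) \<in> L2 (HL (1 + p))"
    by (rule AE_slice_L2[OF h(1) \<sigma>'_inj _ \<sigma>'_onto]) (rule \<sigma>'_lt)
  moreover have "AE t in HL N. (\<lambda>s. k (pull b \<tau> (glue N p t s))) \<in> L2 (HL p)"
    by (rule AE_slice_L2[OF k \<tau>(1) _ \<tau>(3)]) (rule \<tau>(2))
  ultimately show ?thesis
    unfolding slices_orth_def
  proof eventually_elim
    case (elim t)
    define H where "H x s = h (pull a \<sigma>' (glue N (1 + p) t (glue 1 p x s)))" for x s
    define K where "K s = k (pull b \<tau> (glue N p t s))" for s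
    have left: "h (pull a \<sigma> (glue N p (insert_at N (\<sigma> j) t x) s)) = H x s" for x s
    proof -
      have "pull a \<sigma> (glue N p (insert_at N (\<sigma> j) t x) s) i
          = pull a \<sigma>' (glue N (1 + p) t (glue 1 p x s)) i" for i
        using \<sigma>j[of i] \<sigma>(2)[of i] j(1,2)
        by (cases "i < a"; cases "i = j"; cases "\<sigma> i < N")
          (auto simp: pull_def glue_def insert_at_eq \<sigma>'_def)
      then show ?thesis unfolding H_def by presburger
    qed
    have left': "h (insert_at a j (pull a \<sigma> (glue N p t s)) x) = H x s" for x s
    proof -
      have "insert_at a j (pull a \<sigma> (glue N p t s)) x i
          = pull a \<sigma>' (glue N (1 + p) t (glue 1 p x s)) i" for i
        using \<sigma>j[of i] \<sigma>(2)[of i] j(1,2)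
        by (cases "i < a"; cases "i = j"; cases "\<sigma> i < N")
          (auto simp: pull_def glue_def insert_at_eq \<sigma>'_def)
      then show ?thesis unfolding H_def by presburger
    qed
    have right: "k (pull b \<tau> (glue N p (insert_at N (\<sigma> j) t x) s)) = K s" for x s
    proof -
      have "\<tau> i \<noteq> \<sigma> j" if "i < b" for i
        using j(3) that by (metis imageI lessThan_iff)
      then have "pull b \<tau> (glue N p (insert_at N (\<sigma> j) t x) s) = pull b \<tau> (glue N p t s)"
        by (auto simp: pull_def glue_def insert_at_eq)
      then show ?thesis by (simp add: K_def)
    qed
    show ?case
    proof
      fix v assume v: "v \<in> V"
      then have v2: "v \<in> L2 (HL 1)" using V by blast
      have K2: "K \<in> L2 (HL p)" using elim(3) by (simp add: K_def[abs_def])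
      have Hm: "(\<lambda>z. h (pull a \<sigma>' (glue N (1 + p) t z))) \<in> borel_measurable (HL (1 + p))"
        using elim(2) by (simp add: L2_def)
      let ?M = "HL 1 \<Otimes>\<^sub>M HL p"
      have H_meas: "(\<lambda>z. H (fst z) (snd z)) \<in> borel_measurable ?M"
        unfolding H_def using measurable_compose[OF measurable_glue' Hm] .
      have "energy ?M (\<lambda>z. H (fst z) (snd z)) = energy (HL (1 + p)) (\<lambda>z. h (pull a \<sigma>' (glue N (1 + p) t z)))"
        unfolding energy_def H_def using Hm measurable_compose[OF measurable_glue' Hm]
        by (subst nn_integral_glue, simp, subst HL.nn_integral_fst[symmetric]) auto
      then have H2: "(\<lambda>z. H (fst z) (snd z)) \<in> L2 ?M"
        using H_meas elim(2) by (simp add: L2_def)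
      have [measurable]: "v \<in> borel_measurable (HL 1)" "K \<in> borel_measurable (HL p)"
        using v2 K2 by (simp_all add: L2_def)
      have Kv: "(\<lambda>z. K (snd z) * v (fst z)) \<in> borel_measurable ?M" by measurable
      have "energy ?M (\<lambda>z. K (snd z) * v (fst z))
          = (\<integral>\<^sup>+x. \<integral>\<^sup>+s. ennreal ((cmod (K s * v x))\<^sup>2) \<partial>HL p \<partial>HL 1)"
        unfolding energy_def using HL.nn_integral_fst[of "\<lambda>z. ennreal ((cmod (K (snd z) * v (fst z)))\<^sup>2)" "HL 1" p]
          Kv by simp
      also have "\<dots> = (\<integral>\<^sup>+x. \<integral>\<^sup>+s. ennreal ((cmod (v x))\<^sup>2) * ennreal ((cmod (K s))\<^sup>2) \<partial>HL p \<partial>HL 1)"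
        by (simp add: norm_mult power_mult_distrib ennreal_mult mult.commute)
      also have "\<dots> = energy (HL 1) v * energy (HL p) K"
      proof -
        have mv: "(\<lambda>x. ennreal ((cmod (v x))\<^sup>2)) \<in> borel_measurable (HL 1)"
          and mK: "(\<lambda>s. ennreal ((cmod (K s))\<^sup>2)) \<in> borel_measurable (HL p)" by measurable
        show ?thesis
          unfolding energy_def by (simp only: nn_integral_cmult[OF mK] nn_integral_multc[OF mv])
      qed
      also have "\<dots> < \<infinity>" using v2 K2 by (simp add: L2_def ennreal_mult_less_top)
      finally have "(\<lambda>z. K (snd z) * v (fst z)) \<in> L2 ?M"
        using Kv by (simp add: L2_def)
      from L2_mult_integrable[OF H2 this]
      have int: "integrable ?M (\<lambda>(x, s). H x s * (K s * v x))"
        by (simp add: split_beta')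
      have "(\<integral>x. pairing a \<sigma> b \<tau> N p h k (insert_at N (\<sigma> j) t x) * v x \<partial>HL 1)
          = (\<integral>x. \<integral>s. H x s * (K s * v x) \<partial>HL p \<partial>HL 1)"
        unfolding pairing_def left right
        by (simp only: integral_mult_left_zero[symmetric] mult.assoc)
      also have "\<dots> = (\<integral>s. \<integral>x. H x s * (K s * v x) \<partial>HL 1 \<partial>HL p)"
        by (rule HL2.Fubini_integral[OF int, symmetric])
      also have "\<dots> = (\<integral>s. (\<integral>x. H x s * v x \<partial>HL 1) * K s \<partial>HL p)"
      proof -
        have "(\<integral>x. H x s * (K s * v x) \<partial>HL 1) = (\<integral>x. H x s * v x \<partial>HL 1) * K s" for s
          by (subst integral_mult_left_zero[symmetric]) (simp only: ac_simps)
        then show ?thesis by (simp only:)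
      qed
      also have "\<dots> = 0"
      proof (rule integral_eq_zero_AE)
        show "AE s in HL p. (\<integral>x. H x s * v x \<partial>HL 1) * K s = 0"
          using elim(1) unfolding left' by eventually_elim (use v in simp)
      qed
      finally show "(\<integral>x. pairing a \<sigma> b \<tau> N p h k (insert_at N (\<sigma> j) t x) * v x \<partial>HL 1) = 0" .
    qed
  qed
qed

lemma AE_HL_ex:
  assumes "AE x in HL n. P x"
  shows "\<exists>x. P x"
proof (rule ccontr)
  assume "\<nexists>x. P x"
  then have "AE x in HL n. x \<notin> space (HL n)" using assms by simp
  then have "emeasure (HL n) (space (HL n)) = 0"
    by (subst (asm) AE_iff_measurable[OF sets.top]) auto
  moreover have "emeasure (HL n) (space (HL n)) = (\<Prod>i<n. emeasure half_line {0..})"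
    unfolding space_HL by (rule emeasure_HL_box) (use sets.top[of half_line] in \<open>simp add: space_restrict_space\<close>)
  moreover have "emeasure half_line {0..} \<noteq> 0"
  proof -
    have "emeasure half_line {0..} = emeasure lborel {0::real..}"
      by (subst emeasure_restrict_space) auto
    moreover have "emeasure lborel {0..1::real} \<le> emeasure lborel {0::real..}"
      by (rule emeasure_mono) auto
    ultimately show ?thesis by auto
  qed
  ultimately show False by simp
qed

text \<open>The inner integral over one contracted variable already vanishes. Here it matters that \<open>P\<close> and
  \<open>Q\<close> are chosen independently: after contraction the slices of \<open>h\<close> and \<open>k\<close> have the other contracted
  variables in common.\<close>

lemma pairing_eq_0:
  assumes P: "AE y in HL a. P y" and Q: "AE w in HL b. Q w"
    and orth: "\<And>y w. P y \<Longrightarrow> Q w \<Longrightarrow>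
       (\<integral>x. h (insert_at a j y x) * k (insert_at b j' w x) \<partial>HL 1) = 0"
    and j: "j < a" "\<sigma> j = N + p" "j' < b" "\<tau> j' = N + p"
    and \<sigma>: "inj_on \<sigma> {..<a}" "\<And>i. i < a \<Longrightarrow> \<sigma> i < N + (p + 1)"
    and \<tau>: "inj_on \<tau> {..<b}" "\<And>i. i < b \<Longrightarrow> \<tau> i < N + (p + 1)"
  shows "AE t in HL N. pairing a \<sigma> b \<tau> N (p + 1) h k t = 0"
proof -
  have "AE t in HL N. AE s in HL (p + 1). P (pull a \<sigma> (glue N (p + 1) t s))"
    by (rule AE_pull_glue[OF P \<sigma>(1)]) (rule \<sigma>(2))
  moreover have "AE t in HL N. AE s in HL (p + 1). Q (pull b \<tau> (glue N (p + 1) t s))"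
    by (rule AE_pull_glue[OF Q \<tau>(1)]) (rule \<tau>(2))
  ultimately show ?thesis
  proof eventually_elim
    case (elim t)
    define F where "F s = h (pull a \<sigma> (glue N (p + 1) t s)) * k (pull b \<tau> (glue N (p + 1) t s))" for s
    have "AE s in HL (p + 1). P (pull a \<sigma> (glue N (p + 1) t s)) \<and> Q (pull b \<tau> (glue N (p + 1) t s))"
      using elim by eventually_elim simp
    then have ae: "AE s in HL p. AE x in HL 1. P (pull a \<sigma> (glue N (p + 1) t (glue p 1 s x))) \<and>
        Q (pull b \<tau> (glue N (p + 1) t (glue p 1 s x)))"
      by (rule AE_glueD)
    have inner: "AE s in HL p. (\<integral>x. F (glue p 1 s x) \<partial>HL 1) = 0"
    proof (rule AE_mp[OF ae], rule AE_I2, rule impI)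
      fix s assume "AE x in HL 1. P (pull a \<sigma> (glue N (p + 1) t (glue p 1 s x))) \<and>
        Q (pull b \<tau> (glue N (p + 1) t (glue p 1 s x)))"
      \<comment> \<open>Any value \<open>x0\<close> of the inserted variable serves as a dummy for the overwritten coordinate.\<close>
      from AE_HL_ex[OF this] obtain x0 where
        x0: "P (pull a \<sigma> (glue N (p + 1) t (glue p 1 s x0)))"
          "Q (pull b \<tau> (glue N (p + 1) t (glue p 1 s x0)))" by blast
      have "\<sigma> i \<noteq> N + p" if "i < a" "i \<noteq> j" for i
        using \<sigma>(1) j that by (metis inj_onD lessThan_iff)
      then have "insert_at a j (pull a \<sigma> (glue N (p + 1) t (glue p 1 s x0))) x i
          = pull a \<sigma> (glue N (p + 1) t (glue p 1 s x)) i" for x i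
        using \<sigma>(2)[of i] j by (cases "i < a"; cases "i = j"; cases "\<sigma> i < N")
          (force simp: pull_def glue_def insert_at_eq)+
      then have l: "insert_at a j (pull a \<sigma> (glue N (p + 1) t (glue p 1 s x0))) x
          = pull a \<sigma> (glue N (p + 1) t (glue p 1 s x))" for x by blast
      have "\<tau> i \<noteq> N + p" if "i < b" "i \<noteq> j'" for i
        using \<tau>(1) j that by (metis inj_onD lessThan_iff)
      then have "insert_at b j' (pull b \<tau> (glue N (p + 1) t (glue p 1 s x0))) x i
          = pull b \<tau> (glue N (p + 1) t (glue p 1 s x)) i" for x i
        using \<tau>(2)[of i] j by (cases "i < b"; cases "i = j'"; cases "\<tau> i < N")
          (force simp: pull_def glue_def insert_at_eq)+
      then have r: "insert_at b j' (pull b \<tau> (glue N (p + 1) t (glue p 1 s x0))) x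
          = pull b \<tau> (glue N (p + 1) t (glue p 1 s x))" for x by blast
      show "(\<integral>x. F (glue p 1 s x) \<partial>HL 1) = 0"
        using orth[OF x0] unfolding l r F_def .
    qed
    have "(\<integral>s. F s \<partial>HL (p + 1)) = 0"
    proof (cases "integrable (HL (p + 1)) F")
      case True
      show ?thesis
        unfolding integral_glue[OF True] by (rule integral_eq_zero_AE[OF inner])
    qed (rule not_integrable_integral_eq)
    then show ?case by (simp add: pairing_def F_def)
  qed
qed

text \<open>By symmetry all slices of \<open>f\<close> may be taken in the last variable, and by the next lemma in the
  first one.\<close>

lemma AE_insert_at_last:
  assumes sym: "symmetric_kernel (n + 1) f" and i: "i < n + 1"
  shows "AE t in HL (n + 1). AE x in HL 1. f (insert_at (n + 1) i t x)
    = f (glue n 1 (pull n (\<lambda>k. if k = i then n else k) t) x)"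
proof -
  define \<tau> where "\<tau> = Transposition.transpose i n"
  have perm: "\<tau> permutes {..<n + 1}"
    unfolding \<tau>_def using i by (intro permutes_swap_id) auto
  have "AE t in HL (n + 1). AE x in HL 1.
      f (insert_at (n + 1) i t x) = f (pull (n + 1) \<tau> (insert_at (n + 1) i t x))"
    unfolding insert_at_def
    by (rule AE_pull_glue[OF symmetric_kernelD[OF sym perm]]) (use i in \<open>auto simp: inj_on_def\<close>)
  moreover have "pull (n + 1) \<tau> (insert_at (n + 1) i t x)
      = glue n 1 (pull n (\<lambda>k. if k = i then n else k) t) x" for t x
    using i by (auto simp: pull_def insert_at_eq glue_def \<tau>_def Transposition.transpose_def fun_eq_iff)
  ultimately show ?thesis by (simp only:)
qed

lemma AE_insert_at_first:
  assumes sym: "symmetric_kernel (1 + n) f" and i: "i < 1 + n"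
  shows "AE t in HL (1 + n). AE x in HL 1. f (insert_at (1 + n) i t x)
    = f (glue 1 n x (pull n (\<lambda>k. if k + 1 = i then 0 else k + 1) t))"
proof -
  define \<tau> where "\<tau> = Transposition.transpose i 0"
  have perm: "\<tau> permutes {..<1 + n}"
    unfolding \<tau>_def using i by (intro permutes_swap_id) auto
  have "AE t in HL (1 + n). AE x in HL 1.
      f (insert_at (1 + n) i t x) = f (pull (1 + n) \<tau> (insert_at (1 + n) i t x))"
    unfolding insert_at_def
    by (rule AE_pull_glue[OF symmetric_kernelD[OF sym perm]]) (use i in \<open>auto simp: inj_on_def\<close>)
  moreover have "pull (1 + n) \<tau> (insert_at (1 + n) i t x)
      = glue 1 n x (pull n (\<lambda>k. if k + 1 = i then 0 else k + 1) t)" for t x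
    using i by (auto simp: pull_def insert_at_eq glue_def \<tau>_def Transposition.transpose_def fun_eq_iff)
  ultimately show ?thesis by (simp only:)
qed

lemma measurable_insert_at:
  assumes "h \<in> borel_measurable (HL a)" "t \<in> space (HL a)" "i < a"
  shows "(\<lambda>x. h (insert_at a i t x)) \<in> borel_measurable (HL 1)"
  unfolding insert_at_def
  by (rule measurable_pull_glue[OF assms(2) _ assms(1)]) (use assms(3) in auto)

lemma slices_orthI_AE:
  assumes h: "h \<in> borel_measurable (HL a)" and i: "i < a"
    and eq: "AE t in HL a. AE x in HL 1. h (insert_at a i t x) = S t x"
    and S: "AE t in HL a. S t \<in> borel_measurable (HL 1) \<and> (\<forall>v\<in>V. (\<integral>x. S t x * v x \<partial>HL 1) = 0)"
    and V: "V \<subseteq> L2 (HL 1)"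
  shows "slices_orth V a i h"
  unfolding slices_orth_def using eq S AE_space
proof eventually_elim
  case (elim t)
  show ?case
  proof
    fix v assume v: "v \<in> V"
    note [measurable] = measurable_insert_at[OF h elim(3) i] elim(2)[THEN conjunct1]
    have [measurable]: "v \<in> borel_measurable (HL 1)" using v V by (auto simp: L2_def)
    have "(\<integral>x. h (insert_at a i t x) * v x \<partial>HL 1) = (\<integral>x. S t x * v x \<partial>HL 1)"
    proof (rule integral_cong_AE)
      show "AE x in HL 1. h (insert_at a i t x) * v x = S t x * v x"
        using elim(1) by eventually_elim simp
    qed measurable
    then show "(\<integral>x. h (insert_at a i t x) * v x \<partial>HL 1) = 0" using elim(2) v by simp
  qed
qed

text \<open>\<open>V\<close> consists of the slices of \<open>g\<close> with parameters in a set of full measure, and \<open>W\<close> is its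
  orthogonal complement (for the bilinear pairing), which contains almost all slices of \<open>f\<close>.\<close>

lemma separating_function_sets:
  assumes f: "f \<in> sq_integrable (n + 1)" "symmetric_kernel (n + 1) f"
    and g: "g \<in> sq_integrable (1 + m)" "symmetric_kernel (1 + m) g"
    and ae: "AE t in HL (n + m). contraction (n + 1) (1 + m) 1 f g t = 0"
  shows "\<exists>V W. V \<subseteq> L2 (HL 1) \<and> W = {w \<in> L2 (HL 1). \<forall>v\<in>V. (\<integral>x. w x * v x \<partial>HL 1) = 0} \<and>
    (\<forall>i<n + 1. slices_orth V (n + 1) i f) \<and> (\<forall>i<1 + m. slices_orth W (1 + m) i g)"
proof -
  have meas: "f \<in> borel_measurable (HL (n + 1))" "g \<in> borel_measurable (HL (1 + m))"
    using f g by (simp_all add: sq_integrable_iff)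
  define H where "H y x = f (glue n 1 y x)" for y x
  define R where "R w x = g (glue 1 m x w)" for w x
  have "AE y in HL n. AE w in HL m. contraction (n + 1) (1 + m) 1 f g (glue n m y w) = 0"
    by (rule AE_glueD[OF ae])
  moreover have "contraction (n + 1) (1 + m) 1 f g (glue n m y w) = (\<integral>x. H y x * R w x \<partial>HL 1)" for y w
  proof -
    have "(\<lambda>i\<in>{..<n + 1}. if i < n + 1 - 1 then glue n m y w i else x (i - (n + 1 - 1))) = glue n 1 y x" for x
      by (auto simp: glue_def)
    moreover have "(\<lambda>i\<in>{..<1 + m}. if i < 1 then x (1 - 1 - i) else glue n m y w (n + 1 - 1 + (i - 1)))
        = glue 1 m x w" for x
      unfolding glue_def
    proof (rule restrict_ext)
      fix i assume "i \<in> {..<1 + m}"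
      then show "(if i < 1 then x (1 - 1 - i)
          else (\<lambda>i\<in>{..<n + m}. if i < n then y i else w (i - n)) (n + 1 - 1 + (i - 1)))
          = (if i < 1 then x i else w (i - 1))"
        by (cases i) auto
    qed
    ultimately show ?thesis
      unfolding contraction_def H_def R_def by (simp only:)
  qed
  ultimately have orth: "AE y in HL n. AE w in HL m. (\<integral>x. H y x * R w x \<partial>HL 1) = 0"
    by (simp only:)
  have H2: "AE y in HL n. H y \<in> L2 (HL 1)"
  proof -
    have "AE y in HL n. (\<lambda>x. f (pull (n + 1) id (glue n 1 y x))) \<in> L2 (HL 1)"
      by (rule AE_slice_L2[OF f(1)]) auto
    moreover have "pull (n + 1) id (glue n 1 y x) = glue n 1 y x" for y x
      by (auto simp: pull_def glue_def)
    ultimately show ?thesis by (simp only: H_def[abs_def])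
  qed
  have R2: "AE w in HL m. R w \<in> L2 (HL 1)"
  proof -
    let ?\<sigma> = "\<lambda>i. if i = 0 then m else i - 1"
    have "AE w in HL m. (\<lambda>x. g (pull (1 + m) ?\<sigma> (glue m 1 w x))) \<in> L2 (HL 1)"
      by (rule AE_slice_L2[OF g(1)]) (auto simp: inj_on_def image_iff)
    moreover have "pull (1 + m) ?\<sigma> (glue m 1 w x) = glue 1 m x w" for w x
      by (auto simp: pull_def glue_def fun_eq_iff)
    ultimately show ?thesis by (simp only: R_def[abs_def])
  qed
  obtain P Q where PQ: "AE y in HL n. P y" "AE w in HL m. Q w"
    "\<And>y. P y \<Longrightarrow> H y \<in> L2 (HL 1)" "\<And>w. Q w \<Longrightarrow> R w \<in> L2 (HL 1)"
    "\<And>y w. P y \<Longrightarrow> Q w \<Longrightarrow> (\<integral>x. H y x * R w x \<partial>HL 1) = 0"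
    using orthogonal_slices_uniform[OF H2 R2 orth] by blast
  define V where "V = R ` Collect Q"
  define W where "W = {w \<in> L2 (HL 1). \<forall>v\<in>V. (\<integral>x. w x * v x \<partial>HL 1) = 0}"
  have V: "V \<subseteq> L2 (HL 1)" using PQ(4) by (auto simp: V_def)
  have "slices_orth V (n + 1) i f" if i: "i < n + 1" for i
  proof (rule slices_orthI_AE[OF meas(1) i AE_insert_at_last[OF f(2) i] _ V])
    have "AE t in HL (n + 1). P (pull n (\<lambda>k. if k = i then n else k) t)"
      by (rule AE_pull[OF PQ(1)]) (use i in \<open>auto simp: inj_on_def split: if_splits\<close>)
    then show "AE t in HL (n + 1).
        (\<lambda>x. f (glue n 1 (pull n (\<lambda>k. if k = i then n else k) t) x)) \<in> borel_measurable (HL 1) \<and>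
        (\<forall>v\<in>V. (\<integral>x. f (glue n 1 (pull n (\<lambda>k. if k = i then n else k) t) x) * v x \<partial>HL 1) = 0)"
      by (rule AE_mp) (rule AE_I2, use PQ(3,5) in \<open>auto simp: V_def L2_def H_def[abs_def]\<close>)
  qed
  moreover have "slices_orth W (1 + m) i g" if i: "i < 1 + m" for i
  proof (rule slices_orthI_AE[OF meas(2) i AE_insert_at_first[OF g(2) i]])
    have "AE t in HL (1 + m). Q (pull m (\<lambda>k. if k + 1 = i then 0 else k + 1) t)"
      by (rule AE_pull[OF PQ(2)]) (use i in \<open>auto simp: inj_on_def split: if_splits\<close>)
    then show "AE t in HL (1 + m).
        (\<lambda>x. g (glue 1 m x (pull m (\<lambda>k. if k + 1 = i then 0 else k + 1) t))) \<in> borel_measurable (HL 1) \<and>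
        (\<forall>v\<in>W. (\<integral>x. g (glue 1 m x (pull m (\<lambda>k. if k + 1 = i then 0 else k + 1) t)) * v x \<partial>HL 1) = 0)"
    proof (rule AE_mp, intro AE_I2 impI)
      fix t assume Q: "Q (pull m (\<lambda>k. if k + 1 = i then 0 else k + 1) t)"
      let ?w = "pull m (\<lambda>k. if k + 1 = i then 0 else k + 1) t"
      have "R ?w \<in> V" using Q by (simp add: V_def)
      then have "(\<integral>x. R ?w x * v x \<partial>HL 1) = 0" if "v \<in> W" for v
      proof -
        have "(\<integral>x. v x * R ?w x \<partial>HL 1) = 0" using that \<open>R ?w \<in> V\<close> unfolding W_def by blast
        then show ?thesis by (simp only: mult.commute)
      qed
      then show "(\<lambda>x. g (glue 1 m x ?w)) \<in> borel_measurable (HL 1) \<and>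
          (\<forall>v\<in>W. (\<integral>x. g (glue 1 m x ?w) * v x \<partial>HL 1) = 0)"
        using PQ(4)[OF Q] by (simp add: R_def[abs_def] L2_def)
    qed
  qed (auto simp: W_def)
  ultimately show ?thesis using V W_def by blast
qed

section \<open>Wigner integrals\<close>

context multiple_integral_L2
begin

context
  assumes wigner: "wigner_algebra A \<phi> \<iota> I"
begin

lemma wigner_alg: "unital_star_algebra A \<phi> \<iota> (integral_span I sq_integrable)"
  and wigner_prod: "f \<in> sq_integrable n \<Longrightarrow> g \<in> sq_integrable m \<Longrightarrow>
      has_product (I n f) (I m g)
        (\<Sum>p\<le>min n m. I (n + m - 2 * p) (contraction n m p f g))"
  using wigner by (auto simp: wigner_algebra_def)

lemma wigner_units:
  assumes "h \<in> sq_integrable a"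
  shows "has_product (L2_one \<iota>) (I a h) (I a h)"
    and "has_product (I a h) (L2_one \<iota>) (I a h)"
  using wigner_prod[OF const_sq_integrable_0 assms, of 1]
    wigner_prod[OF assms const_sq_integrable_0, of 1] I_unit_kernel[OF assms]
  by (simp_all add: I_one)

lemma wigner_free_imp:
  assumes f: "f \<in> sq_integrable n" "symmetric_kernel n f" "n \<ge> 1"
    and g: "g \<in> sq_integrable m" "symmetric_kernel m g" "m \<ge> 1"
    and free: "L2_free A \<phi> \<iota> [I n f, I m g]"
  shows "AE t in HL (n + m - 2). contraction n m 1 f g t = 0"
proof -
  have "AE t in HL (n + m - 2 * 1). contraction n m 1 f g t = 0"
  proof (rule free_imp_terms_0[OF wigner_alg kernel_space_sq_integrable wigner_units f g(1,2)
        _ _ _ _ _ _ wigner_prod[OF f(1) g(1)] free, where ?j0.0 = 0 and j = 1])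
    show "inj_on (\<lambda>p. n + m - 2 * p) {..min n m}"
      by (rule inj_onI) auto
  qed (use f g contraction_sq_integrable in auto)
  then show ?thesis by (simp only: mult.right_neutral)
qed

lemma wigner_imp_free:
  assumes f: "f \<in> sq_integrable n" "symmetric_kernel n f" "n \<ge> 1"
    and g: "g \<in> sq_integrable m" "symmetric_kernel m g" "m \<ge> 1"
    and ae: "AE t in HL (n + m - 2). contraction n m 1 f g t = 0"
  shows "L2_free A \<phi> \<iota> [I n f, I m g]"
proof -
  obtain n' m' where n': "n = n' + 1" and m': "m = 1 + m'"
    using f(3) g(3) by (metis add.commute le_Suc_ex)
  have "n + m - 2 = n' + m'" using n' m' by simp
  then have "AE t in HL (n' + m'). contraction (n' + 1) (1 + m') 1 f g t = 0"
    using ae n' m' by (simp only:)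
  then obtain V W where V: "V \<subseteq> L2 (HL 1)"
    and W: "W = {w \<in> L2 (HL 1). \<forall>v\<in>V. (\<integral>x. w x * v x \<partial>HL 1) = 0}"
    and fV: "\<And>i. i < n \<Longrightarrow> slices_orth V n i f" and gW: "\<And>i. i < m \<Longrightarrow> slices_orth W m i g"
    using separating_function_sets[of f n' g m'] f g unfolding n' m' by blast
  define D where "D i = (if i = 0 then V else W)" for i :: nat
  have D: "D i \<subseteq> L2 (HL 1)" for i using V W by (auto simp: D_def)
  define F where "F i a = {h \<in> sq_integrable a. \<forall>j<a. slices_orth (D i) a j h}" for i a
  define L where "L i a = {h \<in> sq_integrable a. 0 < a \<longrightarrow> slices_orth (D i) a 0 h}" for i a
  have F_space: "kernel_space (F i)" and L_space: "kernel_space (L i)" for i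
    unfolding kernel_space_def F_def L_def
    using sq_integrable_zero sq_integrable_add sq_integrable_scale slices_orth_zero slices_orth_scale
      slices_orth_add[OF D] by auto
  have left_coord: "slices_orth (D i) (a + b - 2 * p) j (contraction a b p h k)"
    if h: "h \<in> sq_integrable a" "slices_orth (D i) a j h" and k: "k \<in> sq_integrable b"
      and p: "p \<le> min a b" and j: "j < a - p" for i a b p h k j
  proof -
    have "contr_left a b p j = j" using j by (simp add: contr_left_def)
    moreover have "slices_orth (D i) (a + b - 2 * p) (contr_left a b p j) (contraction a b p h k)"
      unfolding contraction_eq_pairing[OF p]
    proof (rule slices_orth_pairing[OF D h k])
      show "j < a" "contr_left a b p j < a + b - 2 * p"
        using j p by (auto simp: contr_left_def)
      show "contr_left a b p j \<notin> contr_right a b p ` {..<b}"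
        using j p by (auto simp: contr_left_def contr_right_def split: if_splits)
      show "{a + b - 2 * p..<a + b - 2 * p + p} \<subseteq> contr_left a b p ` {..<a}"
        by (rule contr_left_onto[OF p])
      show "{a + b - 2 * p..<a + b - 2 * p + p} \<subseteq> contr_right a b p ` {..<b}"
        by (rule contr_right_onto[OF p])
    qed (intro inj_contr_left[OF p] inj_contr_right[OF p] contr_left_lt[OF p] contr_right_lt[OF p];
        assumption)+
    ultimately show ?thesis by simp
  qed
  have right_coord: "slices_orth (D i) (a + b - 2 * p) j (contraction a b p h k)"
    if h: "h \<in> sq_integrable a" and k: "k \<in> sq_integrable b" "slices_orth (D i) b (j - (a - p) + p) k"
      and p: "p \<le> min a b" and j: "\<not> j < a - p" "j < a + b - 2 * p" for i a b p h k j
  proof -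
    have "contr_right a b p (j - (a - p) + p) = j" using j by (simp add: contr_right_def)
    moreover have "slices_orth (D i) (a + b - 2 * p) (contr_right a b p (j - (a - p) + p))
        (contraction a b p h k)"
      unfolding contraction_eq_pairing[OF p] pairing_commute[of a]
    proof (rule slices_orth_pairing[OF D k h])
      show "j - (a - p) + p < b" "contr_right a b p (j - (a - p) + p) < a + b - 2 * p"
        using j p by (auto simp: contr_right_def)
      show "contr_right a b p (j - (a - p) + p) \<notin> contr_left a b p ` {..<a}"
        using j p by (auto simp: contr_left_def contr_right_def split: if_splits)
      show "{a + b - 2 * p..<a + b - 2 * p + p} \<subseteq> contr_left a b p ` {..<a}"
        by (rule contr_left_onto[OF p])
      show "{a + b - 2 * p..<a + b - 2 * p + p} \<subseteq> contr_right a b p ` {..<b}"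
        by (rule contr_right_onto[OF p])
    qed (intro inj_contr_left[OF p] inj_contr_right[OF p] contr_left_lt[OF p] contr_right_lt[OF p];
        assumption)+
    ultimately show ?thesis by simp
  qed
  have contraction_F: "contraction a b p h k \<in> F i (a + b - 2 * p)"
    if h: "h \<in> F i a" and k: "k \<in> F i b" and p: "p \<le> min a b" for i a b p h k
  proof -
    have "slices_orth (D i) (a + b - 2 * p) j (contraction a b p h k)" if j: "j < a + b - 2 * p" for j
    proof (cases "j < a - p")
      case True
      then show ?thesis using h k p by (intro left_coord) (auto simp: F_def)
    next
      case False
      moreover have "j - (a - p) + p < b" using False j p by auto
      ultimately show ?thesis using h k p j by (intro right_coord) (auto simp: F_def)
    qed
    then show ?thesis
      using h k contraction_sq_integrable p by (simp add: F_def)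
  qed
  have slices: "\<exists>P Q. (AE y in HL a. P y) \<and> (AE w in HL b. Q w) \<and> (\<forall>y w. P y \<longrightarrow> Q w \<longrightarrow>
      (\<integral>x. h (insert_at a ja y x) * k (insert_at b jb w x) \<partial>HL 1) = 0)"
    if h: "h \<in> sq_integrable a" "slices_orth V a ja h" "ja < a"
      and k: "k \<in> sq_integrable b" "slices_orth W b jb k" "jb < b" for a b h k ja jb
  proof (intro exI conjI)
    show "AE y in HL a. (\<lambda>x. h (insert_at a ja y x)) \<in> W"
      using AE_insert_at_L2[OF h(1,3)] h(2) unfolding slices_orth_def W
      by eventually_elim simp
    show "AE w in HL b. \<forall>v\<in>W. (\<integral>x. k (insert_at b jb w x) * v x \<partial>HL 1) = 0"
      using k(2) by (simp only: slices_orth_def)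
    show "\<forall>y w. (\<lambda>x. h (insert_at a ja y x)) \<in> W \<longrightarrow>
        (\<forall>v\<in>W. (\<integral>x. k (insert_at b jb w x) * v x \<partial>HL 1) = 0) \<longrightarrow>
        (\<integral>x. h (insert_at a ja y x) * k (insert_at b jb w x) \<partial>HL 1) = 0"
      by (auto simp: mult.commute)
  qed
  have contraction_0: "AE t in HL (a + b - 2 * p). contraction a b p h k t = 0"
    if ij: "i < 2" "j < 2" "i \<noteq> j" and h: "h \<in> F i a" and k: "k \<in> L j b"
      and p: "p \<in> {1..min a b}" for i j :: nat and a b p h k
  proof -
    obtain p' where p': "p = p' + 1" using p by (metis atLeastAtMost_iff le_add_diff_inverse2)
    have ple: "p \<le> min a b" using p by simp
    have ab: "0 < a" "0 < b" using p by auto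
    have h': "h \<in> sq_integrable a" "slices_orth (D i) a (a - 1) h" "a - 1 < a"
      and k': "k \<in> sq_integrable b" "slices_orth (D j) b 0 k"
      using h k ab by (auto simp: F_def L_def)
    have "\<exists>P Q. (AE y in HL a. P y) \<and> (AE w in HL b. Q w) \<and> (\<forall>y w. P y \<longrightarrow> Q w \<longrightarrow>
      (\<integral>x. h (insert_at a (a - 1) y x) * k (insert_at b 0 w x) \<partial>HL 1) = 0)"
    proof (cases "i = 0")
      case True
      then have "D i = V" "D j = W" using ij by (auto simp: D_def)
      then show ?thesis using slices h' k' ab by auto
    next
      case False
      then have D': "D i = W" "D j = V" using ij by (auto simp: D_def)
      then obtain P Q where "AE w in HL b. P w" "AE y in HL a. Q y"
        "\<And>w y. P w \<Longrightarrow> Q y \<Longrightarrow> (\<integral>x. k (insert_at b 0 w x) * h (insert_at a (a - 1) y x) \<partial>HL 1) = 0"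
        using slices[of k b 0 h a "a - 1"] h' k' ab by auto
      then show ?thesis
        by (intro exI[of _ Q] exI[of _ P]) (simp add: mult.commute)
    qed
    then obtain P Q where PQ: "AE y in HL a. P y" "AE w in HL b. Q w"
      "\<And>y w. P y \<Longrightarrow> Q w \<Longrightarrow>
        (\<integral>x. h (insert_at a (a - 1) y x) * k (insert_at b 0 w x) \<partial>HL 1) = 0" by blast
    have "AE t in HL (a + b - 2 * p). pairing a (contr_left a b p) b (contr_right a b p)
        (a + b - 2 * p) (p' + 1) h k t = 0"
    proof (rule pairing_eq_0[OF PQ])
      show "a - 1 < a" "0 < b" using ab by auto
      show "contr_left a b p (a - 1) = a + b - 2 * p + p'" "contr_right a b p 0 = a + b - 2 * p + p'"
        using ple p' by (auto simp: contr_left_def contr_right_def)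
    qed (use inj_contr_left[OF ple] inj_contr_right[OF ple] contr_left_lt[OF ple] contr_right_lt[OF ple]
        in \<open>simp_all add: p'\<close>)
    then show ?thesis
      unfolding contraction_eq_pairing[OF ple] p'[symmetric] .
  qed
  show ?thesis
  proof (rule L2_free_kernel_classes[where F = F and L = L])
    fix i a assume "0 < (a::nat)"
    then show "F i a \<subseteq> L i a" by (auto simp: F_def L_def)
  next
    fix i c show "(\<lambda>_. c) \<in> F i 0" by (simp add: F_def const_sq_integrable_0)
  next
    fix i a h assume "h \<in> L i a"
    then show "has_product (L2_one \<iota>) (I a h) (I a h)"
      by (intro wigner_units) (simp add: L_def)
  next
    fix i a h assume "h \<in> F i a"
    then show "has_product (I a h) (L2_one \<iota>) (I a h)"
      by (intro wigner_units) (simp add: F_def)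
  next
    fix i a b h k assume hk: "h \<in> F i a" "k \<in> F i b"
    show "\<exists>Z\<in>integral_span I (F i). has_product (I a h) (I b k) Z"
    proof (intro bexI)
      show "has_product (I a h) (I b k)
        (\<Sum>p\<le>min a b. I (a + b - 2 * p) (contraction a b p h k))"
        using hk by (intro wigner_prod) (simp_all add: F_def)
      show "(\<Sum>p\<le>min a b. I (a + b - 2 * p) (contraction a b p h k)) \<in> integral_span I (F i)"
        using contraction_F[OF hk]
        by (intro integral_span_sum[OF F_space] integral_span_memI[OF F_space]) auto
    qed
  next
    fix i j a b h k
    assume "i < length [I n f, I m g]" "j < length [I n f, I m g]" and ij: "i \<noteq> j"
      and ab: "0 < (a::nat)" "0 < (b::nat)" and h: "h \<in> F i a" and k: "k \<in> L j b"
    then have ij2: "i < 2" "j < 2" by auto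
    have hk: "h \<in> sq_integrable a" "k \<in> sq_integrable b" using h k by (auto simp: F_def L_def)
    have "I (a + b - 2 * p) (contraction a b p h k) = 0" if p: "p \<in> {1..min a b}" for p
      using contraction_0[OF ij2 ij h k p] I_eq_0_iff[OF contraction_sq_integrable[OF hk, of p]] p
      by simp
    moreover have "{..min a b} = insert 0 {1..min a b}" by auto
    ultimately have "has_product (I a h) (I b k) (I (a + b) (contraction a b 0 h k))"
      using wigner_prod[OF hk] by simp
    moreover have "contraction a b 0 h k \<in> positive_order (L i) (a + b)"
    proof -
      have "slices_orth (D i) (a + b - 2 * 0) 0 (contraction a b 0 h k)"
        using h hk ab by (intro left_coord) (auto simp: F_def)
      then show ?thesis
        using tensor_sq_integrable[OF hk] ab by (simp add: positive_order_def L_def)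
    qed
    ultimately show "\<exists>Z\<in>integral_span I (positive_order (L i)). has_product (I a h) (I b k) Z"
      using integral_span_memI[OF kernel_space_positive_order[OF L_space]] by blast
  next
    fix i assume "i < length [I n f, I m g]"
    then consider "i = 0" | "i = 1" by force
    then show "\<exists>a. \<exists>h\<in>F i a. [I n f, I m g] ! i = I a h"
    proof cases
      case 1
      have "f \<in> F 0 n" using f(1) fV by (simp add: F_def D_def)
      then show ?thesis using 1 by auto
    next
      case 2
      have "g \<in> F 1 m" using g(1) gW by (simp add: F_def D_def)
      then show ?thesis using 2 by auto
    qed
  qed (use F_space L_space in auto)
qed

end

end

section \<open>The characterization of freeness\<close>

theorem theorem3p3:
  fixes A :: "'h::complex_hilbert_space op set" and \<phi> :: "'h op \<Rightarrow> complex"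
    and \<iota> :: "'h op \<Rightarrow> 'l::complex_hilbert_space"
    and n m :: nat and f g :: kernel
  assumes "tracial_Wstar_space A \<phi>" and "L2_completion A \<phi> \<iota>"
    and "n \<ge> 1" and "m \<ge> 1"
    and "f \<in> sq_integrable n" and "g \<in> sq_integrable m"
    and "symmetric_kernel n f" and "symmetric_kernel m g"
  shows
    "(\<forall>S IS. free_brownian_motion A \<phi> S \<and> multiple_integral A \<phi> \<iota> S IS \<and>
        wigner_algebra A \<phi> \<iota> IS \<longrightarrow>
        (L2_free A \<phi> \<iota> [IS n f, IS m g] \<longleftrightarrow>
          (AE t in half_line_power (n + m - 2). contraction n m 1 f g t = 0))) \<and>
     (\<forall>N IN K. free_poisson_process A \<phi> N \<and> multiple_integral A \<phi> \<iota> (compensated N) IN \<and>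
        free_poisson_algebra A \<phi> \<iota> IN K \<and> f \<in> K n \<and> g \<in> K m \<longrightarrow>
        (L2_free A \<phi> \<iota> [IN n f, IN m g] \<longleftrightarrow>
          (AE t in half_line_power (n + m - 1). star_contraction n m 1 f g t = 0)))"
proof (intro conjI allI impI; elim conjE)
  interpret tracial_L2 A \<phi> \<iota>
    using assms by (simp add: tracial_L2_def)
  fix S IS
  assume mi: "multiple_integral A \<phi> \<iota> S IS" and alg: "wigner_algebra A \<phi> \<iota> IS"
  interpret multiple_integral_L2 A \<phi> \<iota> S IS
    by unfold_locales (rule mi)
  show "L2_free A \<phi> \<iota> [IS n f, IS m g] \<longleftrightarrow>
      (AE t in half_line_power (n + m - 2). contraction n m 1 f g t = 0)"
    using wigner_free_imp[OF alg] wigner_imp_free[OF alg] assms by blast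
next
  interpret tracial_L2 A \<phi> \<iota>
    using assms by (simp add: tracial_L2_def)
  fix N IN K
  assume mi: "multiple_integral A \<phi> \<iota> (compensated N) IN"
    and alg: "free_poisson_algebra A \<phi> \<iota> IN K" and K: "f \<in> K n" "g \<in> K m"
  interpret multiple_integral_L2 A \<phi> \<iota> "compensated N" IN
    by unfold_locales (rule mi)
  show "L2_free A \<phi> \<iota> [IN n f, IN m g] \<longleftrightarrow>
      (AE t in half_line_power (n + m - 1). star_contraction n m 1 f g t = 0)"
    using poisson_free_imp[OF alg] poisson_imp_free[OF alg] K assms by blast
qed

end
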